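(* Let $M$ be an $n$-dimensional, orientable, path-connected and compact $C^\infty$-submanifold of $\mathbb{R}^{n+1}$, possibly with non-empty boundary $\partial M$ of $C^\infty$-regularity. Let $g^M:M\to(0,\infty)$ and, for each $\varphi\in\operatorname{Emb}_{\partial M}(M,\mathbb{R}^{n+1})$, $f_\varphi:\varphi(M)\to(0,\infty)$ be $C^\infty$-functions, with $f$ having shape functionality and $$\int_{\varphi(M)}f_\varphi(s)\,ds=\int_Mg^M(s)\,ds\qquad\forall\varphi\in\operatorname{Emb}_{\partial M}(M,\mathbb{R}^{n+1}).$$ Let $$\mathfrak{J}^\tau(\varphi):=\frac12\int_{\varphi(M)}\Big(g^M\circ\varphi^{-1}(s)\cdot\frac{1}{\det D^\tau\varphi\circ\varphi^{-1}(s)}-f_\varphi(s)\Big)^2ds .$$ Also assume enough regularity for $f_\varphi$ such that its pre-shape material derivatives exist. Then, for fixed $\varphi\in\operatorname{Emb}_{\partial M}(M,\mathbb{R}^{n+1})$ and $V\in C^\infty_{\partial\varphi(M)}(\mathbb{R}^{n+1},\mathbb{R}^{n+1})$, the pre-shape derivative of $\mathfrak{J}^\tau$ is given by $$\mathfrak{D}\mathfrak{J}^\tau(\varphi)[V]=-\int_{\varphi(M)}\frac12\Big(\big(g^M\circ\varphi^{-1}\cdot\tfrac{1}{\det D^\tau\varphi}\circ\varphi^{-1}\big)^2-f_\varphi^2\Big)\operatorname{div}_\Gamma(V)+\Big(g^M\circ\varphi^{-1}\cdot\tfrac{1}{\det D^\tau\varphi}\circ\varphi^{-1}-f_\varphi\Big)\cdot\mathfrak{D}_m(f_\varphi)[V]\,ds,$$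 with $\mathfrak{D}_m(f_\varphi)$ the pre-shape material derivative of $f_\varphi$ and $\operatorname{div}_\Gamma$ the tangential divergence on $\varphi(M)$. The pre-shape derivative does not depend on the choice of oriented local orthonormal frames $\tau,\tau^\varphi$ used to represent the covariant derivative $D^\tau$.
   Context: $\operatorname{Emb}(M,\mathbb{R}^{n+1})$ is the space of $C^\infty$-embeddings $M\to\mathbb{R}^{n+1}$ and $\operatorname{Emb}_{\partial M}(M,\mathbb{R}^{n+1}):=\{\varphi\in\operatorname{Emb}(M,\mathbb{R}^{n+1}):\varphi(p)=p\ \forall p\in\partial M\}$ (all of $\operatorname{Emb}(M,\mathbb{R}^{n+1})$ if $\partial M=\varnothing$). Shape functionality of $f$ means $f_{\varphi\circ\rho}=f_\varphi$ for all $\rho\in\operatorname{Diff}(M)$ and $\varphi$ with $\varphi,\varphi\circ\rho\in\operatorname{Emb}_{\partial M}(M,\mathbb{R}^{n+1})$. $C^\infty_{\partial\varphi(M)}(\mathbb{R}^{n+1},\mathbb{R}^{n+1})$ is the space of $V\in C^\infty(\mathbb{R}^{n+1},\mathbb{R}^{n+1})$ vanishing on $\partial\varphi(M)=\partial M$. $M$ and $\varphi(M)$ carry the Riemannian metrics and surface measures $ds$ induced from $\mathbb{R}^{n+1}$. For smooth local orthonormal frames $\tau=(\tau_1,\dots,\tau_n)$ on an open $U\subseteq M$ and $\tau^\varphi=(\tau^\varphi_1,\dots,\tau^\varphi_n)$ on $\varphi(U)$, the covariant derivative is the $n\times n$ matrix $D^\tau\varphi(p):=(\langle D\varphi\,\tau_{j,p},\tau^\varphi_{i,\varphi(p)}\rangle)_{i,j}$.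 Frames are taken positively oriented with respect to a fixed orientation of $M$ and the orientation of $\varphi(M)$ transported from $M$ via $\varphi$ (so $\det D^\tau\varphi>0$). For a direction $V$ put $\varphi_t:=\varphi+t\cdot V\circ\varphi$ and $x_t:=x_0+tV(x_0)$ for small $t\ge0$. The pre-shape derivative is $\mathfrak{D}\mathfrak{J}(\varphi)[V]:=\lim_{t\downarrow0}\frac{\mathfrak{J}(\varphi_t)-\mathfrak{J}(\varphi)}{t}$. The pre-shape material derivative of the family $f_\varphi$ at $x_0\in\varphi(M)$ is $\mathfrak{D}_m(f_\varphi)[V](x_0):=\frac{d}{dt}\big|_{t=0}f_{\varphi_t}(x_t)$ (well-defined since $x_t\in\varphi_t(M)$). The tangential divergence on $\varphi(M)$ is $\operatorname{div}_\Gamma(V)=\sum_{i=1}^n\langle DV\,e_i,e_i\rangle$ for any orthonormal basis $(e_i)$ of the tangent space of $\varphi(M)$.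
   Formalization: "Enough regularity" for f means that all pre-shape material derivatives exist at every point and that the difference quotients of f along x_t are bounded uniformly in the point for small t; pointwise existence alone does not suffice for the formula. *)

theory Defs
  imports "HOL-Analysis.Analysis"
begin

text \<open>The dimension $n$ is \<open>CARD('n)\<close>, so charts live in \<open>real^'n\<close> and the ambient
  space $R^{n+1}$ is \<open>real^('n option)\<close>, because \<open>CARD('n option) = CARD('n) + 1\<close>.\<close>

type_synonym 'n ambient = "real ^ ('n option)"

subsection \<open>Smooth maps\<close>

text \<open>Only meaningful for open \<open>S\<close>. In finite dimension, all iterated directional derivatives
  being continuous is the usual notion of $C^k$.\<close>

primrec Ck_on :: "nat \<Rightarrow> 'a::real_normed_vector set \<Rightarrow> ('a \<Rightarrow> 'b::real_normed_vector) \<Rightarrow> bool" where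
  "Ck_on 0 S f \<longleftrightarrow> continuous_on S f"
| "Ck_on (Suc k) S f \<longleftrightarrow> (\<forall>x\<in>S. f differentiable (at x)) \<and>
     (\<forall>v. Ck_on k S (\<lambda>x. frechet_derivative f (at x) v))"

definition smooth_on :: "'a::real_normed_vector set \<Rightarrow> ('a \<Rightarrow> 'b::real_normed_vector) \<Rightarrow> bool" where
  "smooth_on S f \<longleftrightarrow> (\<forall>k. Ck_on k S f)"

text \<open>Smoothness on a (relatively open part of a) submanifold: local smooth extendability.\<close>

definition smooth_map_on :: "'a::real_normed_vector set \<Rightarrow> ('a \<Rightarrow> 'b::real_normed_vector) \<Rightarrow> bool" where
  "smooth_map_on M h \<longleftrightarrow>
     (\<forall>p\<in>M. \<exists>U F. open U \<and> p \<in> U \<and> smooth_on U F \<and> (\<forall>x\<in>U \<inter> M. F x = h x))"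

subsection \<open>Hypersurfaces with boundary\<close>

definition half_space :: "'n::finite \<Rightarrow> (real^'n) set" where
  "half_space k = {w. 0 \<le> w $ k}"

text \<open>The chart domain is \<open>Q \<inter> half_space k\<close>; taking \<open>Q\<close> inside the open half space gives the
  charts of the interior.\<close>

definition local_parametrization ::
    "('n::finite) ambient set \<Rightarrow> 'n \<Rightarrow> (real^'n) set \<Rightarrow> (real^'n \<Rightarrow> 'n ambient) \<Rightarrow> bool" where
  "local_parametrization M k Q X \<longleftrightarrow>
     open Q \<and> smooth_on Q X \<and>
     openin (top_of_set M) (X ` (Q \<inter> half_space k)) \<and>
     (\<exists>Y. homeomorphism (Q \<inter> half_space k) (X ` (Q \<inter> half_space k)) X Y) \<and>
     (\<forall>w\<in>Q \<inter> half_space k. inj (frechet_derivative X (at w)))"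

definition submanifold :: "('n::finite) ambient set \<Rightarrow> bool" where
  "submanifold M \<longleftrightarrow>
     (\<forall>p\<in>M. \<exists>k Q X. local_parametrization M k Q X \<and> p \<in> X ` (Q \<inter> half_space k))"

definition mfd_boundary :: "('n::finite) ambient set \<Rightarrow> 'n ambient set" where
  "mfd_boundary M =
     {p. \<exists>k Q X w. local_parametrization M k Q X \<and> w \<in> Q \<and> w $ k = 0 \<and> X w = p}"

definition tangent_space :: "('n::finite) ambient set \<Rightarrow> 'n ambient \<Rightarrow> 'n ambient set" where
  "tangent_space M p =
     {v. \<exists>k Q X w u. local_parametrization M k Q X \<and> w \<in> Q \<inter> half_space k \<and> X w = p \<and>
           v = frechet_derivative X (at w) u}"

text \<open>The differential of a map \<open>h\<close> on \<open>M\<close> is \<open>frechet_derivative h (at p within M)\<close>. That linear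
  map is not unique on the ambient space, but its restriction to \<open>tangent_space M p\<close> is (also at
  boundary points), and below it is only ever applied to tangent vectors.\<close>

abbreviation differential ::
    "('n::finite) ambient set \<Rightarrow> ('n ambient \<Rightarrow> 'n ambient) \<Rightarrow> 'n ambient \<Rightarrow> 'n ambient \<Rightarrow> 'n ambient" where
  "differential M h p \<equiv> frechet_derivative h (at p within M)"

text \<open>The Riemannian surface measure of the metric induced from the ambient space: on each chart
  image it has the density $\sqrt{\det (\langle\partial_i X,\partial_j X\rangle)_{ij}}$ with
  respect to Lebesgue measure. This determines the measure uniquely.\<close>

definition area_density :: "(real^'n::finite \<Rightarrow> 'n ambient) \<Rightarrow> real^'n \<Rightarrow> real" where
  "area_density X w =
     sqrt (det (\<chi> i j. frechet_derivative X (at w) (axis i 1) \<bullet>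
                       frechet_derivative X (at w) (axis j 1) :: real^'n^'n))"

definition surface_measure :: "('n::finite) ambient set \<Rightarrow> 'n ambient measure" where
  "surface_measure M = (THE \<mu>. sets \<mu> = sets (restrict_space borel M) \<and>
     (\<forall>k Q X A. local_parametrization M k Q X \<and> A \<in> sets \<mu> \<and> A \<subseteq> X ` (Q \<inter> half_space k) \<longrightarrow>
        emeasure \<mu> A =
          (\<integral>\<^sup>+w\<in>{w \<in> Q \<inter> half_space k. X w \<in> A}. ennreal (area_density X w) \<partial>lborel)))"

subsection \<open>Orientations and frames\<close>

definition tangent_basis :: "('n::finite) ambient set \<Rightarrow> 'n ambient \<Rightarrow> ('n \<Rightarrow> 'n ambient) \<Rightarrow> bool" where
  "tangent_basis M p b \<longleftrightarrow>
     (\<forall>i. b i \<in> tangent_space M p) \<and> inj b \<and> independent (range b)"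

definition same_orientation :: "('n::finite \<Rightarrow> 'n ambient) \<Rightarrow> ('n \<Rightarrow> 'n ambient) \<Rightarrow> bool" where
  "same_orientation b c \<longleftrightarrow>
     (\<exists>A::real^'n^'n. 0 < det A \<and> (\<forall>j. c j = (\<Sum>i\<in>UNIV. A $ i $ j *\<^sub>R b i)))"

text \<open>An orientation assigns to each point an equivalence class of bases of the tangent space
  (the positively oriented ones) that contains a continuous frame near every point. \<open>M\<close> is
  orientable iff an orientation exists.\<close>

definition orientation_on ::
    "('n::finite) ambient set \<Rightarrow> ('n ambient \<Rightarrow> ('n \<Rightarrow> 'n ambient) set) \<Rightarrow> bool" where
  "orientation_on M ori \<longleftrightarrow> (\<forall>p\<in>M.
     (\<exists>b. tangent_basis M p b \<and> ori p = {c. same_orientation b c}) \<and>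
     (\<exists>U b. openin (top_of_set M) U \<and> p \<in> U \<and>
        (\<forall>j. continuous_on U (\<lambda>q. b q j)) \<and> (\<forall>q\<in>U. b q \<in> ori q)))"

definition transported_orientation ::
    "('n::finite) ambient set \<Rightarrow> ('n ambient \<Rightarrow> 'n ambient) \<Rightarrow>
     ('n ambient \<Rightarrow> ('n \<Rightarrow> 'n ambient) set) \<Rightarrow> ('n ambient \<Rightarrow> ('n \<Rightarrow> 'n ambient) set)" where
  "transported_orientation M \<phi> ori x =
     (let p = inv_into M \<phi> x in (\<lambda>b i. differential M \<phi> p (b i)) ` ori p)"

definition orthonormal_basis_at ::
    "('n::finite) ambient set \<Rightarrow> 'n ambient \<Rightarrow> ('n \<Rightarrow> 'n ambient) \<Rightarrow> bool" where
  "orthonormal_basis_at M p e \<longleftrightarrow>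
     (\<forall>i. e i \<in> tangent_space M p) \<and> (\<forall>i j. e i \<bullet> e j = (if i = j then 1 else 0))"

definition oriented_orthonormal_frame ::
    "('n::finite) ambient set \<Rightarrow> ('n ambient \<Rightarrow> ('n \<Rightarrow> 'n ambient) set) \<Rightarrow> 'n ambient set \<Rightarrow>
     ('n ambient \<Rightarrow> 'n \<Rightarrow> 'n ambient) \<Rightarrow> bool" where
  "oriented_orthonormal_frame M ori U e \<longleftrightarrow>
     openin (top_of_set M) U \<and> (\<forall>j. smooth_map_on U (\<lambda>q. e q j)) \<and>
     (\<forall>q\<in>U. orthonormal_basis_at M q (e q) \<and> e q \<in> ori q)"

text \<open>Global frames need not exist, so a choice of frames attaches to every point \<open>p\<close> a smooth
  local frame \<open>\<tau> p\<close> on a neighbourhood of \<open>p\<close>.\<close>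

definition frame_choice ::
    "('n::finite) ambient set \<Rightarrow> ('n ambient \<Rightarrow> ('n \<Rightarrow> 'n ambient) set) \<Rightarrow>
     ('n ambient \<Rightarrow> 'n ambient \<Rightarrow> 'n \<Rightarrow> 'n ambient) \<Rightarrow> bool" where
  "frame_choice M ori \<tau> \<longleftrightarrow> (\<forall>p\<in>M. \<exists>U. p \<in> U \<and> oriented_orthonormal_frame M ori U (\<tau> p))"

text \<open>\<open>\<tau>\<close> is a choice of frames on \<open>M\<close>, \<open>\<sigma>\<close> one on \<open>\<phi> ` M\<close>.\<close>

definition cov_deriv ::
    "('n::finite) ambient set \<Rightarrow> ('n ambient \<Rightarrow> 'n ambient \<Rightarrow> 'n \<Rightarrow> 'n ambient) \<Rightarrow>
     ('n ambient \<Rightarrow> 'n ambient \<Rightarrow> 'n \<Rightarrow> 'n ambient) \<Rightarrow> ('n ambient \<Rightarrow> 'n ambient) \<Rightarrow>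
     'n ambient \<Rightarrow> real^'n^'n" where
  "cov_deriv M \<tau> \<sigma> \<phi> p =
     (\<chi> i j. differential M \<phi> p (\<tau> p p j) \<bullet> \<sigma> (\<phi> p) (\<phi> p) i)"

definition tang_div ::
    "('n::finite) ambient set \<Rightarrow> ('n ambient \<Rightarrow> 'n ambient) \<Rightarrow> 'n ambient \<Rightarrow> real" where
  "tang_div S V x =
     (let e = (SOME e. orthonormal_basis_at S x e)
      in \<Sum>i\<in>UNIV. frechet_derivative V (at x) (e i) \<bullet> e i)"

subsection \<open>Embeddings and directions\<close>

text \<open>Maps on \<open>M\<close> are represented as extensional functions, so that equality of functions is
  equality on \<open>M\<close>.\<close>

definition Emb :: "('n::finite) ambient set \<Rightarrow> ('n ambient \<Rightarrow> 'n ambient) set" where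
  "Emb M = {\<phi> \<in> extensional M. smooth_map_on M \<phi> \<and>
     (\<exists>\<psi>. homeomorphism M (\<phi> ` M) \<phi> \<psi>) \<and>
     (\<forall>p\<in>M. inj_on (differential M \<phi> p) (tangent_space M p))}"

definition Emb_bd :: "('n::finite) ambient set \<Rightarrow> ('n ambient \<Rightarrow> 'n ambient) set" where
  "Emb_bd M = {\<phi> \<in> Emb M. \<forall>p\<in>mfd_boundary M. \<phi> p = p}"

definition Diff :: "('n::finite) ambient set \<Rightarrow> ('n ambient \<Rightarrow> 'n ambient) set" where
  "Diff M = {\<rho> \<in> extensional M. bij_betw \<rho> M M \<and>
     smooth_map_on M \<rho> \<and> smooth_map_on M (inv_into M \<rho>)}"

definition directions ::
    "('n::finite) ambient set \<Rightarrow> ('n ambient \<Rightarrow> 'n ambient) \<Rightarrow> ('n ambient \<Rightarrow> 'n ambient) set" where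
  "directions M \<phi> = {V. smooth_on UNIV V \<and> (\<forall>x\<in>mfd_boundary (\<phi> ` M). V x = 0)}"

definition perturb ::
    "('n::finite) ambient set \<Rightarrow> ('n ambient \<Rightarrow> 'n ambient) \<Rightarrow> ('n ambient \<Rightarrow> 'n ambient) \<Rightarrow>
     real \<Rightarrow> 'n ambient \<Rightarrow> 'n ambient" where
  "perturb M \<phi> V t = (\<lambda>p\<in>M. \<phi> p + t *\<^sub>R V (\<phi> p))"

definition shape_functionality ::
    "('n::finite) ambient set \<Rightarrow> (('n ambient \<Rightarrow> 'n ambient) \<Rightarrow> 'n ambient \<Rightarrow> real) \<Rightarrow> bool" where
  "shape_functionality M f \<longleftrightarrow>
     (\<forall>\<phi>\<in>Emb_bd M. \<forall>\<rho>\<in>Diff M. compose M \<phi> \<rho> \<in> Emb_bd M \<longrightarrow>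
        (\<forall>x\<in>\<phi> ` M. f (compose M \<phi> \<rho>) x = f \<phi> x))"

subsection \<open>Pre-shape and material derivatives\<close>

definition has_preshape_deriv ::
    "('n::finite) ambient set \<Rightarrow> (('n ambient \<Rightarrow> 'n ambient) \<Rightarrow> real) \<Rightarrow>
     ('n ambient \<Rightarrow> 'n ambient) \<Rightarrow> ('n ambient \<Rightarrow> 'n ambient) \<Rightarrow> real \<Rightarrow> bool" where
  "has_preshape_deriv M J \<phi> V D \<longleftrightarrow>
     ((\<lambda>t. (J (perturb M \<phi> V t) - J \<phi>) / t) \<longlongrightarrow> D) (at_right 0)"

definition preshape_deriv ::
    "('n::finite) ambient set \<Rightarrow> (('n ambient \<Rightarrow> 'n ambient) \<Rightarrow> real) \<Rightarrow>
     ('n ambient \<Rightarrow> 'n ambient) \<Rightarrow> ('n ambient \<Rightarrow> 'n ambient) \<Rightarrow> real" where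
  "preshape_deriv M J \<phi> V = Lim (at_right 0) (\<lambda>t. (J (perturb M \<phi> V t) - J \<phi>) / t)"

text \<open>The derivatives are one-sided because \<open>perturb M \<phi> V t\<close> is considered for \<open>t \<ge> 0\<close> only.\<close>

definition material_deriv ::
    "('n::finite) ambient set \<Rightarrow> (('n ambient \<Rightarrow> 'n ambient) \<Rightarrow> 'n ambient \<Rightarrow> real) \<Rightarrow>
     ('n ambient \<Rightarrow> 'n ambient) \<Rightarrow> ('n ambient \<Rightarrow> 'n ambient) \<Rightarrow> 'n ambient \<Rightarrow> real" where
  "material_deriv M f \<phi> V x =
     vector_derivative (\<lambda>t. f (perturb M \<phi> V t) (x + t *\<^sub>R V x)) (at 0 within {0..})"

text \<open>Enough regularity for material derivatives: they exist at every point, and the difference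
  quotients are uniformly bounded for small \<open>t\<close>. The bound is needed to differentiate under the
  integral sign and is automatic if the pointwise limits are attained uniformly.\<close>

definition materially_regular ::
    "('n::finite) ambient set \<Rightarrow> (('n ambient \<Rightarrow> 'n ambient) \<Rightarrow> 'n ambient \<Rightarrow> real) \<Rightarrow> bool" where
  "materially_regular M f \<longleftrightarrow> (\<forall>\<phi>\<in>Emb_bd M. \<forall>V\<in>directions M \<phi>.
     (\<forall>x\<in>\<phi> ` M. (\<lambda>t. f (perturb M \<phi> V t) (x + t *\<^sub>R V x)) differentiable (at 0 within {0..})) \<and>
     (\<exists>C. \<forall>\<^sub>F t in at_right 0. \<forall>x\<in>\<phi> ` M.
        \<bar>f (perturb M \<phi> V t) (x + t *\<^sub>R V x) - f \<phi> x\<bar> \<le> C * t))"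

subsection \<open>The functional\<close>

text \<open>$g^M\circ\varphi^{-1}\cdot\frac{1}{\det D^\tau\varphi}\circ\varphi^{-1}$ as a function on
  \<open>\<phi> ` M\<close>; the frames on \<open>\<phi> ` M\<close> are \<open>\<sigma> \<phi>\<close>.\<close>

definition pushed_density ::
    "('n::finite) ambient set \<Rightarrow> ('n ambient \<Rightarrow> real) \<Rightarrow>
     ('n ambient \<Rightarrow> 'n ambient \<Rightarrow> 'n \<Rightarrow> 'n ambient) \<Rightarrow>
     (('n ambient \<Rightarrow> 'n ambient) \<Rightarrow> 'n ambient \<Rightarrow> 'n ambient \<Rightarrow> 'n \<Rightarrow> 'n ambient) \<Rightarrow>
     ('n ambient \<Rightarrow> 'n ambient) \<Rightarrow> 'n ambient \<Rightarrow> real" where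
  "pushed_density M g \<tau> \<sigma> \<phi> s =
     g (inv_into M \<phi> s) * (1 / det (cov_deriv M \<tau> (\<sigma> \<phi>) \<phi> (inv_into M \<phi> s)))"

definition J_functional ::
    "('n::finite) ambient set \<Rightarrow> ('n ambient \<Rightarrow> real) \<Rightarrow>
     (('n ambient \<Rightarrow> 'n ambient) \<Rightarrow> 'n ambient \<Rightarrow> real) \<Rightarrow>
     ('n ambient \<Rightarrow> 'n ambient \<Rightarrow> 'n \<Rightarrow> 'n ambient) \<Rightarrow>
     (('n ambient \<Rightarrow> 'n ambient) \<Rightarrow> 'n ambient \<Rightarrow> 'n ambient \<Rightarrow> 'n \<Rightarrow> 'n ambient) \<Rightarrow>
     ('n ambient \<Rightarrow> 'n ambient) \<Rightarrow> real" where
  "J_functional M g f \<tau> \<sigma> \<phi> =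
     1 / 2 * (\<integral>s. (pushed_density M g \<tau> \<sigma> \<phi> s - f \<phi> s)\<^sup>2 \<partial>surface_measure (\<phi> ` M))"

definition frame_system ::
    "('n::finite) ambient set \<Rightarrow> ('n ambient \<Rightarrow> ('n \<Rightarrow> 'n ambient) set) \<Rightarrow>
     ('n ambient \<Rightarrow> 'n ambient \<Rightarrow> 'n \<Rightarrow> 'n ambient) \<Rightarrow>
     (('n ambient \<Rightarrow> 'n ambient) \<Rightarrow> 'n ambient \<Rightarrow> 'n ambient \<Rightarrow> 'n \<Rightarrow> 'n ambient) \<Rightarrow> bool" where
  "frame_system M ori \<tau> \<sigma> \<longleftrightarrow>
     frame_choice M ori \<tau> \<and>
     (\<forall>\<phi>\<in>Emb_bd M. frame_choice (\<phi> ` M) (transported_orientation M \<phi> ori) (\<sigma> \<phi>))"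

end

theory Submission
  imports Defs
begin

text \<open>
  Why the formula holds. For small \<open>t\<close> the perturbed embedding is \<open>\<phi>\<close> followed by the ambient map
  \<open>x \<mapsto> x + t V x\<close>. With respect to oriented orthonormal frames, the determinant of the covariant
  derivative of an embedding is the square root of the Gram determinant of the images of an
  orthonormal tangent basis (\<open>det_cov_deriv\<close>), that is, its Jacobian \<open>J\<close>; in particular the
  frames disappear from the functional. The same Jacobian occurs in the area formula
  (\<open>surface_measure_image\<close>), which moves all integrals to the fixed surface \<open>M\<close>:

  \<open>J_functional \<phi>\<^sub>t = \<integral>\<^sub>M 1/2 * J\<^sub>t * (g / J\<^sub>t - f\<^sub>t \<circ> \<phi>\<^sub>t)\<^sup>2 =
  \<integral>\<^sub>M 1/2 * (g\<^sup>2 / J\<^sub>t - 2 * g * (f\<^sub>t \<circ> \<phi>\<^sub>t) + J\<^sub>t * (f\<^sub>t \<circ> \<phi>\<^sub>t)\<^sup>2)\<close>.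

  Jacobians multiply (\<open>jacobian_perturb\<close>): \<open>J\<^sub>t = J * j\<^sub>t\<close>, where \<open>j\<^sub>t\<close> is the Jacobian of
  \<open>x \<mapsto> x + t V x\<close> along the image. Since the derivative of the determinant at the identity is the
  trace, \<open>j\<^sub>t\<close> has derivative \<open>div V\<close> at \<open>t = 0\<close> (\<open>sqrt_gram_has_derivative\<close>), while
  \<open>f\<^sub>t \<circ> \<phi>\<^sub>t\<close> has the material derivative as its derivative by definition. The derivative of the
  integrand is therefore minus \<open>J\<close> times the integrand of the claim, and moving back to the image
  absorbs \<open>J\<close>. Differentiation under the integral sign is dominated convergence, with the constant
  from \<open>misfit_quotient_bound\<close>.

  Most of the work is to give these steps a meaning. The surface measure is a definite description,
  so its existence and uniqueness on compact surfaces have to be shown (\<open>ex1_surface_measure\<close>). They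
  rest on the agreement of the areas computed in overlapping parametrizations
  (\<open>chart_area_consistent\<close>), which is the change of variables formula along a transition map. Such a
  map is differentiable up to the boundary because the inverse of a parametrization is differentiable
  along the surface (\<open>has_derivative_inverse_within\<close>), and its derivative is unique at boundary points
  too (\<open>half_space_derivative_unique\<close>). Finally, the perturbed maps have to be embeddings that fix
  the boundary (\<open>perturb_in_Emb_bd\<close>).
\<close>

section \<open>Closure properties of smooth maps\<close>

lemma frechet_derivative_cong_open:
  assumes "open S" "x \<in> S" "\<And>y. y \<in> S \<Longrightarrow> f y = g y"
  shows "frechet_derivative f (at x) = frechet_derivative g (at x)"
    and "f differentiable (at x) \<longleftrightarrow> g differentiable (at x)"
proof -
  have "(f has_derivative D) (at x) \<longleftrightarrow> (g has_derivative D) (at x)" for D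
    using assms has_derivative_transform_within_open by metis
  then show "frechet_derivative f (at x) = frechet_derivative g (at x)"
    and "f differentiable (at x) \<longleftrightarrow> g differentiable (at x)"
    by (simp_all add: frechet_derivative_def differentiable_def)
qed

lemma Ck_on_cong:
  assumes "open S" "\<And>x. x \<in> S \<Longrightarrow> f x = g x" "Ck_on k S f"
  shows "Ck_on k S g"
  using assms(2,3)
proof (induction k arbitrary: f g)
  case 0
  then show ?case by (simp cong: continuous_on_cong)
next
  case (Suc k)
  have "Ck_on k S (\<lambda>x. frechet_derivative g (at x) v)" for v
  proof (rule Suc.IH)
    show "Ck_on k S (\<lambda>x. frechet_derivative f (at x) v)" using Suc.prems by simp
    show "frechet_derivative f (at x) v = frechet_derivative g (at x) v" if "x \<in> S" for x
      using frechet_derivative_cong_open(1)[OF assms(1) that] Suc.prems(1) by metis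
  qed
  moreover have "g differentiable (at x)" if "x \<in> S" for x
    using frechet_derivative_cong_open(2)[OF assms(1) that] Suc.prems that by (metis Ck_on.simps(2))
  ultimately show ?case by simp
qed

lemma Ck_on_subset: "Ck_on k S f \<Longrightarrow> T \<subseteq> S \<Longrightarrow> Ck_on k T f"
  by (induction k arbitrary: f) (auto intro: continuous_on_subset)

lemma Ck_on_Suc_imp: "Ck_on (Suc k) S f \<Longrightarrow> Ck_on k S f"
proof (induction k arbitrary: f)
  case 0
  then show ?case
    by (auto intro!: continuous_at_imp_continuous_on differentiable_imp_continuous_within)
next
  case (Suc k)
  then show ?case using Ck_on.simps(2) by blast
qed

text \<open>The recursive definition of \<open>Ck_on\<close> speaks of \<open>frechet_derivative\<close>, a choice operator. On an
  open set any explicit formula for the derivative may take its place, and most closure properties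
  below are an induction on the order of differentiability through this rule.\<close>

lemma Ck_on_SucI:
  assumes "open S" "\<And>x. x \<in> S \<Longrightarrow> (f has_derivative D x) (at x)"
    and "\<And>v. Ck_on k S (\<lambda>x. D x v)"
  shows "Ck_on (Suc k) S f"
proof -
  have "Ck_on k S (\<lambda>x. frechet_derivative f (at x) v)" for v
  proof (rule Ck_on_cong[OF assms(1) _ assms(3)])
    show "D x v = frechet_derivative f (at x) v" if "x \<in> S" for x
      using frechet_derivative_at[OF assms(2)[OF that]] by simp
  qed
  then show ?thesis using assms(2) by (auto simp: differentiable_def)
qed

lemma Ck_on_has_derivative:
  "Ck_on (Suc k) S f \<Longrightarrow> x \<in> S \<Longrightarrow> (f has_derivative frechet_derivative f (at x)) (at x)"
  using frechet_derivative_works by (metis Ck_on.simps(2))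

lemma Ck_on_const: "open S \<Longrightarrow> Ck_on k S (\<lambda>x. c)"
proof (induction k arbitrary: c)
  case (Suc k)
  show ?case by (rule Ck_on_SucI[OF Suc.prems, where D = "\<lambda>x v. 0"]) (auto intro!: Suc)
qed simp

lemma Ck_on_bounded_linear:
  assumes "open S" "bounded_linear L" "Ck_on k S f"
  shows "Ck_on k S (\<lambda>x. L (f x))"
  using assms(3)
proof (induction k arbitrary: f)
  case 0
  then show ?case using assms(2) by (simp add: bounded_linear.continuous_on)
next
  case (Suc k)
  show ?case
  proof (rule Ck_on_SucI[OF assms(1)])
    show "((\<lambda>x. L (f x)) has_derivative (\<lambda>v. L (frechet_derivative f (at x) v))) (at x)"
      if "x \<in> S" for x
      by (rule bounded_linear.has_derivative[OF assms(2) Ck_on_has_derivative[OF Suc.prems that]])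
  qed (use Suc in auto)
qed

lemma Ck_on_ident: "open S \<Longrightarrow> Ck_on k S (\<lambda>x. x)"
  by (cases k) (auto intro!: Ck_on_SucI[where D = "\<lambda>x v. v"] Ck_on_const)

lemma Ck_on_add:
  assumes "open S" "Ck_on k S f" "Ck_on k S g"
  shows "Ck_on k S (\<lambda>x. f x + g x)"
  using assms(2,3)
proof (induction k arbitrary: f g)
  case 0
  then show ?case by (simp add: continuous_on_add)
next
  case (Suc k)
  show ?case
  proof (rule Ck_on_SucI[OF assms(1)])
    show "((\<lambda>x. f x + g x) has_derivative
        (\<lambda>v. frechet_derivative f (at x) v + frechet_derivative g (at x) v)) (at x)"
      if "x \<in> S" for x
      by (rule has_derivative_add[OF Ck_on_has_derivative[OF Suc.prems(1) that]
            Ck_on_has_derivative[OF Suc.prems(2) that]])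
  qed (use Suc in auto)
qed

lemma Ck_on_sum:
  assumes "open S" "\<And>i. i \<in> I \<Longrightarrow> Ck_on k S (f i)"
  shows "Ck_on k S (\<lambda>x. \<Sum>i\<in>I. f i x)"
  using assms(2)
  by (induction I rule: infinite_finite_induct) (auto intro!: Ck_on_add Ck_on_const assms(1))

lemma Ck_on_scaleR:
  fixes c :: "'a::real_normed_vector \<Rightarrow> real"
  assumes "open S" "Ck_on k S c" "Ck_on k S f"
  shows "Ck_on k S (\<lambda>x. c x *\<^sub>R f x)"
  using assms(2,3)
proof (induction k arbitrary: c f)
  case 0
  then show ?case by (simp add: continuous_on_scaleR)
next
  case (Suc k)
  show ?case
  proof (rule Ck_on_SucI[OF assms(1)])
    show "((\<lambda>x. c x *\<^sub>R f x) has_derivative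
        (\<lambda>v. c x *\<^sub>R frechet_derivative f (at x) v + frechet_derivative c (at x) v *\<^sub>R f x)) (at x)"
      if "x \<in> S" for x
      by (rule has_derivative_scaleR[OF Ck_on_has_derivative[OF Suc.prems(1) that]
            Ck_on_has_derivative[OF Suc.prems(2) that]])
    show "Ck_on k S (\<lambda>x. c x *\<^sub>R frechet_derivative f (at x) v + frechet_derivative c (at x) v *\<^sub>R f x)" for v
      using Suc.prems Ck_on_Suc_imp[OF Suc.prems(1)] Ck_on_Suc_imp[OF Suc.prems(2)]
      by (intro Ck_on_add[OF assms(1)] Suc.IH) auto
  qed
qed

text \<open>The chain rule for higher derivatives. Expanding the inner derivative in a basis of the
  (Euclidean) middle space writes a directional derivative of \<open>g \<circ> f\<close> as a finite sum of products of
  a component of the derivative of \<open>f\<close> with a partial derivative of \<open>g\<close> composed with \<open>f\<close>. The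
  induction hypothesis covers the second factor, the product rule the rest.\<close>

lemma Ck_on_compose:
  fixes f :: "'a::real_normed_vector \<Rightarrow> 'b::euclidean_space"
  assumes "open S" "open T" "\<And>x. x \<in> S \<Longrightarrow> f x \<in> T" "Ck_on k S f" "Ck_on k T g"
  shows "Ck_on k S (\<lambda>x. g (f x))"
  using assms(4,5)
proof (induction k arbitrary: g)
  case 0
  then show ?case using assms(3)
    by (auto intro: continuous_on_compose2)
next
  case (Suc k)
  have lin: "linear (frechet_derivative g (at y))" if "y \<in> T" for y
    using that Suc.prems(2) linear_frechet_derivative by auto
  show ?case
  proof (rule Ck_on_SucI[OF assms(1)])
    show "((\<lambda>x. g (f x)) has_derivative
        (\<lambda>v. \<Sum>b\<in>Basis. (frechet_derivative f (at x) v \<bullet> b) *\<^sub>R frechet_derivative g (at (f x)) b)) (at x)"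
      if "x \<in> S" for x
    proof -
      have der: "((\<lambda>x. g (f x)) has_derivative
          (\<lambda>v. frechet_derivative g (at (f x)) (frechet_derivative f (at x) v))) (at x)"
        by (rule has_derivative_compose[OF Ck_on_has_derivative[OF Suc.prems(1) that]
              Ck_on_has_derivative[OF Suc.prems(2)]]) (use that assms in auto)
      have rep: "frechet_derivative g (at (f x)) u
          = (\<Sum>b\<in>Basis. (u \<bullet> b) *\<^sub>R frechet_derivative g (at (f x)) b)" for u
      proof -
        have "frechet_derivative g (at (f x)) (\<Sum>b\<in>Basis. (u \<bullet> b) *\<^sub>R b)
            = (\<Sum>b\<in>Basis. (u \<bullet> b) *\<^sub>R frechet_derivative g (at (f x)) b)"
          using lin[OF assms(3)[OF that]] by (simp only: linear_sum linear_scale)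
        then show ?thesis by (simp only: euclidean_representation)
      qed
      have eq: "(\<lambda>v. frechet_derivative g (at (f x)) (frechet_derivative f (at x) v)) =
          (\<lambda>v. \<Sum>b\<in>Basis. (frechet_derivative f (at x) v \<bullet> b) *\<^sub>R frechet_derivative g (at (f x)) b)"
        by (rule ext) (rule rep)
      show ?thesis by (rule der[unfolded eq])
    qed
    show "Ck_on k S (\<lambda>x. \<Sum>b\<in>Basis. (frechet_derivative f (at x) v \<bullet> b) *\<^sub>R frechet_derivative g (at (f x)) b)" for v
    proof (intro Ck_on_sum Ck_on_scaleR assms(1))
      fix b :: 'b
      show "Ck_on k S (\<lambda>x. frechet_derivative f (at x) v \<bullet> b)"
        using Suc.prems by (intro Ck_on_bounded_linear[OF assms(1) bounded_linear_inner_left]) auto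
      show "Ck_on k S (\<lambda>x. frechet_derivative g (at (f x)) b)"
        using Suc.prems Ck_on_Suc_imp by (intro Suc.IH) auto
    qed
  qed
qed

lemma smooth_on_subset: "smooth_on S f \<Longrightarrow> T \<subseteq> S \<Longrightarrow> smooth_on T f"
  unfolding smooth_on_def using Ck_on_subset by blast

lemma smooth_on_compose:
  fixes f :: "'a::real_normed_vector \<Rightarrow> 'b::euclidean_space"
  assumes "open S" "open T" "\<And>x. x \<in> S \<Longrightarrow> f x \<in> T" "smooth_on S f" "smooth_on T g"
  shows "smooth_on S (\<lambda>x. g (f x))"
  using assms Ck_on_compose unfolding smooth_on_def by blast

lemma smooth_on_id_plus_scaleR:
  assumes "open S" "smooth_on S V"
  shows "smooth_on S (\<lambda>x. x + t *\<^sub>R V x)"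
  using assms unfolding smooth_on_def
  by (intro allI Ck_on_add Ck_on_ident Ck_on_bounded_linear[OF _ bounded_linear_scaleR_right]) auto

lemma smooth_on_has_derivative:
  "smooth_on S f \<Longrightarrow> x \<in> S \<Longrightarrow> (f has_derivative frechet_derivative f (at x)) (at x)"
  unfolding smooth_on_def using Ck_on_has_derivative by blast

lemma smooth_on_imp_continuous_on: "smooth_on S f \<Longrightarrow> continuous_on S f"
  unfolding smooth_on_def by (metis Ck_on.simps(1))

lemma smooth_on_continuous_derivative:
  "smooth_on S f \<Longrightarrow> continuous_on S (\<lambda>x. frechet_derivative f (at x) v)"
  unfolding smooth_on_def by (metis Ck_on.simps(1) Ck_on.simps(2))

lemma smooth_on_linear_derivative:
  "smooth_on S f \<Longrightarrow> x \<in> S \<Longrightarrow> linear (frechet_derivative f (at x))"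
  using smooth_on_has_derivative has_derivative_linear by blast

lemma smooth_map_on_imp_continuous_on:
  assumes "smooth_map_on M h"
  shows "continuous_on M h"
proof (rule continuous_on_eq_continuous_within[THEN iffD2], rule ballI)
  fix p assume "p \<in> M"
  then obtain U F where U: "open U" "p \<in> U" "smooth_on U F" "\<And>x. x \<in> U \<inter> M \<Longrightarrow> F x = h x"
    using assms unfolding smooth_map_on_def by meson
  have "continuous (at p within M) F"
    using smooth_on_imp_continuous_on[OF U(3)] U(1,2)
    by (meson continuous_at_imp_continuous_at_within continuous_on_eq_continuous_at)
  moreover have "\<forall>\<^sub>F x in at p within M. F x = h x"
    using U by (auto simp: eventually_at_topological)
  moreover have "F p = h p" using U \<open>p \<in> M\<close> by blast
  ultimately show "continuous (at p within M) h"
    unfolding continuous_within using Lim_transform_eventually by metis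
qed

section \<open>Gram determinants\<close>

text \<open>The squared $n$-dimensional volume of the parallelepiped spanned by the family \<open>b\<close>.\<close>

definition gram :: "('n::finite \<Rightarrow> 'a::euclidean_space) \<Rightarrow> real" where
  "gram b = det (\<chi> i j. b i \<bullet> b j :: real^'n^'n)"

definition orthonormal :: "('n::finite \<Rightarrow> 'a::euclidean_space) \<Rightarrow> bool" where
  "orthonormal e \<longleftrightarrow> (\<forall>i j. e i \<bullet> e j = (if i = j then 1 else 0))"

lemma area_density_gram:
  "area_density X w = sqrt (gram (\<lambda>i. frechet_derivative X (at w) (axis i 1)))"
  by (simp add: area_density_def gram_def)

lemma gram_orthonormal: 
  fixes e :: "'n::finite \<Rightarrow> 'a::euclidean_space"
  assumes "orthonormal e"
  shows "gram e = 1"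
proof -
  have "(\<chi> i j. e i \<bullet> e j :: real^'n^'n) = mat 1"
    using assms by (simp add: orthonormal_def mat_def vec_eq_iff)
  then show ?thesis by (simp add: gram_def)
qed

text \<open>In matrix form the new Gram matrix is \<open>transpose A ** E ** A\<close>, where \<open>E\<close> is the old one.\<close>

lemma gram_linear_combination:
  fixes A :: "real^'n^'n"
  assumes "\<And>j. b j = (\<Sum>i\<in>UNIV. A $ i $ j *\<^sub>R e i)"
  shows "gram b = (det A)\<^sup>2 * gram e"
proof -
  have "(\<chi> i j. b i \<bullet> b j :: real^'n^'n) = transpose A ** ((\<chi> i j. e i \<bullet> e j) ** A)"
  proof -
    have "b i \<bullet> b j = (\<Sum>k\<in>UNIV. A $ k $ i * (\<Sum>l\<in>UNIV. (e k \<bullet> e l) * A $ l $ j))" for i j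
      by (simp add: assms inner_sum_left inner_sum_right sum_distrib_left mult_ac)
         (subst sum.swap, simp add: mult_ac)
    then show ?thesis
      by (simp add: vec_eq_iff matrix_matrix_mult_def transpose_def)
  qed
  then show ?thesis
    by (simp add: gram_def det_mul power2_eq_square)
qed

lemma orthonormal_inj:
  assumes "orthonormal e"
  shows "inj e" and "independent (range e)"
proof -
  show "inj e"
    using assms unfolding inj_def orthonormal_def by (metis zero_neq_one)
  have "0 \<notin> range e"
    using assms unfolding orthonormal_def by (metis (no_types, lifting) imageE inner_zero_left zero_neq_one)
  moreover have "pairwise orthogonal (range e)"
    using assms unfolding pairwise_def orthonormal_def orthogonal_def by auto
  ultimately show "independent (range e)"
    using pairwise_orthogonal_independent by blast
qed

lemma orthonormal_span:
  fixes e :: "'n::finite \<Rightarrow> 'a::euclidean_space"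
  assumes "orthonormal e" "range e \<subseteq> T" "dim T = CARD('n)"
  shows "T \<subseteq> span (range e)"
proof (rule card_ge_dim_independent[OF assms(2)])
  show "independent (range e)" by (rule orthonormal_inj(2)[OF assms(1)])
  show "dim T \<le> card (range e)"
    using orthonormal_inj(1)[OF assms(1)] assms(3) by (simp add: card_image)
qed

lemma orthonormal_expansion:
  fixes e :: "'n::finite \<Rightarrow> 'a::euclidean_space"
  assumes "orthonormal e" "v \<in> span (range e)"
  shows "v = (\<Sum>i\<in>UNIV. (v \<bullet> e i) *\<^sub>R e i)"
proof -
  obtain u where "v = (\<Sum>x\<in>range e. u x *\<^sub>R x)"
    using assms(2) by (auto simp: span_finite)
  then have v: "v = (\<Sum>i\<in>UNIV. u (e i) *\<^sub>R e i)"
    by (simp add: sum.reindex[OF orthonormal_inj(1)[OF assms(1)]])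
  have "v \<bullet> e j = u (e j)" for j
  proof -
    have ee: "e i \<bullet> e j = (if i = j then 1 else 0)" for i
      using assms(1) by (simp add: orthonormal_def)
    show ?thesis by (simp add: v inner_sum_left ee if_distrib cong: if_cong)
  qed
  then show ?thesis using v by simp
qed

text \<open>Gram determinants of images under a linear map split into a factor that depends only on the
  family and one that depends only on the map. All multiplicativity of Jacobians below comes from
  here.\<close>

lemma gram_linear_image:
  fixes e :: "'n::finite \<Rightarrow> 'a::euclidean_space" and L :: "'a \<Rightarrow> 'b::euclidean_space"
    and b :: "'n \<Rightarrow> 'a"
  assumes "orthonormal e" "\<And>i. b i \<in> span (range e)" "linear L"
  shows "gram (\<lambda>i. L (b i)) = gram b * gram (\<lambda>i. L (e i))"
proof -
  define A :: "real^'n^'n" where "A = (\<chi> i j. b j \<bullet> e i)"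
  have b: "b j = (\<Sum>i\<in>UNIV. A $ i $ j *\<^sub>R e i)" for j
    using orthonormal_expansion[OF assms(1,2)] by (simp add: A_def)
  have "L (b j) = (\<Sum>i\<in>UNIV. A $ i $ j *\<^sub>R L (e i))" for j
    by (subst b) (simp add: linear_sum[OF assms(3)] linear_scale[OF assms(3)])
  then show ?thesis
    using gram_linear_combination[of b A e] gram_linear_combination[of "\<lambda>i. L (b i)" A "\<lambda>i. L (e i)"]
      b gram_orthonormal[OF assms(1)] by simp
qed

lemma ex_orthonormal:
  fixes T :: "'a::euclidean_space set"
  assumes "subspace T" "dim T = CARD('n::finite)"
  obtains e :: "'n::finite \<Rightarrow> 'a" where "orthonormal e" "range e \<subseteq> T"
proof -
  obtain B where B: "B \<subseteq> T" "pairwise orthogonal B" "\<And>x. x \<in> B \<Longrightarrow> norm x = 1"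
      "independent B" "card B = dim T" "span B = T"
    using orthonormal_basis_subspace[OF assms(1)] by metis
  then obtain e :: "'n \<Rightarrow> 'a" where e: "bij_betw e UNIV B"
    using assms(2) by (metis finite_class.finite_UNIV finite_same_card_bij independent_imp_finite)
  have "orthonormal e"
    unfolding orthonormal_def
  proof (intro allI)
    fix i j
    have "e i \<in> B" "e j \<in> B" "i \<noteq> j \<Longrightarrow> e i \<noteq> e j"
      using e by (auto simp: bij_betw_def inj_def)
    then show "e i \<bullet> e j = (if i = j then 1 else 0)"
      using B(2,3) by (auto simp: pairwise_def orthogonal_def norm_eq_1)
  qed
  then show ?thesis using that e B(1) by (simp add: bij_betw_def)
qed

lemma dim_range_inj:
  fixes D :: "real^'n::finite \<Rightarrow> 'a::euclidean_space"
  assumes "linear D" "inj D"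
  shows "subspace (range D)" "dim (range D) = CARD('n)"
proof -
  show "subspace (range D)" by (simp add: linear_subspace_image assms)
  show "dim (range D) = CARD('n)"
    using dim_image_eq[OF assms(1), of UNIV] assms(2) by simp
qed

text \<open>In an orthonormal basis of its range, \<open>D\<close> becomes an invertible square matrix, and the Gram
  determinant is the square of its determinant.\<close>

lemma gram_linear_pos:
  fixes D :: "real^'n::finite \<Rightarrow> 'a::euclidean_space"
  assumes "linear D" "inj D"
  shows "gram (\<lambda>i. D (axis i 1)) > 0"
proof -
  obtain e :: "'n \<Rightarrow> 'a" where e: "orthonormal e" "range e \<subseteq> range D"
    using ex_orthonormal[OF dim_range_inj[OF assms]] by metis
  have sp: "D x \<in> span (range e)" for x
    using orthonormal_span[OF e dim_range_inj(2)[OF assms]] by blast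
  define A :: "real^'n^'n" where "A = (\<chi> i j. D (axis j 1) \<bullet> e i)"
  have b: "D (axis j 1) = (\<Sum>i\<in>UNIV. A $ i $ j *\<^sub>R e i)" for j
    using orthonormal_expansion[OF e(1) sp] by (simp add: A_def)
  have "x = 0" if "A *v x = 0" for x
  proof -
    have "D x \<bullet> e i = (A *v x) $ i" for i
    proof -
      have "D x = (\<Sum>j\<in>UNIV. x $ j *\<^sub>R D (axis j 1))"
        by (subst basis_expansion[symmetric, of x])
           (simp add: linear_sum[OF assms(1)] linear_scale[OF assms(1)] scalar_mult_eq_scaleR)
      then show ?thesis
        by (simp add: inner_sum_left A_def matrix_vector_mult_def mult.commute)
    qed
    then have "D x = 0" using orthonormal_expansion[OF e(1) sp, of x] that by simp
    then show "x = 0" using assms by (metis inj_eq linear_0)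
  qed
  then have "invertible A"
    using matrix_left_invertible_ker invertible_left_inverse by blast
  then have "det A \<noteq> 0" by (simp add: invertible_det_nz)
  then show ?thesis
    using gram_linear_combination[of "\<lambda>j. D (axis j 1)" A e] b gram_orthonormal[OF e(1)] by simp
qed

text \<open>A determinant of inner products has a sign, a Gram determinant has not; orientation settles the
  sign. Both families are positive multiples of the reference family \<open>b\<close>, so the matrix \<open>C\<close> that
  expresses \<open>e\<close> in terms of \<open>c\<close> has positive determinant. As \<open>L \<circ> c\<close> is orthonormal, \<open>C\<close> is
  also the matrix of inner products, and the Gram determinant of \<open>L \<circ> e\<close> is \<open>(det C)\<^sup>2\<close>.\<close>

lemma det_same_orientation:
  fixes A B :: "real^'n^'n" and L :: "'a::euclidean_space \<Rightarrow> 'b::euclidean_space"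
  assumes "linear L" "det A > 0" "det B > 0"
    and e: "\<And>j. e j = (\<Sum>i\<in>UNIV. A $ i $ j *\<^sub>R b i)"
    and c: "\<And>j. c j = (\<Sum>i\<in>UNIV. B $ i $ j *\<^sub>R b i)"
    and "orthonormal (\<lambda>i. L (c i))"
  shows "det (\<chi> i j. L (e j) \<bullet> L (c i)) = sqrt (gram (\<lambda>i. L (e i)))"
proof -
  have "invertible B" using assms(3) by (simp add: invertible_det_nz)
  then obtain B' where B': "B ** B' = mat 1" unfolding invertible_def by blast
  define C where "C = B' ** A"
  have BC: "B ** C = A"
    by (simp add: C_def matrix_mul_assoc B')
  have detC: "det C > 0"
    using BC assms(2,3) det_mul[of B C] by (metis zero_less_mult_pos)
  have "e j = (\<Sum>i\<in>UNIV. C $ i $ j *\<^sub>R c i)" for j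
  proof -
    have "(\<Sum>i\<in>UNIV. C $ i $ j *\<^sub>R c i) = (\<Sum>i\<in>UNIV. \<Sum>k\<in>UNIV. (B $ k $ i * C $ i $ j) *\<^sub>R b k)"
      by (simp add: c scaleR_sum_right mult.commute)
    also have "\<dots> = (\<Sum>k\<in>UNIV. (B ** C) $ k $ j *\<^sub>R b k)"
      by (subst sum.swap) (simp add: matrix_matrix_mult_def scaleR_sum_left)
    finally show ?thesis using e BC by simp
  qed
  then have Le: "L (e j) = (\<Sum>i\<in>UNIV. C $ i $ j *\<^sub>R L (c i))" for j
    by (simp add: linear_sum[OF assms(1)] linear_scale[OF assms(1)])
  have "(\<chi> i j. L (e j) \<bullet> L (c i)) = C"
  proof -
    have ee: "L (c k) \<bullet> L (c i) = (if k = i then 1 else 0)" for k i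
      using assms(6) by (simp add: orthonormal_def)
    show ?thesis by (simp add: vec_eq_iff Le inner_sum_left ee if_distrib cong: if_cong)
  qed
  moreover have "gram (\<lambda>i. L (e i)) = (det C)\<^sup>2"
    using gram_linear_combination[of "\<lambda>i. L (e i)" C "\<lambda>i. L (c i)"] Le gram_orthonormal[OF assms(6)]
    by simp
  ultimately show ?thesis using detC by auto
qed

text \<open>Differentiate the Leibniz formula. A permutation other than the identity moves at least two
  indices, so each of its products with one factor removed still contains an off-diagonal entry of
  the identity matrix. Only the diagonal product contributes, and it gives the trace.\<close>

lemma has_derivative_det_mat_1:
  "((det :: real^'n^'n \<Rightarrow> real) has_derivative trace) (at (mat 1))"
proof -
  have "((\<lambda>A::real^'n^'n. \<Sum>p | p permutes UNIV. of_int (sign p) * (\<Prod>i\<in>UNIV. A $ i $ p i)) has_derivative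
      (\<lambda>E. \<Sum>p | p permutes UNIV. of_int (sign p) *
         (\<Sum>i\<in>UNIV. E $ i $ p i * (\<Prod>j\<in>UNIV - {i}. (mat 1 :: real^'n^'n) $ j $ p j)))) (at (mat 1))"
    by (intro has_derivative_sum has_derivative_mult_right has_derivative_prod
        bounded_linear_imp_has_derivative bounded_linear_compose[OF bounded_linear_vec_nth bounded_linear_vec_nth])
  moreover have "(\<Sum>p | p permutes UNIV. of_int (sign p) *
         (\<Sum>i\<in>UNIV. E $ i $ p i * (\<Prod>j\<in>UNIV - {i}. (mat 1 :: real^'n^'n) $ j $ p j))) = trace E"
    (is "sum ?F _ = _") for E :: "real^'n^'n"
  proof -
    have "?F p = 0" if p: "p permutes UNIV" "p \<noteq> id" for p
    proof -
      have "(\<Prod>j\<in>UNIV - {i}. (mat 1 :: real^'n^'n) $ j $ p j) = 0" for i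
      proof -
        obtain k where k: "p k \<noteq> k" using p(2) by (auto simp: fun_eq_iff)
        have "p (p k) \<noteq> p k" using k permutes_inj[OF p(1)] by (auto simp: inj_def)
        then obtain j where "j \<noteq> i" "p j \<noteq> j" using k by metis
        then show ?thesis by (intro prod_zero) (auto simp: mat_def intro!: bexI[of _ j])
      qed
      then show ?thesis by (simp only: mult_zero_right sum.neutral_const)
    qed
    then have "sum ?F {p. p permutes UNIV} = sum ?F {id}"
      by (intro sum.mono_neutral_right) (auto simp: permutes_id finite_permutations)
    also have "\<dots> = trace E" by (simp add: trace_def sign_id mat_def)
    finally show ?thesis .
  qed
  ultimately show ?thesis by (simp add: det_def[abs_def])
qed

text \<open>Differentiability at a single point already bounds the difference quotients based at that point.
  Applied to a function of matrices, this gives estimates that are uniform in all families with the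
  same bound on their entries.\<close>

lemma has_derivative_locally_lipschitz:
  assumes "(f has_derivative f') (at x)"
  obtains K d where "d > 0" "K \<ge> 0" "\<And>y. norm (y - x) < d \<Longrightarrow> norm (f y - f x) \<le> K * norm (y - x)"
proof -
  obtain B where B: "B > 0" "\<And>h. norm (f' h) \<le> norm h * B"
    using assms has_derivative_bounded_linear bounded_linear.pos_bounded by blast
  obtain d where d: "d > 0" "\<And>y. norm (y - x) < d \<Longrightarrow>
      norm (f y - f x - f' (y - x)) \<le> 1 * norm (y - x)"
    using assms unfolding has_derivative_at_alt by (metis zero_less_one)
  have "norm (f y - f x) \<le> (1 + B) * norm (y - x)" if "norm (y - x) < d" for y
    using norm_triangle_sub[of "f y - f x" "f' (y - x)"] d(2)[OF that] B(2)[of "y - x"]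
    by (simp add: algebra_simps)
  then show ?thesis using that[of d "1 + B"] d(1) B(1) by auto
qed

text \<open>Written so that the deviation from the identity matrix is visibly of order \<open>t\<close>.\<close>

lemma gram_perturbed:
  fixes e w :: "'n::finite \<Rightarrow> 'a::euclidean_space"
  assumes "orthonormal e"
  shows "gram (\<lambda>i. e i + t *\<^sub>R w i) =
    det (mat 1 + t *\<^sub>R ((\<chi> i j. e i \<bullet> w j + w i \<bullet> e j) + t *\<^sub>R (\<chi> i j. w i \<bullet> w j)) :: real^'n^'n)"
proof -
  have "(\<chi> i j. (e i + t *\<^sub>R w i) \<bullet> (e j + t *\<^sub>R w j) :: real^'n^'n) =
    mat 1 + t *\<^sub>R ((\<chi> i j. e i \<bullet> w j + w i \<bullet> e j) + t *\<^sub>R (\<chi> i j. w i \<bullet> w j))"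
    using assms by (auto simp: vec_eq_iff mat_def orthonormal_def inner_add_left inner_add_right algebra_simps)
  then show ?thesis by (simp add: gram_def)
qed

lemma has_derivative_sqrt_det:
  "((\<lambda>A::real^'n^'n. sqrt (det A)) has_derivative (\<lambda>E. trace E / 2)) (at (mat 1))"
  using has_derivative_real_sqrt[OF _ has_derivative_det_mat_1] by simp

text \<open>First variation of area. For \<open>w i = DV (e i)\<close> the derivative is the tangential divergence
  of \<open>V\<close>.\<close>

lemma sqrt_gram_has_derivative:
  fixes e w :: "'n::finite \<Rightarrow> 'a::euclidean_space"
  assumes "orthonormal e"
  shows "((\<lambda>t. sqrt (gram (\<lambda>i. e i + t *\<^sub>R w i))) has_real_derivative (\<Sum>i\<in>UNIV. w i \<bullet> e i)) (at 0)"
proof -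
  let ?B = "(\<chi> i j. e i \<bullet> w j + w i \<bullet> e j) :: real^'n^'n"
  let ?C = "(\<chi> i j. w i \<bullet> w j) :: real^'n^'n"
  have "((\<lambda>t::real. mat 1 + t *\<^sub>R (?B + t *\<^sub>R ?C)) has_derivative (\<lambda>s. s *\<^sub>R ?B)) (at 0)"
    by (auto intro!: derivative_eq_intros)
  then have "((\<lambda>t::real. sqrt (det (mat 1 + t *\<^sub>R (?B + t *\<^sub>R ?C)))) has_derivative
      (\<lambda>s. trace (s *\<^sub>R ?B) / 2)) (at 0)"
    by (rule has_derivative_compose) (simp add: has_derivative_sqrt_det)
  moreover have tr: "(\<lambda>s. trace (s *\<^sub>R ?B) / 2) = (*) (\<Sum>i\<in>UNIV. w i \<bullet> e i)"
    by (simp add: fun_eq_iff trace_def sum.distrib inner_commute sum_distrib_left[symmetric])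
  ultimately show ?thesis
    by (simp only: gram_perturbed[OF assms] has_field_derivative_def)
qed

lemma norm_matrix_le:
  fixes A :: "real^'n^'m" and K :: real
  assumes "\<And>i j. \<bar>A $ i $ j\<bar> \<le> K"
  shows "norm A \<le> CARD('m) * (CARD('n) * K)"
proof -
  have "norm A \<le> (\<Sum>i\<in>UNIV. norm (A $ i))" by (simp add: norm_vec_def L2_set_le_sum)
  also have "\<dots> \<le> (\<Sum>i\<in>(UNIV::'m set). \<Sum>j\<in>(UNIV::'n set). K)"
    by (intro sum_mono order_trans[OF norm_le_l1_cart]) (use assms in auto)
  finally show ?thesis by simp
qed

text \<open>The constants depend on \<open>B\<close> alone, not on the frame: the perturbed Gram matrix stays in a ball
  around the identity matrix whose radius is proportional to \<open>t\<close>. This supplies the dominating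
  constant for differentiation under the integral sign.\<close>

lemma sqrt_gram_uniform_bound:
  fixes B :: real
  obtains K d where "d > 0" "K \<ge> 0"
    "\<And>(e::'n::finite \<Rightarrow> 'a::euclidean_space) w t. \<lbrakk>orthonormal e; \<forall>i. norm (w i) \<le> B; 0 \<le> t; t < d\<rbrakk>
       \<Longrightarrow> \<bar>sqrt (gram (\<lambda>i. e i + t *\<^sub>R w i)) - 1\<bar> \<le> K * t"
proof -
  obtain K d where Kd: "d > 0" "K \<ge> 0" "\<And>A::real^'n^'n. norm (A - mat 1) < d \<Longrightarrow>
      norm (sqrt (det A) - sqrt (det (mat 1 :: real^'n^'n))) \<le> K * norm (A - mat 1)"
    using has_derivative_locally_lipschitz[OF has_derivative_sqrt_det] by metis
  \<comment> \<open>The distance from the identity matrix is at most \<open>t * N\<close> for \<open>t \<le> 1\<close>.\<close>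
  define N where "N = real CARD('n) * (real CARD('n) * (2 * \<bar>B\<bar> + \<bar>B\<bar> * \<bar>B\<bar>))"
  have N0: "N \<ge> 0" by (simp add: N_def)
  show ?thesis
  proof (rule that[of "min 1 (d / (N + 1))" "K * N"])
    show "0 < min 1 (d / (N + 1))" using Kd(1) N0 by simp
    show "0 \<le> K * N" using Kd N0 by simp
    fix e w :: "'n \<Rightarrow> 'a" and t :: real
    assume e: "orthonormal e" and w: "\<forall>i. norm (w i) \<le> B" and t: "0 \<le> t" "t < min 1 (d / (N + 1))"
    let ?E = "t *\<^sub>R ((\<chi> i j. e i \<bullet> w j + w i \<bullet> e j) + t *\<^sub>R (\<chi> i j. w i \<bullet> w j)) :: real^'n^'n"
    have B: "norm (w i) \<le> \<bar>B\<bar>" for i using w by (meson abs_ge_self order_trans)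
    have e1: "norm (e i) = 1" for i using e by (simp add: orthonormal_def norm_eq_1)
    have ew: "\<bar>e i \<bullet> w j\<bar> \<le> \<bar>B\<bar>" for i j
      using Cauchy_Schwarz_ineq2[of "e i" "w j"] e1 B[of j] by simp
    have ww: "\<bar>w i \<bullet> w j\<bar> \<le> \<bar>B\<bar> * \<bar>B\<bar>" for i j
      using Cauchy_Schwarz_ineq2[of "w i" "w j"] B[of j] B[of i]
      by (meson mult_mono norm_ge_zero order_trans abs_ge_zero)
    have "\<bar>e i \<bullet> w j + w i \<bullet> e j + t * (w i \<bullet> w j)\<bar> \<le> 2 * \<bar>B\<bar> + \<bar>B\<bar> * \<bar>B\<bar>" for i j
    proof -
      have "\<bar>t * (w i \<bullet> w j)\<bar> \<le> 1 * (\<bar>B\<bar> * \<bar>B\<bar>)"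
        unfolding abs_mult using t ww[of i j] by (intro mult_mono) auto
      then show ?thesis using ew[of i j] ew[of j i] by (simp add: inner_commute)
    qed
    then have "norm ((\<chi> i j. e i \<bullet> w j + w i \<bullet> e j) + t *\<^sub>R (\<chi> i j. w i \<bullet> w j) :: real^'n^'n) \<le> N"
      unfolding N_def by (intro norm_matrix_le) simp
    then have E: "norm ?E \<le> t * N"
      using t by (simp add: mult_left_mono)
    also have "t * N < d"
    proof -
      have "t * (N + 1) < d" using t N0 by (simp add: pos_less_divide_eq)
      then show ?thesis using t by (simp add: algebra_simps)
    qed
    finally have "\<bar>sqrt (det (mat 1 + ?E)) - 1\<bar> \<le> K * norm ?E"
      using Kd(3)[of "mat 1 + ?E"] by simp
    also have "\<dots> \<le> K * N * t" using E Kd(2) by (simp add: mult_left_mono mult.commute mult.left_commute)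
    finally show "\<bar>sqrt (gram (\<lambda>i. e i + t *\<^sub>R w i)) - 1\<bar> \<le> K * N * t"
      by (simp add: gram_perturbed[OF e])
  qed
qed

section \<open>Change of variables for arbitrary finite index types\<close>

text \<open>The theorem \<open>has_absolute_integral_change_of_variables\<close> asks for a well-ordered index type. The
  type \<open>'a ranked\<close> is a copy of \<open>'a\<close> ordered by an arbitrary enumeration. Relabelling coordinates
  preserves Lebesgue measure and determinants, so the theorem carries over to every finite index
  type.\<close>

typedef 'a ranked = "UNIV :: 'a set"
  morphisms unranked ranked by simp

lemma bij_unranked: "bij unranked"
  by (metis UNIV_I bij_betw_byWitness ranked_inverse subset_UNIV unranked_inverse bijI' ranked_inject)

instance ranked :: (finite) finite
proof
  have "inj (unranked :: 'a ranked \<Rightarrow> 'a)" by (simp add: bij_is_inj bij_unranked)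
  then show "finite (UNIV :: 'a ranked set)"
    by (metis finite finite_imageD)
qed

definition rank :: "'a::finite ranked \<Rightarrow> nat" where
  "rank = (SOME r. inj r)"

lemma inj_rank: "inj rank"
proof -
  have "\<exists>r :: 'a ranked \<Rightarrow> nat. inj r"
    using finite_imp_inj_to_nat_seg[OF finite, of "UNIV :: 'a ranked set"] by auto
  then show ?thesis unfolding rank_def by (rule someI_ex)
qed

instantiation ranked :: (finite) wellorder
begin

definition less_eq_ranked :: "'a ranked \<Rightarrow> 'a ranked \<Rightarrow> bool" where
  "x \<le> y \<longleftrightarrow> rank x \<le> rank y"

definition less_ranked :: "'a ranked \<Rightarrow> 'a ranked \<Rightarrow> bool" where
  "x < y \<longleftrightarrow> rank x < rank y"

instance
proof
  show "P a" if "\<And>x. (\<And>y. y < x \<Longrightarrow> P y) \<Longrightarrow> P x" for P and a :: "'a ranked"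
    by (induction a rule: measure_induct_rule[where f = rank])
       (use that in \<open>auto simp: less_ranked_def\<close>)
qed (auto simp: less_eq_ranked_def less_ranked_def intro: injD[OF inj_rank])

end

text \<open>The Leibniz sums agree term by term after permutations are conjugated by \<open>h\<close>, which preserves
  their signs.\<close>

lemma det_reindex:
  fixes A :: "real^'n::finite^'n" and h :: "'m::finite \<Rightarrow> 'n"
  assumes "bij h"
  shows "det (\<chi> i j. A $ h i $ h j :: real^'m^'m) = det A"
proof -
  let ?m = "\<lambda>p. map_permutation UNIV h p"
  have inj: "inj h" and range: "range h = UNIV" using assms by (auto simp: bij_def)
  have bij: "bij_betw ?m {p. p permutes UNIV} {p. p permutes UNIV}"
    using bij_betw_permutations[of h UNIV UNIV] assms
    by (simp add: map_permutation_def restrict_id_def[abs_def] range o_def)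
  have "det A = (\<Sum>p | p permutes UNIV. of_int (sign (?m p)) * (\<Prod>i\<in>UNIV. A $ i $ ?m p i))"
    unfolding det_def by (rule sum.reindex_bij_betw[OF bij, symmetric])
  also have "\<dots> = (\<Sum>p | p permutes UNIV. of_int (sign p) * (\<Prod>i\<in>UNIV. A $ h i $ h (p i)))"
  proof (rule sum.cong[OF refl])
    fix p :: "'m \<Rightarrow> 'm" assume "p \<in> {p. p permutes UNIV}"
    then have "sign (?m p) = sign p" using inj by (intro sign_map_permutation) auto
    moreover have "(\<Prod>i\<in>UNIV. A $ i $ ?m p i) = (\<Prod>i\<in>UNIV. A $ h i $ ?m p (h i))"
      by (rule prod.reindex_bij_betw[OF assms, symmetric])
    moreover have "?m p (h i) = h (p i)" for i
      by (rule map_permutation_apply) (use inj in auto)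
    ultimately show "of_int (sign (?m p)) * (\<Prod>i\<in>UNIV. A $ i $ ?m p i) =
        of_int (sign p) * (\<Prod>i\<in>UNIV. A $ h i $ h (p i))" by simp
  qed
  finally show ?thesis by (simp add: det_def)
qed

definition relabel :: "('m::finite \<Rightarrow> 'n::finite) \<Rightarrow> real^'n \<Rightarrow> real^'m" where
  "relabel h x = (\<chi> i. x $ h i)"

lemma relabel_inverse: "bij h \<Longrightarrow> relabel (inv h) (relabel h x) = x" "bij h \<Longrightarrow> relabel h (relabel (inv h) y) = y"
  by (simp_all add: relabel_def vec_eq_iff bij_is_surj surj_f_inv_f bij_is_inj)

lemma bounded_linear_relabel: "bounded_linear (relabel h)"
  by (rule linear_conv_bounded_linear[THEN iffD1]) (auto simp: linear_iff relabel_def vec_eq_iff)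

lemma relabel_measurable [measurable]: "relabel h \<in> borel_measurable borel"
  by (intro borel_measurable_continuous_onI linear_continuous_on bounded_linear_relabel)

lemma Basis_vec_range: "(Basis :: (real^'k::finite) set) = range (\<lambda>i. axis i 1)"
  by (auto simp: Basis_vec_def)

lemma inj_axis: "inj (\<lambda>i::'k::finite. axis i (1::real))"
  by (auto simp: inj_def axis_eq_axis)

lemma distr_lborel_relabel:
  fixes h :: "'m::finite \<Rightarrow> 'n::finite"
  assumes "bij h"
  shows "distr lborel borel (relabel h) = (lborel :: (real^'m) measure)"
proof (rule lborel_eqI[symmetric])
  fix l u :: "real^'m"
  assume le: "\<And>b. b \<in> Basis \<Longrightarrow> l \<bullet> b \<le> u \<bullet> b"
  note B = Basis_vec_range and injB = inj_axis
  have vim: "relabel h -` box l u = box (relabel (inv h) l) (relabel (inv h) u)"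
  proof -
    have "(\<forall>i. P (h i) i) \<longleftrightarrow> (\<forall>j. P j (inv h j))" for P
      using assms by (metis bij_inv_eq_iff)
    from this[of "\<lambda>j i. l $ i < x $ j \<and> x $ j < u $ i" for x] show ?thesis
      by (auto simp: mem_box_cart relabel_def set_eq_iff)
  qed
  have le': "relabel (inv h) l \<bullet> b \<le> relabel (inv h) u \<bullet> b" if b: "b \<in> Basis" for b
  proof -
    obtain i where "b = axis i 1" using b by (auto simp: B)
    then show ?thesis using le[of "axis (inv h i) 1"] by (auto simp: B inner_axis relabel_def)
  qed
  have "emeasure (distr lborel borel (relabel h)) (box l u) =
      emeasure lborel (box (relabel (inv h) l) (relabel (inv h) u))"
    by (subst emeasure_distr) (auto simp: vim)
  also have "\<dots> = (\<Prod>b\<in>Basis. (relabel (inv h) u - relabel (inv h) l) \<bullet> b)"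
    by (rule emeasure_lborel_box) (rule le')
  also have "(\<Prod>b\<in>Basis. (relabel (inv h) u - relabel (inv h) l) \<bullet> b) = (\<Prod>j\<in>UNIV. (u - l) $ inv h j)"
    by (simp add: B prod.reindex[OF injB] inner_axis relabel_def)
  also have "\<dots> = (\<Prod>i\<in>UNIV. (u - l) $ i)"
    by (rule prod.reindex_bij_betw) (simp add: assms bij_imp_bij_inv)
  also have "\<dots> = (\<Prod>b\<in>Basis. (u - l) \<bullet> b)"
    by (simp add: B prod.reindex[OF injB] inner_axis)
  finally show "emeasure (distr lborel borel (relabel h)) (box l u) = (\<Prod>b\<in>Basis. (u - l) \<bullet> b)" .
qed simp

lemma nn_integral_relabel:
  fixes h :: "'m::finite \<Rightarrow> 'n::finite"
  assumes "bij h" "F \<in> borel_measurable borel"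
  shows "(\<integral>\<^sup>+x. F (relabel h x) \<partial>lborel) = (\<integral>\<^sup>+y. F y \<partial>lborel)"
  using assms by (subst distr_lborel_relabel[OF assms(1), symmetric]) (simp add: nn_integral_distr)

text \<open>The underlying theorem concerns integrals with a finite value. Nonnegative integrals that attain
  the same finite values are also infinite simultaneously, which gives equality in \<open>[0, \<infinity>]\<close>.\<close>

lemma nn_integral_change_of_variables_wellorder:
  fixes T :: "real^'n::{finite,wellorder} \<Rightarrow> real^'n::_"
  assumes S: "S \<in> sets borel"
    and der: "\<And>x. x \<in> S \<Longrightarrow> (T has_derivative T' x) (at x within S)"
    and inj: "inj_on T S"
    and u: "\<And>y. 0 \<le> u y" and v: "\<And>x. x \<in> S \<Longrightarrow> v x = \<bar>det (matrix (T' x))\<bar> * u (T x)"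
    and mv: "(\<lambda>x. indicator S x * v x) \<in> borel_measurable borel"
    and mu: "(\<lambda>y. indicator (T ` S) y * u y) \<in> borel_measurable borel"
  shows "(\<integral>\<^sup>+x. ennreal (indicator S x * v x) \<partial>lborel) = (\<integral>\<^sup>+y. ennreal (indicator (T ` S) y * u y) \<partial>lborel)"
    (is "?I = ?J")
proof -
  have v0: "0 \<le> indicator S x * v x" for x by (auto simp: indicator_def v u)
  have u0: "0 \<le> indicator (T ` S) y * u y" for y by (auto simp: indicator_def u)
  have restr: "((\<lambda>x. indicator A x * F x) has_integral r) UNIV \<longleftrightarrow> (F has_integral r) A"
    for A and F :: "(real, 'n) vec \<Rightarrow> real" and r
  proof -
    have "(\<lambda>x. indicator A x * F x) = (\<lambda>x. if x \<in> A then F x else 0)"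
      by (auto simp: fun_eq_iff indicator_def)
    then show ?thesis by (simp only: has_integral_restrict_UNIV)
  qed
  have "((\<lambda>x. \<bar>det (matrix (T' x))\<bar> * u (T x)) has_integral r) S \<longleftrightarrow> (u has_integral r) (T ` S)" for r
  proof -
    have "S \<in> sets lebesgue" using S by (metis sets_completionI_sets sets_lborel)
    from has_absolute_integral_change_of_variables[OF this der inj, of "\<lambda>y. vec (u y) :: real^1" "vec r"]
    show ?thesis
      by (simp add: absolutely_integrable_on_1_iff integral_on_1_eq absolutely_integrable_on_iff_nonneg u
          has_integral_iff)
  qed
  moreover have "((\<lambda>x. \<bar>det (matrix (T' x))\<bar> * u (T x)) has_integral r) S \<longleftrightarrow> (v has_integral r) S" for r
    by (rule has_integral_cong) (simp add: v)
  ultimately have iff: "((\<lambda>x. indicator S x * v x) has_integral r) UNIV \<longleftrightarrow>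
      ((\<lambda>y. indicator (T ` S) y * u y) has_integral r) UNIV" for r
    by (simp only: restr)
  have leb: "f \<in> borel_measurable lebesgue" if "f \<in> borel_measurable borel" for f :: "(real, 'n) vec \<Rightarrow> real"
    using that by (simp add: measurable_completion)
  have *: "?I = ennreal r \<longleftrightarrow> ?J = ennreal r" if "r \<ge> 0" for r
    using iff[of r] that leb[OF mv] leb[OF mu]
    unfolding has_integral_iff_nn_integral_lebesgue[OF v0] has_integral_iff_nn_integral_lebesgue[OF u0]
    by (simp add: nn_integral_completion)
  show ?thesis
  proof (cases ?I)
    case (real r) then show ?thesis using * by metis
  next
    case top
    then show ?thesis using * by (cases ?J) auto
  qed
qed

lemma nn_integral_change_of_variables:
  fixes T :: "real^'n::finite \<Rightarrow> real^'n"
  assumes S: "S \<in> sets borel"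
    and der: "\<And>x. x \<in> S \<Longrightarrow> (T has_derivative T' x) (at x within S)"
    and inj: "inj_on T S"
    and u: "\<And>y. 0 \<le> u y" and v: "\<And>x. x \<in> S \<Longrightarrow> v x = \<bar>det (matrix (T' x))\<bar> * u (T x)"
    and mv: "(\<lambda>x. indicator S x * v x) \<in> borel_measurable borel"
    and mu: "(\<lambda>y. indicator (T ` S) y * u y) \<in> borel_measurable borel"
  shows "(\<integral>\<^sup>+x. ennreal (indicator S x * v x) \<partial>lborel) = (\<integral>\<^sup>+y. ennreal (indicator (T ` S) y * u y) \<partial>lborel)"
proof -
  define h :: "'n ranked \<Rightarrow> 'n" where "h = unranked"
  have h: "bij h" by (simp add: h_def bij_unranked)
  define R where "R = relabel h"
  define Q where "Q = relabel (inv h)"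
  have RQ: "R (Q y) = y" "Q (R x) = x" for x y by (simp_all add: R_def Q_def relabel_inverse h)
  have bl: "bounded_linear R" "bounded_linear Q" by (simp_all add: R_def Q_def bounded_linear_relabel)
  have [measurable]: "R \<in> borel_measurable borel" "Q \<in> borel_measurable borel" by (simp_all add: R_def Q_def)
  have Im: "R ` A = Q -` A" for A by (auto simp: RQ image_iff) (metis RQ)
  have TS: "(R \<circ> T \<circ> Q) ` (R ` S) = R ` (T ` S)" by (auto simp: image_comp RQ)
  have ind: "indicator (R ` A) y = indicator A (Q y)" for A y by (simp add: Im indicator_def)
  have invh: "inv h (h i) = i" for i using h by (simp add: bij_is_inj)
  have "(\<integral>\<^sup>+x. ennreal (indicator S x * v x) \<partial>lborel) =
      (\<integral>\<^sup>+y. ennreal (indicator S (Q y) * v (Q y)) \<partial>lborel)"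
    unfolding Q_def using mv by (intro nn_integral_relabel[symmetric]) (auto simp: h bij_imp_bij_inv)
  also have "\<dots> = (\<integral>\<^sup>+y. ennreal (indicator (R ` S) y * (v \<circ> Q) y) \<partial>lborel)"
    by (simp add: ind)
  also have "\<dots> = (\<integral>\<^sup>+y. ennreal (indicator ((R \<circ> T \<circ> Q) ` (R ` S)) y * (u \<circ> Q) y) \<partial>lborel)"
  proof (rule nn_integral_change_of_variables_wellorder)
    show "R ` S \<in> sets borel" unfolding Im using measurable_sets[OF \<open>Q \<in> borel_measurable borel\<close> S] by simp
    show "((R \<circ> T \<circ> Q) has_derivative (R \<circ> T' (Q y) \<circ> Q)) (at y within R ` S)" if "y \<in> R ` S" for y
    proof -
      have y: "Q y \<in> S" using that by (auto simp: RQ)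
      have QS: "Q ` (R ` S) = S" by (auto simp: RQ image_iff)
      have "(T \<circ> Q has_derivative T' (Q y) \<circ> Q) (at y within R ` S)"
        by (rule diff_chain_within) (use der[OF y] bl QS in \<open>auto intro: bounded_linear_imp_has_derivative\<close>)
      then show ?thesis
        using bounded_linear.has_derivative[OF bl(1)] by (simp add: o_def)
    qed
    show "inj_on (R \<circ> T \<circ> Q) (R ` S)"
      using inj by (auto simp: inj_on_def RQ) (metis RQ(2))
    show "0 \<le> (u \<circ> Q) y" for y by (simp add: u)
    show "(v \<circ> Q) y = \<bar>det (matrix (R \<circ> T' (Q y) \<circ> Q))\<bar> * (u \<circ> Q) ((R \<circ> T \<circ> Q) y)" if "y \<in> R ` S" for y
    proof -
      have ax: "Q (axis j 1) = axis (h j) 1" for j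
        using h by (auto simp: Q_def relabel_def vec_eq_iff axis_def invh bij_inv_eq_iff)
      have "matrix (R \<circ> T' (Q y) \<circ> Q) = (\<chi> i j. matrix (T' (Q y)) $ h i $ h j)"
        by (simp add: matrix_def vec_eq_iff ax R_def relabel_def)
      then show ?thesis
        using v[of "Q y"] that det_reindex[OF h] by (auto simp: RQ)
    qed
    show "(\<lambda>x. indicator (R ` S) x * (v \<circ> Q) x) \<in> borel_measurable borel"
      using measurable_compose[OF \<open>Q \<in> borel_measurable borel\<close> mv] by (simp add: ind)
    show "(\<lambda>x. indicator ((R \<circ> T \<circ> Q) ` R ` S) x * (u \<circ> Q) x) \<in> borel_measurable borel"
      unfolding TS using measurable_compose[OF \<open>Q \<in> borel_measurable borel\<close> mu] by (simp add: ind)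
  qed
  also have "\<dots> = (\<integral>\<^sup>+y. ennreal (indicator (T ` S) (Q y) * u (Q y)) \<partial>lborel)"
    unfolding TS by (simp add: ind)
  also have "\<dots> = (\<integral>\<^sup>+y. ennreal (indicator (T ` S) y * u y) \<partial>lborel)"
    unfolding Q_def using mu by (intro nn_integral_relabel) (auto simp: h bij_imp_bij_inv)
  finally show ?thesis .
qed

section \<open>Parametrizations and transition maps\<close>

text \<open>Here \<open>f ` S\<close> may have empty interior, as for a parametrized surface, so \<open>f'\<close> is only assumed to
  have a left inverse. Mere continuity of \<open>g\<close> suffices: it confines the error of \<open>f\<close> to a small
  neighbourhood, this yields a Lipschitz bound for \<open>g\<close> at the point, and the bound turns the error of
  \<open>f\<close> into one for \<open>g\<close>. For parametrizations it replaces the inverse function theorem.\<close>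

lemma has_derivative_inverse_within:
  fixes f :: "'a::real_normed_vector \<Rightarrow> 'b::real_normed_vector"
  assumes f: "(f has_derivative f') (at x within S)" and "x \<in> S"
    and g: "\<And>z. z \<in> S \<Longrightarrow> g (f z) = z" and cont: "continuous (at (f x) within f ` S) g"
    and g': "bounded_linear g'" "\<And>v. g' (f' v) = v"
  shows "(g has_derivative g') (at (f x) within f ` S)"
proof -
  interpret f': bounded_linear f' using f by (rule has_derivative_bounded_linear)
  interpret g': bounded_linear g' by fact
  obtain C where C: "C > 0" "\<And>v. norm (g' v) \<le> norm v * C"
    using g'.pos_bounded by blast
  \<comment> \<open>The error of the inverse is controlled by the error of \<open>f\<close>, pulled back by \<open>g'\<close>.\<close>
  have err: "\<exists>d>0. \<forall>z\<in>S. norm (f z - f x) < d \<longrightarrow>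
      norm (z - x - g' (f z - f x)) \<le> e * norm (z - x)" if "e > 0" for e
  proof -
    obtain d0 where d0: "d0 > 0" "\<And>z. z \<in> S \<Longrightarrow> norm (z - x) < d0 \<Longrightarrow>
        norm (f z - f x - f' (z - x)) \<le> e / C * norm (z - x)"
      using f \<open>e > 0\<close> C(1) unfolding has_derivative_within_alt by (metis divide_pos_pos)
    obtain d where d: "d > 0" "\<And>z. z \<in> S \<Longrightarrow> norm (f z - f x) < d \<Longrightarrow> norm (z - x) < d0"
      using cont d0(1) g \<open>x \<in> S\<close> unfolding continuous_within_eps_delta by (force simp: dist_norm)
    have "norm (z - x - g' (f z - f x)) \<le> e * norm (z - x)" if "z \<in> S" "norm (f z - f x) < d" for z
    proof -
      have "z - x - g' (f z - f x) = - g' (f z - f x - f' (z - x))"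
        by (simp add: g'.diff g'(2))
      then have "norm (z - x - g' (f z - f x)) \<le> norm (f z - f x - f' (z - x)) * C"
        using C(2) by simp
      also have "\<dots> \<le> e / C * norm (z - x) * C"
        using d0(2)[OF that(1) d(2)[OF that]] C(1) by (intro mult_right_mono) auto
      finally show ?thesis using C(1) by simp
    qed
    then show ?thesis using d(1) by blast
  qed
  obtain d1 where d1: "d1 > 0" "\<And>z. z \<in> S \<Longrightarrow> norm (f z - f x) < d1 \<Longrightarrow>
      norm (z - x - g' (f z - f x)) \<le> 1/2 * norm (z - x)"
    using err[of "1/2"] by auto
  have lip: "norm (z - x) \<le> 2 * C * norm (f z - f x)" if "z \<in> S" "norm (f z - f x) < d1" for z
    using d1(2)[OF that] C(2)[of "f z - f x"] norm_triangle_sub[of "z - x" "g' (f z - f x)"]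
    by (simp add: algebra_simps)
  show ?thesis
    unfolding has_derivative_within_alt
  proof (intro conjI g'(1) allI impI)
    fix e :: real assume "e > 0"
    then obtain d where d: "d > 0" "\<And>z. z \<in> S \<Longrightarrow> norm (f z - f x) < d \<Longrightarrow>
        norm (z - x - g' (f z - f x)) \<le> e / (2 * C) * norm (z - x)"
      using err[of "e / (2 * C)"] C(1) by auto
    have "norm (g (f z) - g (f x) - g' (f z - f x)) \<le> e * norm (f z - f x)"
      if z: "z \<in> S" "norm (f z - f x) < min d d1" for z
    proof -
      have "norm (z - x - g' (f z - f x)) \<le> e / (2 * C) * norm (z - x)" using d(2) z by simp
      also have "\<dots> \<le> e / (2 * C) * (2 * C * norm (f z - f x))"
        using lip z \<open>e > 0\<close> C(1) by (intro mult_left_mono) auto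
      finally show ?thesis using C(1) z(1) \<open>x \<in> S\<close> by (simp add: g)
    qed
    then show "\<exists>d>0. \<forall>y\<in>f ` S. norm (y - f x) < d \<longrightarrow> norm (g y - g (f x) - g' (y - f x)) \<le> e * norm (y - f x)"
      using d(1) d1(1) by (intro exI[of _ "min d d1"]) auto
  qed
qed

text \<open>From every point of the half space, boundary points included, one can move a little in each
  positive coordinate direction without leaving it; so the derivative is determined.\<close>

lemma half_space_derivative_unique:
  fixes f :: "real^'n::finite \<Rightarrow> 'b::real_normed_vector"
  assumes "open O'" "w \<in> O' \<inter> half_space k"
    and "(f has_derivative D1) (at w within O' \<inter> half_space k)"
    and "(f has_derivative D2) (at w within O' \<inter> half_space k)"
  shows "D1 = D2"
proof (rule frechet_derivative_unique_within[OF assms(3,4)])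
  fix i :: "real^'n" and e :: real assume i: "i \<in> Basis" and "e > 0"
  obtain j where j: "i = axis j 1" using i by (auto simp: Basis_vec_range)
  obtain r where r: "r > 0" "ball w r \<subseteq> O'" using assms(1,2) open_contains_ball by blast
  define d where "d = min e r / 2"
  have d: "0 < d" "d < e" "d < r" using r(1) \<open>e > 0\<close> by (auto simp: d_def)
  have "w + d *\<^sub>R i \<in> O'" using r(2) d by (auto simp: dist_norm j subset_iff)
  moreover have "w + d *\<^sub>R i \<in> half_space k"
    using assms(2) d by (auto simp: half_space_def j axis_def)
  ultimately show "\<exists>d. 0 < \<bar>d\<bar> \<and> \<bar>d\<bar> < e \<and> w + d *\<^sub>R i \<in> O' \<inter> half_space k"
    using d by (intro exI[of _ d]) auto
qed

lemma closed_half_space: "closed (half_space k)"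
  unfolding half_space_def by (intro closed_Collect_le continuous_intros)

locale chart =
  fixes M :: "('n::finite) ambient set" and k Q X
  assumes lp: "local_parametrization M k Q X"
begin

abbreviation "D \<equiv> Q \<inter> half_space k"

abbreviation "dX w \<equiv> frechet_derivative X (at w)"

lemma open_Q: "open Q" and smooth: "smooth_on Q X"
  and openin_image: "openin (top_of_set M) (X ` D)"
  and inj_dX: "w \<in> D \<Longrightarrow> inj (dX w)"
  using lp by (auto simp: local_parametrization_def)

lemma has_derivative_X: "w \<in> Q \<Longrightarrow> (X has_derivative dX w) (at w)"
  using smooth smooth_on_has_derivative by blast

lemma continuous_X: "continuous_on Q X"
  by (rule smooth_on_imp_continuous_on[OF smooth])

lemma linear_dX: "w \<in> Q \<Longrightarrow> linear (dX w)"
  using smooth smooth_on_linear_derivative by blast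

lemma image_subset: "X ` D \<subseteq> M"
  using openin_image openin_imp_subset by blast

lemma inj_X: "inj_on X D"
  using lp unfolding local_parametrization_def homeomorphism_def by (metis inj_on_inverseI)

lemma continuous_inverse: "continuous_on (X ` D) (inv_into D X)"
proof -
  obtain Y where "homeomorphism D (X ` D) X Y" using lp by (auto simp: local_parametrization_def)
  then have "continuous_on (X ` D) Y" "\<And>w. w \<in> D \<Longrightarrow> Y (X w) = w" by (auto simp: homeomorphism_def)
  then show ?thesis
    by (elim continuous_on_cong[THEN iffD1, rotated -1]) (auto simp: inv_into_f_f[OF inj_X])
qed

lemma inverse_X: "w \<in> D \<Longrightarrow> inv_into D X (X w) = w"
  by (rule inv_into_f_f[OF inj_X])

lemma borel_D: "D \<in> sets borel"
  using open_Q closed_half_space by (intro sets.Int borel_open borel_closed)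

lemma area_density_pos: "w \<in> D \<Longrightarrow> area_density X w > 0"
  unfolding area_density_gram using gram_linear_pos[OF linear_dX inj_dX] by auto

lemma continuous_area_density: "continuous_on Q (area_density X)"
  unfolding area_density_def[abs_def] det_def
  by (intro continuous_intros) (simp_all add: smooth_on_continuous_derivative[OF smooth] continuous_intros)

lemma openin_preimage:
  assumes "openin (top_of_set M) W"
  obtains O' where "open O'" "O' \<subseteq> Q" "{w \<in> D. X w \<in> W} = O' \<inter> half_space k"
proof -
  obtain U where U: "open U" "W = M \<inter> U" using assms by (auto simp: openin_open)
  have "open (Q \<inter> X -` U)"
    using continuous_X open_Q U(1) by (simp add: continuous_on_open_vimage Int_commute)
  moreover have "{w \<in> D. X w \<in> W} = (Q \<inter> X -` U) \<inter> half_space k"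
    using image_subset U(2) by auto
  ultimately show ?thesis using that[of "Q \<inter> X -` U"] by auto
qed

lemma borel_preimage:
  assumes "A \<in> sets (restrict_space borel M)"
  shows "{w \<in> D. X w \<in> A} \<in> sets borel"
proof -
  obtain A' where A': "A' \<in> sets borel" "A = M \<inter> A'" using assms by (auto simp: sets_restrict_space)
  have "X \<in> borel_measurable (restrict_space borel D)"
    by (rule borel_measurable_continuous_on_restrict) (meson Int_lower1 continuous_X continuous_on_subset)
  from measurable_sets[OF this A'(1)] have "X -` A' \<inter> D \<in> sets (restrict_space borel D)"
    by (simp add: space_restrict_space)
  then have "X -` A' \<inter> D \<in> sets borel"
    by (subst (asm) sets_restrict_space_iff) (use borel_D in auto)
  moreover have "{w \<in> D. X w \<in> A} = X -` A' \<inter> D" using image_subset A'(2) by auto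
  ultimately show ?thesis by simp
qed

lemma measurable_area_indicator:
  assumes "B \<in> sets borel" "B \<subseteq> Q"
  shows "(\<lambda>w. indicator B w * area_density X w) \<in> borel_measurable borel"
  using borel_measurable_continuous_on_indicator[OF assms(1) continuous_on_subset[OF continuous_area_density assms(2)]]
  by simp

end

text \<open>Although parametrizations map into a space of higher dimension, the transition map \<open>T\<close> is
  differentiable because the inverse of a parametrization is differentiable along the surface.
  Composing \<open>T\<close> with \<open>X\<close> gives back \<open>X2\<close>, and uniqueness of derivatives on the half space turns
  this into an identity between derivatives.\<close>

lemma transition_map:
  fixes M :: "('n::finite) ambient set"
  assumes "local_parametrization M k Q X" "local_parametrization M k2 Q2 X2"
    and w: "w \<in> Q2 \<inter> half_space k2" "X2 w \<in> X ` (Q \<inter> half_space k)"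
  defines "O2 \<equiv> {w \<in> Q2 \<inter> half_space k2. X2 w \<in> X ` (Q \<inter> half_space k)}"
    and "T \<equiv> \<lambda>w. inv_into (Q \<inter> half_space k) X (X2 w)"
  obtains T' where "(T has_derivative T') (at w within O2)"
    "\<And>u. frechet_derivative X (at (T w)) (T' u) = frechet_derivative X2 (at w) u"
proof -
  interpret c: chart M k Q X by (rule chart.intro) fact
  interpret c2: chart M k2 Q2 X2 by (rule chart.intro) fact
  have Tw: "T w \<in> c.D" "X (T w) = X2 w" using w(2) by (auto simp: T_def c.inverse_X)
  obtain g' where g': "linear g'" "g' \<circ> c.dX (T w) = id"
    using linear_injective_left_inverse[OF c.linear_dX c.inj_dX] Tw(1) by blast
  have bl: "bounded_linear g'" using g'(1) by (simp add: linear_conv_bounded_linear)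
  have inv: "(inv_into c.D X has_derivative g') (at (X (T w)) within X ` c.D)"
  proof (rule has_derivative_inverse_within[where f' = "c.dX (T w)"])
    show "(X has_derivative c.dX (T w)) (at (T w) within c.D)"
      using Tw(1) c.has_derivative_X has_derivative_at_withinI by blast
    show "continuous (at (X (T w)) within X ` c.D) (inv_into c.D X)"
      using c.continuous_inverse Tw(1) by (auto simp: continuous_on_eq_continuous_within)
  qed (use Tw c.inverse_X bl g'(2) in \<open>auto simp: fun_eq_iff\<close>)
  have X2: "(X2 has_derivative c2.dX w) (at w within O2)"
    using w(1) c2.has_derivative_X has_derivative_at_withinI by blast
  have sub: "X2 ` O2 \<subseteq> X ` c.D" by (auto simp: O2_def)
  have T': "(T has_derivative (\<lambda>u. g' (c2.dX w u))) (at w within O2)"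
    unfolding T_def
    by (rule has_derivative_in_compose[OF X2]) (use inv sub Tw(2) in \<open>auto intro: has_derivative_subset\<close>)
  have "(X has_derivative c.dX (T w)) (at (T w) within T ` O2)"
    using Tw(1) c.has_derivative_X has_derivative_at_withinI by blast
  from has_derivative_in_compose[OF T' this]
  have "((\<lambda>w. X (T w)) has_derivative (\<lambda>u. c.dX (T w) (g' (c2.dX w u)))) (at w within O2)" .
  moreover have "X (T z) = X2 z" if "z \<in> O2" for z
    using that unfolding O2_def T_def by (auto intro: f_inv_into_f)
  ultimately have XT: "(X2 has_derivative (\<lambda>u. c.dX (T w) (g' (c2.dX w u)))) (at w within O2)"
    using w by (elim has_derivative_transform[rotated -1]) (auto simp: O2_def)
  obtain O' where "open O'" "O' \<subseteq> Q2" "{w \<in> c2.D. X2 w \<in> X ` c.D} = O' \<inter> half_space k2"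
    by (rule c2.openin_preimage[OF c.openin_image])
  then have O': "open O'" "O2 = O' \<inter> half_space k2" by (simp_all only: O2_def)
  have "w \<in> O2" using w by (simp add: O2_def)
  then have "(\<lambda>u. c.dX (T w) (g' (c2.dX w u))) = c2.dX w"
    using half_space_derivative_unique[OF O'(1)] XT X2 unfolding O'(2) by blast
  then show ?thesis using that[OF T'] by (metis (no_types))
qed

text \<open>The definition collects tangent vectors from all parametrizations at once. By
  \<open>transition_map\<close> they all lie in the range of the derivative of any single one.\<close>

lemma tangent_space_chart:
  assumes "local_parametrization M k Q X" "w \<in> Q \<inter> half_space k"
  shows "tangent_space M (X w) = range (frechet_derivative X (at w))"
proof
  show "range (frechet_derivative X (at w)) \<subseteq> tangent_space M (X w)"
    using assms unfolding tangent_space_def by blast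
  show "tangent_space M (X w) \<subseteq> range (frechet_derivative X (at w))"
  proof
    fix v assume "v \<in> tangent_space M (X w)"
    then obtain k2 Q2 X2 w2 u where lp2: "local_parametrization M k2 Q2 X2" "w2 \<in> Q2 \<inter> half_space k2"
      "X2 w2 = X w" "v = frechet_derivative X2 (at w2) u"
      unfolding tangent_space_def by auto
    have "X2 w2 \<in> X ` (Q \<inter> half_space k)" using lp2(3) assms(2) by auto
    from transition_map[OF assms(1) lp2(1,2) this] obtain T' where
      "\<And>u. frechet_derivative X (at (inv_into (Q \<inter> half_space k) X (X2 w2))) (T' u) = frechet_derivative X2 (at w2) u"
      by metis
    moreover have "inv_into (Q \<inter> half_space k) X (X2 w2) = w"
      using chart.inverse_X[OF chart.intro[OF assms(1)] assms(2)] lp2(3) by simp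
    ultimately show "v \<in> range (frechet_derivative X (at w))"
      using lp2(4) by (metis rangeI)
  qed
qed

text \<open>Change of variables along the transition map \<open>T\<close>: the derivatives of the two parametrizations
  differ by the linear map \<open>T'\<close>, hence their Gram determinants by \<open>(det T')\<^sup>2\<close>, and the area densities
  by exactly the factor in the transformation formula.\<close>

lemma chart_area_consistent:
  fixes M :: "('n::finite) ambient set"
  assumes "local_parametrization M k Q X" "local_parametrization M k2 Q2 X2"
    and A: "A \<in> sets (restrict_space borel M)"
    and sub: "A \<subseteq> X ` (Q \<inter> half_space k)" "A \<subseteq> X2 ` (Q2 \<inter> half_space k2)"
  shows "(\<integral>\<^sup>+w\<in>{w \<in> Q2 \<inter> half_space k2. X2 w \<in> A}. ennreal (area_density X2 w) \<partial>lborel) =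
    (\<integral>\<^sup>+w\<in>{w \<in> Q \<inter> half_space k. X w \<in> A}. ennreal (area_density X w) \<partial>lborel)"
proof -
  interpret c: chart M k Q X by (rule chart.intro) fact
  interpret c2: chart M k2 Q2 X2 by (rule chart.intro) fact
  define T where "T = (\<lambda>w. inv_into c.D X (X2 w))"
  define S where "S = {w \<in> c2.D. X2 w \<in> A}"
  define B where "B = {w \<in> c.D. X w \<in> A}"
  define O2 where "O2 = {w \<in> c2.D. X2 w \<in> X ` c.D}"
  have SO: "S \<subseteq> O2" using sub by (auto simp: S_def O2_def)
  have XT: "T w \<in> c.D" "X (T w) = X2 w" if "w \<in> O2" for w
    using that by (auto simp: T_def O2_def c.inverse_X)
  have TS: "T ` S = B"
  proof (intro equalityI subsetI)
    fix z assume "z \<in> T ` S" then show "z \<in> B" using XT SO by (auto simp: B_def S_def)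
  next
    fix z assume z: "z \<in> B"
    then obtain w where "w \<in> c2.D" "X2 w = X z" using sub by (auto simp: B_def)
    then show "z \<in> T ` S" using z c.inverse_X[of z] by (intro image_eqI[of _ _ w]) (auto simp: T_def S_def B_def)
  qed
  have "\<forall>w\<in>O2. \<exists>T'. (T has_derivative T') (at w within O2) \<and> (\<forall>u. c.dX (T w) (T' u) = c2.dX w u)"
    using transition_map[OF assms(1,2)] unfolding T_def O2_def by (metis (no_types, lifting) mem_Collect_eq)
  then obtain T' where T': "\<And>w. w \<in> O2 \<Longrightarrow> (T has_derivative T' w) (at w within O2)"
      "\<And>w u. w \<in> O2 \<Longrightarrow> c.dX (T w) (T' w u) = c2.dX w u"
    by metis
  have dens: "area_density X2 w = \<bar>det (matrix (T' w))\<bar> * area_density X (T w)" if "w \<in> O2" for w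
  proof -
    have lin: "linear (c.dX (T w))" using c.linear_dX XT(1)[OF that] by blast
    have "c2.dX w (axis j 1) = (\<Sum>i\<in>UNIV. matrix (T' w) $ i $ j *\<^sub>R c.dX (T w) (axis i 1))" for j
    proof -
      have "c2.dX w (axis j 1) = c.dX (T w) (\<Sum>i\<in>UNIV. T' w (axis j 1) $ i *s axis i 1)"
        using T'(2)[OF that] by (simp add: basis_expansion)
      then show ?thesis
        by (simp add: linear_sum[OF lin] linear_scale[OF lin] scalar_mult_eq_scaleR matrix_def)
    qed
    then show ?thesis
      unfolding area_density_gram
      by (subst gram_linear_combination) (auto simp: real_sqrt_mult)
  qed
  have SB: "S \<in> sets borel" "B \<in> sets borel"
    unfolding S_def B_def using c.borel_preimage c2.borel_preimage A by auto
  have "(\<integral>\<^sup>+w. ennreal (indicator S w * area_density X2 w) \<partial>lborel) =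
      (\<integral>\<^sup>+w. ennreal (indicator (T ` S) w * (indicator B w * area_density X w)) \<partial>lborel)"
  proof (rule nn_integral_change_of_variables[OF SB(1)])
    show "(T has_derivative T' w) (at w within S)" if "w \<in> S" for w
      using that SO T'(1) by (meson has_derivative_subset subsetD)
    show "inj_on T S"
      using XT(2) SO c2.inj_X unfolding inj_on_def S_def by (metis (no_types, lifting) mem_Collect_eq subsetD)
    show "0 \<le> indicator B w * area_density X w" for w
      using c.area_density_pos[of w] by (auto simp: indicator_def B_def)
    show "area_density X2 w = \<bar>det (matrix (T' w))\<bar> * (indicator B (T w) * area_density X (T w))" if "w \<in> S" for w
    proof -
      have "T w \<in> B" using that TS by blast
      then show ?thesis using dens that SO by auto
    qed
    show "(\<lambda>w. indicator S w * area_density X2 w) \<in> borel_measurable borel"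
      using SB(1) by (intro c2.measurable_area_indicator) (auto simp: S_def)
    have "(\<lambda>w. indicator B w * area_density X w) \<in> borel_measurable borel"
      using SB(2) by (intro c.measurable_area_indicator) (auto simp: B_def)
    then show "(\<lambda>w. indicator (T ` S) w * (indicator B w * area_density X w)) \<in> borel_measurable borel"
      unfolding TS using SB(2) by simp
  qed
  moreover have "ennreal (indicator E w * r) = ennreal r * indicator E w" for E and w :: "real^'n" and r
    by (simp add: indicator_def)
  moreover have "indicator B w * (indicator B w * r) = indicator B w * r" for w and r :: real
    by (simp add: indicator_def)
  ultimately have "(\<integral>\<^sup>+w\<in>S. ennreal (area_density X2 w) \<partial>lborel) =
      (\<integral>\<^sup>+w\<in>B. ennreal (area_density X w) \<partial>lborel)"
    by (simp only: TS)
  then show ?thesis by (simp only: S_def B_def)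
qed

section \<open>The surface measure\<close>

lemma openin_sets_restrict_borel:
  assumes "openin (top_of_set M) U"
  shows "U \<in> sets (restrict_space borel M)"
proof -
  obtain V where "open V" "U = M \<inter> V" using assms by (auto simp: openin_open)
  then show ?thesis unfolding sets_restrict_space by (intro image_eqI[of _ _ V]) auto
qed

text \<open>A finite subcover, made disjoint by removing from each member the earlier ones.\<close>

lemma compact_borel_partition:
  fixes M :: "'a::topological_space set"
  assumes "compact M" "\<And>p. p \<in> M \<Longrightarrow> \<exists>U. openin (top_of_set M) U \<and> p \<in> U \<and> Pr U"
  obtains n :: nat and U P where "\<And>i. i < n \<Longrightarrow> Pr (U i)"
    "\<And>i. i < n \<Longrightarrow> U i \<in> sets (restrict_space borel M)"
    "\<And>i. i < n \<Longrightarrow> P i \<in> sets (restrict_space borel M)" "\<And>i. i < n \<Longrightarrow> P i \<subseteq> U i"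
    "disjoint_family_on P {..<n}" "M = (\<Union>i<n. P i)"
proof -
  let ?C = "{U. openin (top_of_set M) U \<and> Pr U}"
  have "M \<subseteq> \<Union>?C" using assms(2) by blast
  then obtain \<D> where \<D>: "\<D> \<subseteq> ?C" "finite \<D>" "M \<subseteq> \<Union>\<D>"
    using assms(1) unfolding compact_eq_openin_cover by (metis (mono_tags, lifting) mem_Collect_eq)
  obtain n :: nat and U where U: "\<D> = U ` {i. i < n}"
    using finite_imp_nat_seg_image_inj_on[OF \<D>(2)] by metis
  have ope: "openin (top_of_set M) (U i) \<and> Pr (U i)" if "i < n" for i
    using \<D>(1) U that by auto
  have Us: "U i \<in> sets (restrict_space borel M)" if "i < n" for i
    using ope[OF that] openin_sets_restrict_borel by blast
  define P where "P i = U i - (\<Union>j<i. U j)" for i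
  show ?thesis
  proof (rule that[of n U P])
    fix i assume i: "i < n"
    show "Pr (U i)" "P i \<subseteq> U i" using ope i by (auto simp: P_def)
    show "U i \<in> sets (restrict_space borel M)" by (rule Us[OF i])
    show "P i \<in> sets (restrict_space borel M)"
      unfolding P_def using i by (intro sets.Diff sets.finite_UN Us) auto
  next
    show "disjoint_family_on P {..<n}"
      unfolding disjoint_family_on_def P_def by (metis (no_types, lifting) DiffE UN_I disjoint_iff lessThan_iff linorder_neqE_nat)
    have "M \<subseteq> (\<Union>i<n. P i)"
    proof
      fix x assume "x \<in> M"
      then have ex: "\<exists>i. i < n \<and> x \<in> U i" using \<D>(3) U by auto
      define i where "i = (LEAST i. i < n \<and> x \<in> U i)"
      have "i < n" "x \<in> U i" using LeastI_ex[OF ex] by (simp_all add: i_def)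
      moreover have "x \<notin> U j" if "j < i" for j
        using not_less_Least[of j "\<lambda>i. i < n \<and> x \<in> U i"] that \<open>i < n\<close> by (auto simp: i_def)
      ultimately show "x \<in> (\<Union>i<n. P i)" by (auto simp: P_def)
    qed
    moreover have "(\<Union>i<n. P i) \<subseteq> M"
    proof
      fix x assume "x \<in> (\<Union>i<n. P i)"
      then obtain i where "i < n" "x \<in> U i" by (auto simp: P_def)
      then show "x \<in> M" using ope openin_imp_subset by blast
    qed
    ultimately show "M = (\<Union>i<n. P i)" by blast
  qed
qed

lemma emeasure_partition:
  fixes n :: nat
  assumes "\<And>i. i < n \<Longrightarrow> P i \<in> sets \<mu>" "disjoint_family_on P {..<n}" "A \<in> sets \<mu>" "A \<subseteq> (\<Union>i<n. P i)"
  shows "emeasure \<mu> A = (\<Sum>i<n. emeasure \<mu> (A \<inter> P i))"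
proof -
  have "A = (\<Union>i<n. A \<inter> P i)" using assms(4) by blast
  then have "emeasure \<mu> A = emeasure \<mu> (\<Union>i<n. A \<inter> P i)" by simp
  also have "\<dots> = (\<Sum>i<n. emeasure \<mu> (A \<inter> P i))"
    using assms by (intro sum_emeasure[symmetric]) (auto simp: disjoint_family_on_def)
  finally show ?thesis .
qed

lemma measure_eq_locally:
  fixes M :: "'a::topological_space set"
  assumes "compact M" "sets \<mu> = sets (restrict_space borel M)" "sets \<nu> = sets (restrict_space borel M)"
    and loc: "\<And>p. p \<in> M \<Longrightarrow> \<exists>U. openin (top_of_set M) U \<and> p \<in> U \<and>
        (\<forall>A\<in>sets \<mu>. A \<subseteq> U \<longrightarrow> emeasure \<mu> A = emeasure \<nu> A)"
  shows "\<mu> = \<nu>"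
proof (rule measure_eqI)
  show "sets \<mu> = sets \<nu>" using assms by simp
  fix A assume A: "A \<in> sets \<mu>"
  then have "A \<subseteq> M" using assms(2) by (auto simp: sets_restrict_space)
  obtain n :: nat and U P where P: "\<And>i. i < n \<Longrightarrow> \<forall>A\<in>sets \<mu>. A \<subseteq> U i \<longrightarrow> emeasure \<mu> A = emeasure \<nu> A"
    "\<And>i. i < n \<Longrightarrow> U i \<in> sets (restrict_space borel M)"
    "\<And>i. i < n \<Longrightarrow> P i \<in> sets (restrict_space borel M)" "\<And>i. i < n \<Longrightarrow> P i \<subseteq> U i"
    "disjoint_family_on P {..<n}" "M = (\<Union>i<n. P i)"
    by (rule compact_borel_partition[OF assms(1) loc]) (assumption, rule that)
  have "emeasure \<mu> A = (\<Sum>i<n. emeasure \<mu> (A \<inter> P i))"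
    using P A assms(2) \<open>A \<subseteq> M\<close> by (intro emeasure_partition) auto
  also have "\<dots> = (\<Sum>i<n. emeasure \<nu> (A \<inter> P i))"
    using P A assms(2) by (intro sum.cong refl) (auto simp: le_infI2 intro!: P(1)[rule_format])
  also have "\<dots> = emeasure \<nu> A"
    using P A assms(2,3) \<open>A \<subseteq> M\<close> by (intro emeasure_partition[symmetric]) auto
  finally show "emeasure \<mu> A = emeasure \<nu> A" .
qed

context chart
begin

lemma restrict:
  assumes "open Q'" "Q' \<subseteq> Q"
  shows "local_parametrization M k Q' X"
proof -
  obtain Y where Y: "homeomorphism D (X ` D) X Y" using lp by (auto simp: local_parametrization_def)
  have sub: "Q' \<inter> half_space k \<subseteq> D" using assms(2) by blast
  have "openin (top_of_set D) (Q' \<inter> half_space k)"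
    using assms by (auto simp: openin_open)
  then have "openin (top_of_set (X ` D)) (X ` (Q' \<inter> half_space k))"
    by (rule homeomorphism_imp_open_map[OF Y])
  then have "openin (top_of_set M) (X ` (Q' \<inter> half_space k))"
    using openin_image openin_trans by blast
  moreover have "homeomorphism (Q' \<inter> half_space k) (X ` (Q' \<inter> half_space k)) X Y"
    using Y sub by (rule homeomorphism_of_subsets) auto
  ultimately show ?thesis
    using assms smooth smooth_on_subset inj_dX sub unfolding local_parametrization_def by blast
qed

text \<open>The area of \<open>A\<close> as computed in this parametrization.\<close>

definition chart_area :: "'n ambient set \<Rightarrow> ennreal" where
  "chart_area A = (\<integral>\<^sup>+w\<in>{w \<in> D. X w \<in> A}. ennreal (area_density X w) \<partial>lborel)"

text \<open>The area measure pulled back to parameter space, where countable additivity can be read off.\<close>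

definition param_measure :: "(real^'n) measure" where
  "param_measure = density lborel (\<lambda>w. ennreal (indicator D w * area_density X w))"

lemma param_density_measurable [measurable]:
  "(\<lambda>w. indicator D w * area_density X w) \<in> borel_measurable borel"
  by (rule measurable_area_indicator[OF borel_D]) auto

lemma chart_area_param_measure:
  assumes "A \<in> sets (restrict_space borel M)"
  shows "chart_area A = emeasure param_measure {w \<in> D. X w \<in> A}"
proof -
  have "(\<lambda>w. ennreal (indicator D w * area_density X w)) \<in> borel_measurable lborel" by measurable
  moreover have "{w \<in> D. X w \<in> A} \<in> sets lborel" using borel_preimage[OF assms] by simp
  ultimately show ?thesis
    unfolding param_measure_def chart_area_def
    by (subst emeasure_density) (auto intro!: nn_integral_cong simp: indicator_def)
qed

lemma chart_area_sum:
  fixes n :: nat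
  assumes "\<And>i. i < n \<Longrightarrow> P i \<in> sets (restrict_space borel M)" "disjoint_family_on P {..<n}"
    "A \<in> sets (restrict_space borel M)" "A \<subseteq> (\<Union>i<n. P i)"
  shows "chart_area A = (\<Sum>i<n. chart_area (A \<inter> P i))"
proof -
  have "chart_area A = emeasure param_measure {w \<in> D. X w \<in> A}"
    by (rule chart_area_param_measure) fact
  also have "\<dots> = (\<Sum>i<n. emeasure param_measure ({w \<in> D. X w \<in> A} \<inter> {w \<in> D. X w \<in> P i}))"
    using borel_preimage[OF assms(3)] borel_preimage[OF assms(1)] assms(2,4)
    by (intro emeasure_partition) (auto simp: disjoint_family_on_def param_measure_def)
  also have "\<dots> = (\<Sum>i<n. chart_area (A \<inter> P i))"
    using assms by (intro sum.cong refl)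
      (auto simp: chart_area_param_measure intro!: arg_cong[where f = "emeasure param_measure"])
  finally show ?thesis .
qed

lemma chart_area_suminf:
  assumes "range A \<subseteq> sets (restrict_space borel M)" "disjoint_family A"
  shows "(\<Sum>i. chart_area (A i)) = chart_area (\<Union>i. A i)"
proof -
  have "(\<Sum>i. emeasure param_measure {w \<in> D. X w \<in> A i}) = emeasure param_measure (\<Union>i. {w \<in> D. X w \<in> A i})"
    using assms borel_preimage by (intro suminf_emeasure) (auto simp: disjoint_family_on_def param_measure_def)
  moreover have "(\<Union>i. {w \<in> D. X w \<in> A i}) = {w \<in> D. X w \<in> (\<Union>i. A i)}" by auto
  ultimately show ?thesis
    using assms by (simp add: chart_area_param_measure image_subset_iff sets.countable_UN)
qed

end

text \<open>The area density may blow up at the edge of the parameter domain. Shrinking the domain to a ball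
  whose closure still lies in it makes the density bounded.\<close>

lemma chart_finite_area:
  fixes M :: "('n::finite) ambient set"
  assumes "submanifold M" "p \<in> M"
  obtains k Q X where "local_parametrization M k Q X" "p \<in> X ` (Q \<inter> half_space k)"
    "chart.chart_area k Q X (X ` (Q \<inter> half_space k)) < \<infinity>"
proof -
  obtain k Q X where lp: "local_parametrization M k Q X" and "p \<in> X ` (Q \<inter> half_space k)"
    using assms unfolding submanifold_def by meson
  then obtain w where w: "w \<in> Q \<inter> half_space k" "X w = p" by blast
  interpret c: chart M k Q X by (rule chart.intro) fact
  obtain r where r: "r > 0" "cball w r \<subseteq> Q" using c.open_Q w open_contains_cball by blast
  let ?B = "ball w r"
  have lp': "local_parametrization M k ?B X" by (rule c.restrict) (use r in auto)
  interpret b: chart M k ?B X by (rule chart.intro) fact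
  have "bounded (area_density X ` cball w r)"
    using continuous_on_subset[OF c.continuous_area_density r(2)]
    by (intro compact_imp_bounded compact_continuous_image) auto
  then obtain K where K: "\<forall>a\<in>area_density X ` cball w r. norm a \<le> K"
    unfolding bounded_iff by blast
  have "b.chart_area (X ` b.D) \<le> (\<integral>\<^sup>+z. ennreal K * indicator ?B z \<partial>lborel)"
    unfolding b.chart_area_def
  proof (rule nn_integral_mono)
    fix z
    show "ennreal (area_density X z) * indicator {w \<in> b.D. X w \<in> X ` b.D} z \<le> ennreal K * indicator ?B z"
    proof (cases "z \<in> ?B")
      case True
      then have "z \<in> cball w r" by simp
      then have "\<bar>area_density X z\<bar> \<le> K" using K by (metis imageI real_norm_def)
      then have "ennreal (area_density X z) \<le> ennreal K" by (intro ennreal_leI) simp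
      then show ?thesis using True by (simp add: indicator_def)
    qed (simp add: indicator_def)
  qed
  also have "\<dots> = ennreal K * emeasure lborel ?B" by (simp add: nn_integral_cmult_indicator)
  also have "\<dots> < \<infinity>" using emeasure_bounded_finite[OF bounded_ball, of w r]
    by (simp add: ennreal_mult_less_top)
  finally show ?thesis using that[OF lp'] w r(1) by auto
qed

text \<open>The property by which \<open>surface_measure\<close> is singled out.\<close>

definition is_surface_measure :: "('n::finite) ambient set \<Rightarrow> 'n ambient measure \<Rightarrow> bool" where
  "is_surface_measure M \<mu> \<longleftrightarrow> sets \<mu> = sets (restrict_space borel M) \<and>
     (\<forall>k Q X A. local_parametrization M k Q X \<and> A \<in> sets \<mu> \<and> A \<subseteq> X ` (Q \<inter> half_space k) \<longrightarrow>
        emeasure \<mu> A = (\<integral>\<^sup>+w\<in>{w \<in> Q \<inter> half_space k. X w \<in> A}. ennreal (area_density X w) \<partial>lborel))"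

text \<open>For existence, add up chart areas over a finite Borel partition subordinate to charts; by
  \<open>chart_area_consistent\<close> the result agrees with the area in every other chart. Uniqueness is local
  because finitely many charts cover \<open>M\<close>.\<close>

lemma ex1_surface_measure:
  fixes M :: "('n::finite) ambient set"
  assumes "submanifold M" "compact M"
  shows "\<exists>!\<mu>. is_surface_measure M \<mu>"
proof (rule ex_ex1I)
  let ?S = "sets (restrict_space borel M)"
  have cover: "\<exists>U. openin (top_of_set M) U \<and> p \<in> U \<and> 
      (\<exists>k Q X. local_parametrization M k Q X \<and> U = X ` (Q \<inter> half_space k))" if "p \<in> M" for p
  proof -
    obtain k Q X where lp: "local_parametrization M k Q X" "p \<in> X ` (Q \<inter> half_space k)"
      using assms(1) \<open>p \<in> M\<close> unfolding submanifold_def by meson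
    then have "openin (top_of_set M) (X ` (Q \<inter> half_space k))"
      by (simp add: local_parametrization_def)
    then show ?thesis using lp by blast
  qed
  obtain n :: nat and U P where U: "\<And>i. i < n \<Longrightarrow> \<exists>k Q X. local_parametrization M k Q X \<and> U i = X ` (Q \<inter> half_space k)"
    and "\<And>i. i < n \<Longrightarrow> U i \<in> ?S"
    and P: "\<And>i. i < n \<Longrightarrow> P i \<in> ?S" "\<And>i. i < n \<Longrightarrow> P i \<subseteq> U i"
      "disjoint_family_on P {..<n}" "M = (\<Union>i<n. P i)"
    by (rule compact_borel_partition[OF assms(2) cover]) (assumption, rule that)
  have "\<forall>i. \<exists>k Q X. i < n \<longrightarrow> local_parametrization M k Q X \<and> U i = X ` (Q \<inter> half_space k)"
    using U by blast
  then obtain k Q X where X: "\<And>i. i < n \<Longrightarrow> local_parametrization M (k i) (Q i) (X i)"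
      "\<And>i. i < n \<Longrightarrow> U i = X i ` (Q i \<inter> half_space (k i))"
    by metis
  have ch: "chart M (k i) (Q i) (X i)" if "i < n" for i using X(1)[OF that] by (rule chart.intro)
  let ?a = "\<lambda>i. chart.chart_area (k i) (Q i) (X i)"
  define m where "m A = (\<Sum>i<n. ?a i (A \<inter> P i))" for A
  define \<mu> where "\<mu> = measure_of M ?S m"
  have space: "space (restrict_space borel M) = M" by (simp add: space_restrict_space)
  have sets: "sets \<mu> = ?S"
    unfolding \<mu>_def using sets.sets_measure_of_eq[of "restrict_space borel M"] by (simp add: space)
  have em: "emeasure \<mu> A = m A" if "A \<in> ?S" for A
    unfolding \<mu>_def
  proof (rule emeasure_measure_of_sigma)
    show "sigma_algebra M ?S" using sets.sigma_algebra_axioms[of "restrict_space borel M"] by (simp add: space)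
    show "positive ?S m"
      by (auto simp: positive_def m_def chart.chart_area_def[OF ch])
    show "countably_additive ?S m"
      unfolding countably_additive_def
    proof (intro allI impI)
      fix A :: "nat \<Rightarrow> 'n ambient set"
      assume A: "range A \<subseteq> ?S" "disjoint_family A" "(\<Union>i. A i) \<in> ?S"
      have "(\<Sum>j. m (A j)) = (\<Sum>i<n. \<Sum>j. ?a i (A j \<inter> P i))"
        unfolding m_def by (rule suminf_sum) auto
      also have "\<dots> = (\<Sum>i<n. ?a i (\<Union>j. A j \<inter> P i))"
        using A P(1) by (intro sum.cong refl chart.chart_area_suminf[OF ch]) (auto simp: disjoint_family_on_def)
      also have "\<dots> = m (\<Union>j. A j)" by (simp add: m_def)
      finally show "(\<Sum>j. m (A j)) = m (\<Union>j. A j)" .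
    qed
  qed fact
  have "is_surface_measure M \<mu>"
    unfolding is_surface_measure_def sets
  proof (intro conjI refl allI impI, elim conjE)
    fix k' Q' X' A
    assume A: "local_parametrization M k' Q' X'" "A \<in> ?S" "A \<subseteq> X' ` (Q' \<inter> half_space k')"
    interpret c: chart M k' Q' X' by (rule chart.intro) fact
    have AM: "A \<subseteq> M" using A(2) by (auto simp: sets_restrict_space)
    have "emeasure \<mu> A = (\<Sum>i<n. ?a i (A \<inter> P i))" using em A(2) by (simp add: m_def)
    also have "\<dots> = (\<Sum>i<n. c.chart_area (A \<inter> P i))"
    proof (intro sum.cong refl)
      fix i assume "i \<in> {..<n}"
      then have i: "i < n" by simp
      show "?a i (A \<inter> P i) = c.chart_area (A \<inter> P i)"
        unfolding c.chart_area_def chart.chart_area_def[OF ch[OF i]]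
      proof (rule chart_area_consistent[OF A(1) X(1)[OF i]])
        show "A \<inter> P i \<in> ?S" using A(2) P(1)[OF i] by auto
        show "A \<inter> P i \<subseteq> X' ` c.D" using A(3) by blast
        show "A \<inter> P i \<subseteq> X i ` (Q i \<inter> half_space (k i))" using P(2)[OF i] X(2)[OF i] by blast
      qed
    qed
    also have "\<dots> = c.chart_area A"
      using P A(2) AM by (intro c.chart_area_sum[symmetric]) auto
    finally show "emeasure \<mu> A = (\<integral>\<^sup>+w\<in>{w \<in> Q' \<inter> half_space k'. X' w \<in> A}. ennreal (area_density X' w) \<partial>lborel)"
      by (simp only: c.chart_area_def)
  qed
  then show "\<exists>\<mu>. is_surface_measure M \<mu>" by blast
  fix \<mu> \<nu> assume \<mu>: "is_surface_measure M \<mu>" and \<nu>: "is_surface_measure M \<nu>"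
  show "\<mu> = \<nu>"
  proof (rule measure_eq_locally[OF assms(2)])
    show s: "sets \<mu> = ?S" "sets \<nu> = ?S" using \<mu> \<nu> by (simp_all add: is_surface_measure_def)
    fix p assume "p \<in> M"
    then obtain k Q X where lp: "local_parametrization M k Q X" "p \<in> X ` (Q \<inter> half_space k)"
      using assms(1) unfolding submanifold_def by meson
    have area: "emeasure \<kappa> A = chart.chart_area k Q X A"
      if "is_surface_measure M \<kappa>" "A \<in> ?S" "A \<subseteq> X ` (Q \<inter> half_space k)" for \<kappa> A
      using that lp(1) unfolding is_surface_measure_def chart.chart_area_def[OF chart.intro[OF lp(1)]] by blast
    have "emeasure \<mu> A = emeasure \<nu> A" if "A \<in> sets \<mu>" "A \<subseteq> X ` (Q \<inter> half_space k)" for A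
      using area[OF \<mu>] area[OF \<nu>] that by (simp add: s)
    then show "\<exists>U. openin (top_of_set M) U \<and> p \<in> U \<and> (\<forall>A\<in>sets \<mu>. A \<subseteq> U \<longrightarrow> emeasure \<mu> A = emeasure \<nu> A)"
      using lp(2) chart.openin_image[OF chart.intro[OF lp(1)]]
      by (intro exI[of _ "X ` (Q \<inter> half_space k)"] conjI) blast+
  qed
qed

lemma is_surface_measure_surface_measure:
  assumes "submanifold M" "compact M"
  shows "is_surface_measure M (surface_measure M)"
proof -
  have "surface_measure M = (THE \<mu>. is_surface_measure M \<mu>)"
    by (simp add: surface_measure_def is_surface_measure_def[abs_def])
  then show ?thesis using theI'[OF ex1_surface_measure[OF assms]] by simp
qed

locale compact_surface =
  fixes M :: "('n::finite) ambient set"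
  assumes submanifold: "submanifold M" and compact: "compact M"
begin

lemma sets_surface_measure [simp]: "sets (surface_measure M) = sets (restrict_space borel M)"
  using is_surface_measure_surface_measure[OF submanifold compact] by (simp add: is_surface_measure_def)

lemma space_surface_measure [simp]: "space (surface_measure M) = M"
  using sets_eq_imp_space_eq[OF sets_surface_measure] by (simp add: space_restrict_space)

lemma emeasure_surface_measure:
  assumes "local_parametrization M k Q X" "A \<in> sets (restrict_space borel M)" "A \<subseteq> X ` (Q \<inter> half_space k)"
  shows "emeasure (surface_measure M) A = chart.chart_area k Q X A"
  using is_surface_measure_surface_measure[OF submanifold compact] assms
  unfolding is_surface_measure_def chart.chart_area_def[OF chart.intro[OF assms(1)]] by simp

lemma finite_surface_measure: "finite_measure (surface_measure M)"
proof
  have cover: "\<exists>U. openin (top_of_set M) U \<and> p \<in> U \<and> emeasure (surface_measure M) U < \<infinity>" if p: "p \<in> M" for p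
  proof -
    obtain k Q X where X: "local_parametrization M k Q X" "p \<in> X ` (Q \<inter> half_space k)"
      "chart.chart_area k Q X (X ` (Q \<inter> half_space k)) < \<infinity>"
      by (rule chart_finite_area[OF submanifold p])
    then have ope: "openin (top_of_set M) (X ` (Q \<inter> half_space k))" by (simp add: local_parametrization_def)
    have "emeasure (surface_measure M) (X ` (Q \<inter> half_space k)) < \<infinity>"
      using emeasure_surface_measure[OF X(1) openin_sets_restrict_borel[OF ope]] X(3) by simp
    then show ?thesis using ope X(2) by blast
  qed
  obtain n :: nat and U P where *: "\<And>i. i < n \<Longrightarrow> emeasure (surface_measure M) (U i) < \<infinity>"
    "\<And>i. i < n \<Longrightarrow> U i \<in> sets (restrict_space borel M)"
    "\<And>i. i < n \<Longrightarrow> P i \<in> sets (restrict_space borel M)" "\<And>i. i < n \<Longrightarrow> P i \<subseteq> U i"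
    "disjoint_family_on P {..<n}" "M = (\<Union>i<n. P i)"
    by (rule compact_borel_partition[OF compact cover]) (assumption, rule that)
  have "emeasure (surface_measure M) M = emeasure (surface_measure M) (\<Union>i<n. P i)" using *(6) by simp
  also have "\<dots> = (\<Sum>i<n. emeasure (surface_measure M) (P i))"
    using *(3,5) by (intro sum_emeasure[symmetric]) auto
  also have "\<dots> < \<infinity>"
  proof -
    have "emeasure (surface_measure M) (P i) < \<infinity>" if "i < n" for i
      using emeasure_mono[OF *(4)[OF that], of "surface_measure M"] *(1,2) that
      by (simp add: order_le_less_trans)
    then show ?thesis by (simp add: less_top)
  qed
  finally show "emeasure (surface_measure M) (space (surface_measure M)) \<noteq> \<infinity>" by simp
qed

lemma continuous_on_measurable:
  fixes h :: "'n ambient \<Rightarrow> 'b::{second_countable_topology, metric_space}"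
  assumes "continuous_on M h"
  shows "h \<in> borel_measurable (surface_measure M)"
  using borel_measurable_continuous_on_restrict[OF assms] by (simp cong: measurable_cong_sets)

lemma nn_integral_chart:
  assumes "local_parametrization M k Q X" and A: "A \<in> sets (restrict_space borel M)" "A \<subseteq> X ` (Q \<inter> half_space k)"
    and h: "h \<in> borel_measurable (surface_measure M)"
  shows "(\<integral>\<^sup>+p\<in>A. h p \<partial>surface_measure M) =
    (\<integral>\<^sup>+w\<in>{w \<in> Q \<inter> half_space k. X w \<in> A}. h (X w) * ennreal (area_density X w) \<partial>lborel)"
proof -
  interpret c: chart M k Q X by (rule chart.intro) fact
  let ?S = "surface_measure M"
  let ?L = "restrict_space lborel c.D"
  have D: "c.D \<inter> space lborel \<in> sets lborel" using c.borel_D by simp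
  have X: "X \<in> ?L \<rightarrow>\<^sub>M ?S"
  proof -
    have "X \<in> restrict_space borel c.D \<rightarrow>\<^sub>M restrict_space borel M"
      using c.image_subset borel_measurable_continuous_on_restrict[OF continuous_on_subset[OF c.continuous_X Int_lower1]]
      by (auto simp: measurable_restrict_space2_iff space_restrict_space)
    then show ?thesis by (simp cong: measurable_cong_sets sets_restrict_space_cong)
  qed
  have area: "(\<lambda>w. area_density X w) \<in> borel_measurable ?L"
    using borel_measurable_continuous_on_restrict[OF continuous_on_subset[OF c.continuous_area_density Int_lower1]]
    by (simp cong: measurable_cong_sets sets_restrict_space_cong)
  have indA: "(indicator A :: _ \<Rightarrow> ennreal) \<in> borel_measurable ?S"
    by (rule borel_measurable_indicator) (simp add: A)
  let ?d = "\<lambda>w. ennreal (area_density X w) * indicator A (X w)"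
  have d: "?d \<in> borel_measurable ?L"
    using area measurable_compose[OF X indA] by measurable
  have "density ?S (indicator A) = distr (density ?L ?d) ?S X"
  proof (rule measure_eqI)
    fix B assume "B \<in> sets (density ?S (indicator A))"
    then have B: "B \<in> sets ?S" by simp
    have AB: "A \<inter> B \<in> sets (restrict_space borel M)" using A B by simp
    have "emeasure (density ?S (indicator A)) B = emeasure ?S (A \<inter> B)"
      using A B by (subst emeasure_density[OF indA B])
        (simp add: indicator_inter_arith[symmetric] nn_integral_indicator)
    also have "\<dots> = c.chart_area (A \<inter> B)"
      using emeasure_surface_measure[OF assms(1) AB] A by blast
    also have "\<dots> = (\<integral>\<^sup>+w. ?d w * indicator (X -` B \<inter> c.D) w * indicator c.D w \<partial>lborel)"
      unfolding c.chart_area_def by (intro nn_integral_cong) (auto simp: indicator_def)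
    also have "\<dots> = (\<integral>\<^sup>+w. ?d w * indicator (X -` B \<inter> c.D) w \<partial>?L)"
      by (subst nn_integral_restrict_space[OF D]) simp
    also have "\<dots> = emeasure (density ?L ?d) (X -` B \<inter> space ?L)"
      using measurable_sets[OF X B] by (subst emeasure_density[OF d]) (simp_all add: space_restrict_space)
    also have "\<dots> = emeasure (distr (density ?L ?d) ?S X) B"
      using X B by (subst emeasure_distr) auto
    finally show "emeasure (density ?S (indicator A)) B = emeasure (distr (density ?L ?d) ?S X) B" .
  qed simp
  moreover have "(\<integral>\<^sup>+p\<in>A. h p \<partial>?S) = (\<integral>\<^sup>+p. h p \<partial>density ?S (indicator A))"
    by (subst nn_integral_density[OF indA h]) (simp add: mult.commute)
  moreover have "(\<integral>\<^sup>+p. h p \<partial>distr (density ?L ?d) ?S X) = (\<integral>\<^sup>+w. ?d w * h (X w) \<partial>?L)"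
    using X h d measurable_compose[OF X h] by (simp add: nn_integral_distr nn_integral_density)
  moreover have "(\<integral>\<^sup>+w. ?d w * h (X w) \<partial>?L) =
      (\<integral>\<^sup>+w\<in>{w \<in> c.D. X w \<in> A}. h (X w) * ennreal (area_density X w) \<partial>lborel)"
    by (subst nn_integral_restrict_space[OF D]) (auto intro!: nn_integral_cong simp: indicator_def mult.commute)
  ultimately show ?thesis by simp
qed

end

section \<open>Embeddings and their Jacobians\<close>

lemma continuous_on_openin_cover:
  fixes h :: "'a::t2_space \<Rightarrow> 'b::topological_space"
  assumes "\<And>p. p \<in> M \<Longrightarrow> \<exists>U. openin (top_of_set M) U \<and> p \<in> U \<and> continuous_on U h"
  shows "continuous_on M h"
  unfolding continuous_on_eq_continuous_within
proof
  fix p assume "p \<in> M"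
  then obtain U where U: "openin (top_of_set M) U" "p \<in> U" "continuous_on U h" using assms by blast
  obtain V where V: "open V" "U = M \<inter> V" using U(1) by (auto simp: openin_open)
  have "at p within M = at p within U"
    by (rule at_within_nhd[of p V]) (use U(2) V in auto)
  then show "continuous (at p within M) h"
    using U(2,3) by (simp add: continuous_on_eq_continuous_within)
qed

lemma orthonormal_basis_at_iff:
  "orthonormal_basis_at M p e \<longleftrightarrow> orthonormal e \<and> range e \<subseteq> tangent_space M p"
  by (auto simp: orthonormal_basis_at_def orthonormal_def)

lemma submanifold_chart:
  assumes "submanifold M" "p \<in> M"
  obtains k Q X w where "local_parametrization M k Q X" "w \<in> Q \<inter> half_space k" "X w = p"
  using assms unfolding submanifold_def by (metis imageE)

lemma tangent_space_dim:
  fixes M :: "('n::finite) ambient set"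
  assumes "submanifold M" "p \<in> M"
  shows "subspace (tangent_space M p)" "dim (tangent_space M p) = CARD('n)"
proof -
  obtain k Q X w where X: "local_parametrization M k Q X" "w \<in> Q \<inter> half_space k" "X w = p"
    by (rule submanifold_chart[OF assms])
  interpret c: chart M k Q X by (rule chart.intro) fact
  have "tangent_space M p = range (c.dX w)" using tangent_space_chart[OF X(1,2)] X(3) by simp
  moreover have "linear (c.dX w)" "inj (c.dX w)" using c.linear_dX c.inj_dX X(2) by auto
  ultimately show "subspace (tangent_space M p)" "dim (tangent_space M p) = CARD('n)"
    using dim_range_inj by metis+
qed

lemma ex_orthonormal_basis_at:
  assumes "submanifold M" "p \<in> M"
  shows "\<exists>e. orthonormal_basis_at M p e"
  using ex_orthonormal[OF tangent_space_dim[OF assms]] unfolding orthonormal_basis_at_iff by metis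

lemma gram_linear_tangent:
  fixes M :: "('n::finite) ambient set" and L :: "'n ambient \<Rightarrow> 'b::euclidean_space"
    and b e :: "'n \<Rightarrow> 'n ambient"
  assumes "submanifold M" "p \<in> M" "orthonormal_basis_at M p e" "\<And>i. b i \<in> tangent_space M p" "linear L"
  shows "gram (\<lambda>i. L (b i)) = gram b * gram (\<lambda>i. L (e i))"
  by (rule gram_linear_image)
     (use assms orthonormal_span[of e "tangent_space M p"] tangent_space_dim[OF assms(1,2)]
       in \<open>auto simp: orthonormal_basis_at_iff\<close>)

text \<open>The factor by which \<open>\<Phi>\<close> stretches $n$-dimensional area at \<open>p\<close>. The chosen orthonormal basis
  does not matter, see \<open>jacobian_eq\<close>; in charts the factor is a quotient of area densities, see
  \<open>area_density_jacobian\<close>.\<close>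

definition jacobian ::
    "('n::finite) ambient set \<Rightarrow> ('n ambient \<Rightarrow> 'n ambient) \<Rightarrow> 'n ambient \<Rightarrow> real" where
  "jacobian M \<Phi> p = sqrt (gram (\<lambda>i. differential M \<Phi> p ((SOME e. orthonormal_basis_at M p e) i)))"

locale embedded_surface = compact_surface M for M :: "('n::finite) ambient set" +
  fixes \<Phi> :: "'n ambient \<Rightarrow> 'n ambient"
  assumes Emb: "\<Phi> \<in> Emb M"
begin

lemma smooth: "smooth_map_on M \<Phi>"
  and inj_differential: "p \<in> M \<Longrightarrow> inj_on (differential M \<Phi> p) (tangent_space M p)"
  using Emb by (auto simp: Emb_def)

lemma continuous: "continuous_on M \<Phi>"
  using smooth by (rule smooth_map_on_imp_continuous_on)

lemma inj: "inj_on \<Phi> M"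
  using Emb unfolding Emb_def homeomorphism_def by (auto intro: inj_on_inverseI)

lemma compact_image: "compact (\<Phi> ` M)"
  using compact_continuous_image[OF continuous compact] .

lemma has_derivative_extension:
  assumes "open U" "p \<in> U" "smooth_on U F" "\<And>x. x \<in> U \<inter> M \<Longrightarrow> F x = \<Phi> x" "p \<in> M"
  shows "(\<Phi> has_derivative frechet_derivative F (at p)) (at p within M)"
proof -
  obtain d where d: "d > 0" "ball p d \<subseteq> U" using assms(1,2) open_contains_ball by blast
  show ?thesis
  proof (rule has_derivative_transform_within[OF _ d(1) assms(5)])
    show "(F has_derivative frechet_derivative F (at p)) (at p within M)"
      using smooth_on_has_derivative[OF assms(3,2)] has_derivative_at_withinI by blast
    show "F x = \<Phi> x" if "x \<in> M" "dist x p < d" for x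
      using that d(2) assms(4) by (auto simp: subset_iff dist_commute)
  qed
qed

lemma has_derivative_differential:
  assumes "p \<in> M"
  shows "(\<Phi> has_derivative differential M \<Phi> p) (at p within M)"
proof -
  obtain U F where "open U" "p \<in> U" "smooth_on U F" "\<forall>x\<in>U \<inter> M. F x = \<Phi> x"
    using smooth assms unfolding smooth_map_on_def by meson
  then have "(\<Phi> has_derivative frechet_derivative F (at p)) (at p within M)"
    using has_derivative_extension assms by blast
  then show ?thesis using frechet_derivative_works differentiableI by blast
qed

lemma linear_differential: "p \<in> M \<Longrightarrow> linear (differential M \<Phi> p)"
  using has_derivative_differential has_derivative_linear by blast

text \<open>The chain rule along a chart, where \<open>Z\<close> may differ from \<open>\<Phi> \<circ> X\<close> outside the half space. Derivatives
  are unique on the half space, so this difference is invisible.\<close>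

lemma differential_chart:
  assumes "local_parametrization M k Q X" "w \<in> Q \<inter> half_space k"
    and "smooth_on Q Z" "\<And>z. z \<in> Q \<inter> half_space k \<Longrightarrow> Z z = \<Phi> (X z)"
  shows "frechet_derivative Z (at w) u = differential M \<Phi> (X w) (frechet_derivative X (at w) u)"
proof -
  interpret c: chart M k Q X by (rule chart.intro) fact
  have XM: "X ` c.D \<subseteq> M" by (rule c.image_subset)
  have "(X has_derivative c.dX w) (at w within c.D)"
    using c.has_derivative_X assms(2) has_derivative_at_withinI by blast
  moreover have "(\<Phi> has_derivative differential M \<Phi> (X w)) (at (X w) within X ` c.D)"
    using has_derivative_differential XM assms(2) by (blast intro: has_derivative_subset)
  ultimately have der: "((\<lambda>z. \<Phi> (X z)) has_derivative (\<lambda>u. differential M \<Phi> (X w) (c.dX w u))) (at w within c.D)"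
    by (rule has_derivative_in_compose)
  have "(Z has_derivative (\<lambda>u. differential M \<Phi> (X w) (c.dX w u))) (at w within c.D)"
    by (rule has_derivative_transform[OF assms(2,4) der])
  moreover have "(Z has_derivative frechet_derivative Z (at w)) (at w within c.D)"
    using smooth_on_has_derivative[OF assms(3)] assms(2) has_derivative_at_withinI by blast
  ultimately have "(\<lambda>u. differential M \<Phi> (X w) (c.dX w u)) = frechet_derivative Z (at w)"
    by (rule half_space_derivative_unique[OF c.open_Q assms(2)])
  then show ?thesis by metis
qed

text \<open>A smooth local extension of \<open>\<Phi>\<close> composed with a parametrization of \<open>M\<close> parametrizes the image. The
  parameter domain has to shrink to where the extension is defined.\<close>

lemma image_chart:
  assumes "local_parametrization M k Q X" "w \<in> Q \<inter> half_space k"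
  obtains Q' Z where "open Q'" "w \<in> Q'" "Q' \<subseteq> Q"
    "local_parametrization M k Q' X" "local_parametrization (\<Phi> ` M) k Q' Z"
    "\<And>z. z \<in> Q' \<inter> half_space k \<Longrightarrow> Z z = \<Phi> (X z)"
    "\<And>z u. z \<in> Q' \<inter> half_space k \<Longrightarrow>
       frechet_derivative Z (at z) u = differential M \<Phi> (X z) (frechet_derivative X (at z) u)"
proof -
  interpret c: chart M k Q X by (rule chart.intro) fact
  have "X w \<in> M" using c.image_subset assms(2) by blast
  then obtain U F where U: "open U" "X w \<in> U" "smooth_on U F" "\<And>x. x \<in> U \<inter> M \<Longrightarrow> F x = \<Phi> x"
    using smooth unfolding smooth_map_on_def by meson
  define Q' where "Q' = Q \<inter> X -` U"
  define Z where "Z = (\<lambda>z. F (X z))"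
  have Q': "open Q'" "w \<in> Q'" "Q' \<subseteq> Q"
    using c.continuous_X c.open_Q U(1,2) assms(2)
    by (auto simp: Q'_def continuous_on_open_vimage Int_commute)
  have lp': "local_parametrization M k Q' X" by (rule c.restrict[OF Q'(1,3)])
  interpret c': chart M k Q' X by (rule chart.intro) (rule lp')
  have Z: "Z z = \<Phi> (X z)" if "z \<in> c'.D" for z
    using that c'.image_subset U(4) by (auto simp: Z_def Q'_def)
  have smoothZ: "smooth_on Q' Z"
    unfolding Z_def by (rule smooth_on_compose[OF Q'(1) U(1) _ c'.smooth U(3)]) (simp add: Q'_def)
  have dZ: "frechet_derivative Z (at z) u = differential M \<Phi> (X z) (c.dX z u)" if "z \<in> c'.D" for z u
    by (rule differential_chart[OF lp' that smoothZ Z])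
  have im: "Z ` c'.D = \<Phi> ` X ` c'.D" using Z by force
  obtain \<psi> where \<psi>: "homeomorphism M (\<Phi> ` M) \<Phi> \<psi>" using Emb by (auto simp: Emb_def)
  have "local_parametrization (\<Phi> ` M) k Q' Z"
    unfolding local_parametrization_def
  proof (intro conjI Q'(1) smoothZ ballI)
    show "openin (top_of_set (\<Phi> ` M)) (Z ` c'.D)"
      unfolding im by (rule homeomorphism_imp_open_map[OF \<psi> c'.openin_image])
    obtain Y where Y: "homeomorphism c'.D (X ` c'.D) X Y"
      using lp' by (auto simp: local_parametrization_def)
    have "homeomorphism (X ` c'.D) (Z ` c'.D) \<Phi> \<psi>"
      by (rule homeomorphism_of_subsets[OF \<psi> c'.image_subset order.refl]) (simp add: im)
    then have "homeomorphism c'.D (Z ` c'.D) (\<Phi> \<circ> X) (Y \<circ> \<psi>)"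
      by (rule homeomorphism_compose[OF Y])
    then have "homeomorphism c'.D (Z ` c'.D) Z (Y \<circ> \<psi>)"
      by (rule homeomorphism_cong) (auto simp: Z)
    then show "\<exists>Y. homeomorphism c'.D (Z ` c'.D) Z Y" by blast
    fix z assume z: "z \<in> c'.D"
    have "inj_on (differential M \<Phi> (X z)) (range (c.dX z))"
      using inj_differential[of "X z"] tangent_space_chart[OF lp' z] c'.image_subset z by auto
    then have "inj (differential M \<Phi> (X z) \<circ> c.dX z)"
      using c'.inj_dX[OF z] by (intro comp_inj_on)
    moreover have "frechet_derivative Z (at z) = differential M \<Phi> (X z) \<circ> c.dX z"
      using dZ[OF z] by (simp add: fun_eq_iff)
    ultimately show "inj (frechet_derivative Z (at z))" by simp
  qed
  from that[OF Q' lp' this Z dZ] show ?thesis by blast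
qed

lemma submanifold_image: "submanifold (\<Phi> ` M)"
  unfolding submanifold_def
proof
  fix q assume "q \<in> \<Phi> ` M"
  then obtain p where p: "p \<in> M" "q = \<Phi> p" by blast
  obtain k Q X w where X: "local_parametrization M k Q X" "w \<in> Q \<inter> half_space k" "X w = p"
    by (rule submanifold_chart[OF submanifold p(1)])
  obtain Q' Z where "w \<in> Q'" "local_parametrization (\<Phi> ` M) k Q' Z"
      "\<And>z. z \<in> Q' \<inter> half_space k \<Longrightarrow> Z z = \<Phi> (X z)"
    using image_chart[OF X(1,2)] by metis
  moreover from this have "q \<in> Z ` (Q' \<inter> half_space k)"
    using X(2,3) p(2) by (intro image_eqI[of _ _ w]) auto
  ultimately show "\<exists>k Q X. local_parametrization (\<Phi> ` M) k Q X \<and> q \<in> X ` (Q \<inter> half_space k)" by blast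
qed

sublocale image: compact_surface "\<Phi> ` M"
  by unfold_locales (rule submanifold_image compact_image)+

lemma boundary_image:
  assumes "p \<in> mfd_boundary M"
  shows "\<Phi> p \<in> mfd_boundary (\<Phi> ` M)"
proof -
  obtain k Q X w where X: "local_parametrization M k Q X" "w \<in> Q" "w $ k = 0" "X w = p"
    using assms unfolding mfd_boundary_def by blast
  then have w: "w \<in> Q \<inter> half_space k" by (simp add: half_space_def)
  obtain Q' Z where "w \<in> Q'" "local_parametrization (\<Phi> ` M) k Q' Z"
      "\<And>z. z \<in> Q' \<inter> half_space k \<Longrightarrow> Z z = \<Phi> (X z)"
    using image_chart[OF X(1) w] by metis
  then show ?thesis using w X unfolding mfd_boundary_def by blast
qed

lemma area_density_image_chart:
  assumes "local_parametrization M k Q X" "w \<in> Q \<inter> half_space k" "orthonormal_basis_at M (X w) e"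
    and "\<And>u. frechet_derivative Z (at w) u = differential M \<Phi> (X w) (frechet_derivative X (at w) u)"
  shows "area_density Z w = area_density X w * sqrt (gram (\<lambda>i. differential M \<Phi> (X w) (e i)))"
proof -
  interpret c: chart M k Q X by (rule chart.intro) fact
  have "X w \<in> M" using c.image_subset assms(2) by blast
  then show ?thesis
    unfolding area_density_gram assms(4)
    by (subst gram_linear_tangent[OF submanifold _ assms(3)])
       (auto simp: real_sqrt_mult tangent_space_chart[OF assms(1,2)] linear_differential)
qed

text \<open>For any orthonormal basis the factor is the quotient of the area densities of two fixed
  parametrizations, which does not mention the basis.\<close>

lemma jacobian_eq:
  assumes "p \<in> M" "orthonormal_basis_at M p e"
  shows "jacobian M \<Phi> p = sqrt (gram (\<lambda>i. differential M \<Phi> p (e i)))"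
proof -
  obtain k Q X w where X: "local_parametrization M k Q X" "w \<in> Q \<inter> half_space k" "X w = p"
    by (rule submanifold_chart[OF submanifold assms(1)])
  obtain Q' Z where Z: "w \<in> Q'" "local_parametrization M k Q' X"
      "\<And>z u. z \<in> Q' \<inter> half_space k \<Longrightarrow>
       frechet_derivative Z (at z) u = differential M \<Phi> (X z) (frechet_derivative X (at z) u)"
    using image_chart[OF X(1,2)] by metis
  interpret c: chart M k Q' X by (rule chart.intro) (rule Z(2))
  have w: "w \<in> c.D" using X(2) Z(1) by auto
  let ?e = "SOME e. orthonormal_basis_at M p e"
  have "orthonormal_basis_at M p ?e"
    using ex_orthonormal_basis_at[OF submanifold assms(1)] by (rule someI_ex)
  then have "area_density X w * sqrt (gram (\<lambda>i. differential M \<Phi> p (?e i))) = area_density Z w"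
    using area_density_image_chart[OF Z(2) w _ Z(3)[OF w]] X(3) by simp
  also have "\<dots> = area_density X w * sqrt (gram (\<lambda>i. differential M \<Phi> p (e i)))"
    using area_density_image_chart[OF Z(2) w _ Z(3)[OF w]] X(3) assms(2) by simp
  finally show ?thesis
    using c.area_density_pos[OF w] by (simp add: jacobian_def)
qed

lemma area_density_jacobian:
  assumes "local_parametrization M k Q X" "w \<in> Q \<inter> half_space k"
    and "\<And>u. frechet_derivative Z (at w) u = differential M \<Phi> (X w) (frechet_derivative X (at w) u)"
  shows "area_density Z w = jacobian M \<Phi> (X w) * area_density X w"
proof -
  have p: "X w \<in> M" using chart.image_subset[OF chart.intro[OF assms(1)]] assms(2) by blast
  obtain e where e: "orthonormal_basis_at M (X w) e" using ex_orthonormal_basis_at[OF submanifold p] by blast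
  show ?thesis
    using area_density_image_chart[OF assms(1,2) e assms(3)] jacobian_eq[OF p e] by simp
qed

text \<open>Both properties are clear from the expression as a quotient of area densities in a chart, whereas
  the bases in the definition are chosen independently at each point.\<close>

lemma
  shows jacobian_pos: "\<And>p. p \<in> M \<Longrightarrow> jacobian M \<Phi> p > 0"
    and continuous_jacobian: "continuous_on M (jacobian M \<Phi>)"
proof -
  have *: "\<exists>U. openin (top_of_set M) U \<and> p \<in> U \<and> continuous_on U (jacobian M \<Phi>) \<and> jacobian M \<Phi> p > 0"
    if p: "p \<in> M" for p
  proof -
    obtain k Q X w where X: "local_parametrization M k Q X" "w \<in> Q \<inter> half_space k" "X w = p"
      by (rule submanifold_chart[OF submanifold p])
    obtain Q' Z where Z: "w \<in> Q'" "local_parametrization M k Q' X"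
        "local_parametrization (\<Phi> ` M) k Q' Z" "\<And>z. z \<in> Q' \<inter> half_space k \<Longrightarrow> Z z = \<Phi> (X z)"
        "\<And>z u. z \<in> Q' \<inter> half_space k \<Longrightarrow>
         frechet_derivative Z (at z) u = differential M \<Phi> (X z) (frechet_derivative X (at z) u)"
      using image_chart[OF X(1,2)] by metis
    interpret c: chart M k Q' X by (rule chart.intro) (rule Z(2))
    interpret cZ: chart "\<Phi> ` M" k Q' Z by (rule chart.intro) (rule Z(3))
    have w: "w \<in> c.D" using X(2) Z(1) by auto
    let ?Y = "inv_into c.D X"
    have J: "jacobian M \<Phi> (X z) = area_density Z z / area_density X z" if "z \<in> c.D" for z
      using area_density_jacobian[OF Z(2) that Z(5)[OF that]] c.area_density_pos[OF that] by simp
    have YD: "?Y ` (X ` c.D) \<subseteq> c.D" by (auto simp: c.inverse_X)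
    have "continuous_on (X ` c.D) (\<lambda>q. area_density Z (?Y q) / area_density X (?Y q))"
    proof (intro continuous_on_divide)
      show "continuous_on (X ` c.D) (\<lambda>q. area_density Z (?Y q))"
        by (rule continuous_on_compose2[OF cZ.continuous_area_density c.continuous_inverse]) (use YD in blast)
      show "continuous_on (X ` c.D) (\<lambda>q. area_density X (?Y q))"
        by (rule continuous_on_compose2[OF c.continuous_area_density c.continuous_inverse]) (use YD in blast)
      show "\<forall>q\<in>X ` c.D. area_density X (?Y q) \<noteq> 0"
        using YD c.area_density_pos by (metis image_subset_iff less_irrefl)
    qed
    then have "continuous_on (X ` c.D) (jacobian M \<Phi>)"
      by (rule continuous_on_eq) (auto simp: J c.inverse_X)
    moreover have "jacobian M \<Phi> p > 0"
      using J[OF w] X(3) c.area_density_pos[OF w] cZ.area_density_pos[OF w] by simp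
    ultimately show ?thesis
      using c.openin_image w X(3) by (intro exI[of _ "X ` c.D"]) auto
  qed
  show "\<And>p. p \<in> M \<Longrightarrow> jacobian M \<Phi> p > 0" using * by blast
  show "continuous_on M (jacobian M \<Phi>)" by (rule continuous_on_openin_cover) (use * in blast)
qed

lemma measurable_embedding: "\<Phi> \<in> surface_measure M \<rightarrow>\<^sub>M surface_measure (\<Phi> ` M)"
proof -
  have "\<Phi> \<in> restrict_space borel M \<rightarrow>\<^sub>M restrict_space borel (\<Phi> ` M)"
    using borel_measurable_continuous_on_restrict[OF continuous]
    by (auto simp: measurable_restrict_space2_iff space_restrict_space)
  then show ?thesis by (simp cong: measurable_cong_sets)
qed

lemma measurable_jacobian: "jacobian M \<Phi> \<in> borel_measurable (surface_measure M)"
  by (rule continuous_on_measurable[OF continuous_jacobian])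

text \<open>The area formula. Both measures are given in a chart by the same integral: the area density of the
  image chart is the Jacobian times the area density of the chart of \<open>M\<close>.\<close>

theorem surface_measure_image:
  "surface_measure (\<Phi> ` M) =
     distr (density (surface_measure M) (\<lambda>p. ennreal (jacobian M \<Phi> p))) (surface_measure (\<Phi> ` M)) \<Phi>"
  (is "_ = ?\<nu>")
proof (rule measure_eq_locally[OF compact_image])
  show "sets (surface_measure (\<Phi> ` M)) = sets (restrict_space borel (\<Phi> ` M))"
    "sets ?\<nu> = sets (restrict_space borel (\<Phi> ` M))" by simp_all
  fix q assume "q \<in> \<Phi> ` M"
  then obtain p where p: "p \<in> M" "q = \<Phi> p" by blast
  obtain k Q X w where X: "local_parametrization M k Q X" "w \<in> Q \<inter> half_space k" "X w = p"
    by (rule submanifold_chart[OF submanifold p(1)])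
  obtain Q' Z where Z: "w \<in> Q'" "local_parametrization M k Q' X"
      "local_parametrization (\<Phi> ` M) k Q' Z" "\<And>z. z \<in> Q' \<inter> half_space k \<Longrightarrow> Z z = \<Phi> (X z)"
      "\<And>z u. z \<in> Q' \<inter> half_space k \<Longrightarrow>
       frechet_derivative Z (at z) u = differential M \<Phi> (X z) (frechet_derivative X (at z) u)"
    using image_chart[OF X(1,2)] by metis
  interpret c: chart M k Q' X by (rule chart.intro) (rule Z(2))
  interpret cZ: chart "\<Phi> ` M" k Q' Z by (rule chart.intro) (rule Z(3))
  have "emeasure (surface_measure (\<Phi> ` M)) A = emeasure ?\<nu> A"
    if A: "A \<in> sets (surface_measure (\<Phi> ` M))" "A \<subseteq> Z ` c.D" for A
  proof -
    let ?A = "\<Phi> -` A \<inter> M"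
    have meas: "?A \<in> sets (surface_measure M)"
      using measurable_sets[OF measurable_embedding A(1)] by simp
    have sub: "?A \<subseteq> X ` c.D"
    proof
      fix x assume x: "x \<in> ?A"
      then obtain z where z: "z \<in> c.D" "\<Phi> x = \<Phi> (X z)" using A(2) Z(4) by auto
      then have "x = X z" using inj x c.image_subset by (meson IntD2 image_subset_iff inj_onD)
      then show "x \<in> X ` c.D" using z(1) by blast
    qed
    have J: "ennreal (jacobian M \<Phi> (X z)) * ennreal (area_density X z) = ennreal (area_density Z z)"
      if "z \<in> c.D" for z
    proof -
      have "X z \<in> M" using that c.image_subset by blast
      then show ?thesis
        using area_density_jacobian[OF Z(2) that Z(5)[OF that]] jacobian_pos[of "X z"] c.area_density_pos[OF that]
        by (simp add: ennreal_mult)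
    qed
    have "emeasure ?\<nu> A = emeasure (density (surface_measure M) (\<lambda>p. ennreal (jacobian M \<Phi> p))) ?A"
      using measurable_embedding A(1) by (subst emeasure_distr) auto
    also have "\<dots> = (\<integral>\<^sup>+p\<in>?A. ennreal (jacobian M \<Phi> p) \<partial>surface_measure M)"
      using measurable_jacobian meas by (subst emeasure_density) auto
    also have "\<dots> = (\<integral>\<^sup>+w\<in>{w \<in> c.D. X w \<in> ?A}. ennreal (jacobian M \<Phi> (X w)) * ennreal (area_density X w) \<partial>lborel)"
      using nn_integral_chart[OF Z(2) _ sub, of "\<lambda>p. ennreal (jacobian M \<Phi> p)"] measurable_jacobian meas by simp
    also have "\<dots> = (\<integral>\<^sup>+w\<in>{w \<in> c.D. Z w \<in> A}. ennreal (area_density Z w) \<partial>lborel)"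
    proof (rule nn_integral_cong)
      fix z
      show "ennreal (jacobian M \<Phi> (X z)) * ennreal (area_density X z) * indicator {w \<in> c.D. X w \<in> ?A} z =
          ennreal (area_density Z z) * indicator {w \<in> c.D. Z w \<in> A} z"
      proof (cases "z \<in> c.D")
        case True
        then have "X z \<in> M" using c.image_subset by blast
        then have "X z \<in> ?A \<longleftrightarrow> Z z \<in> A" using Z(4)[OF True] by simp
        then show ?thesis using True J[OF True] by (simp add: indicator_def)
      next
        case False
        then have "indicator {w \<in> c.D. X w \<in> ?A} z = (0::ennreal)"
          "indicator {w \<in> c.D. Z w \<in> A} z = (0::ennreal)"
          by (intro indicator_simps; blast)+
        then show ?thesis by (simp only: mult_zero_right)
      qed
    qed
    also have "\<dots> = emeasure (surface_measure (\<Phi> ` M)) A"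
      using image.emeasure_surface_measure[OF Z(3)] A by (simp add: cZ.chart_area_def)
    finally show ?thesis by simp
  qed
  moreover have "q \<in> Z ` c.D" using X(2,3) Z(1,4) p(2) by (intro image_eqI[of _ _ w]) auto
  ultimately show "\<exists>U. openin (top_of_set (\<Phi> ` M)) U \<and> q \<in> U \<and>
      (\<forall>A\<in>sets (surface_measure (\<Phi> ` M)). A \<subseteq> U \<longrightarrow> emeasure (surface_measure (\<Phi> ` M)) A = emeasure ?\<nu> A)"
    using cZ.openin_image by blast
qed

lemma
  fixes F :: "'n ambient \<Rightarrow> real"
  assumes "F \<in> borel_measurable (surface_measure (\<Phi> ` M))"
  shows integral_surface_image:
      "(\<integral>s. F s \<partial>surface_measure (\<Phi> ` M)) = (\<integral>p. jacobian M \<Phi> p * F (\<Phi> p) \<partial>surface_measure M)" (is ?I)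
    and integrable_surface_image:
      "integrable (surface_measure (\<Phi> ` M)) F \<longleftrightarrow>
         integrable (surface_measure M) (\<lambda>p. jacobian M \<Phi> p * F (\<Phi> p))" (is ?int)
proof -
  let ?d = "density (surface_measure M) (\<lambda>p. ennreal (jacobian M \<Phi> p))"
  have \<Phi>: "\<Phi> \<in> ?d \<rightarrow>\<^sub>M surface_measure (\<Phi> ` M)" using measurable_embedding by simp
  have F: "(\<lambda>p. F (\<Phi> p)) \<in> borel_measurable (surface_measure M)"
    using measurable_compose[OF measurable_embedding assms] .
  have nn: "AE p in surface_measure M. 0 \<le> jacobian M \<Phi> p"
    using jacobian_pos by (intro AE_I2) (simp add: less_imp_le)
  have "(\<integral>s. F s \<partial>surface_measure (\<Phi> ` M)) = (\<integral>s. F s \<partial>distr ?d (surface_measure (\<Phi> ` M)) \<Phi>)"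
    using surface_measure_image by simp
  also have "\<dots> = (\<integral>p. F (\<Phi> p) \<partial>?d)" by (rule integral_distr[OF \<Phi> assms])
  also have "\<dots> = (\<integral>p. jacobian M \<Phi> p * F (\<Phi> p) \<partial>surface_measure M)"
    using integral_density[OF F measurable_jacobian nn] by simp
  finally show ?I .
  have "integrable (surface_measure (\<Phi> ` M)) F \<longleftrightarrow> integrable (distr ?d (surface_measure (\<Phi> ` M)) \<Phi>) F"
    using surface_measure_image by simp
  also have "\<dots> \<longleftrightarrow> integrable ?d (\<lambda>p. F (\<Phi> p))" by (rule integrable_distr_eq[OF \<Phi> assms])
  also have "\<dots> \<longleftrightarrow> integrable (surface_measure M) (\<lambda>p. jacobian M \<Phi> p * F (\<Phi> p))"
    using integrable_density[OF F measurable_jacobian nn] by simp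
  finally show ?int .
qed

end

section \<open>Covariant derivatives and perturbed embeddings\<close>

text \<open>The ambiguity of derivatives within \<open>M\<close> concerns directions transversal to \<open>M\<close> only: after composition
  with a chart they are derivatives on a piece of the half space, where they are unique.\<close>

lemma differential_unique:
  fixes h :: "('n::finite) ambient \<Rightarrow> 'n ambient"
  assumes "(h has_derivative L) (at p within M)" "v \<in> tangent_space M p"
  shows "differential M h p v = L v"
proof -
  obtain k Q X w u where X: "local_parametrization M k Q X" "w \<in> Q \<inter> half_space k" "X w = p"
      and v: "v = frechet_derivative X (at w) u"
    using assms(2) unfolding tangent_space_def by blast
  interpret c: chart M k Q X by (rule chart.intro) fact
  have "(X has_derivative c.dX w) (at w within c.D)"
    using c.has_derivative_X X(2) has_derivative_at_withinI by blast
  moreover have "(h has_derivative L') (at (X w) within X ` c.D)"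
    if "(h has_derivative L') (at p within M)" for L'
    using that has_derivative_subset[OF _ c.image_subset] X(3) by blast
  ultimately have "((\<lambda>z. h (X z)) has_derivative (\<lambda>u. L' (c.dX w u))) (at w within c.D)"
    if "(h has_derivative L') (at p within M)" for L'
    using that has_derivative_in_compose by blast
  moreover have "(h has_derivative differential M h p) (at p within M)"
    using assms(1) frechet_derivative_works differentiableI by blast
  ultimately have "(\<lambda>u. differential M h p (c.dX w u)) = (\<lambda>u. L (c.dX w u))"
    using half_space_derivative_unique[OF c.open_Q X(2)] assms(1) by blast
  then show ?thesis using v by metis
qed

lemma smooth_bounds_on_compact:
  fixes V :: "'a::euclidean_space \<Rightarrow> 'b::euclidean_space"
  assumes "smooth_on UNIV V" "compact N"
  obtains B where "B \<ge> 0"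
    "\<And>x v. x \<in> N \<Longrightarrow> norm (frechet_derivative V (at x) v) \<le> B * norm v"
    "\<And>x y. x \<in> N \<Longrightarrow> y \<in> N \<Longrightarrow> norm (V x - V y) \<le> B * norm (x - y)"
proof -
  obtain R where R: "N \<subseteq> cball 0 R"
    using compact_imp_bounded[OF assms(2)] by (auto simp: bounded_iff subset_iff)
  have der: "(V has_derivative frechet_derivative V (at x)) (at x)" for x
    using smooth_on_has_derivative[OF assms(1)] by blast
  have "continuous_on (cball 0 R) (\<lambda>x. \<Sum>b\<in>Basis. norm (frechet_derivative V (at x) b))"
    by (intro continuous_intros continuous_on_subset[OF smooth_on_continuous_derivative[OF assms(1)]]) auto
  then have "bounded ((\<lambda>x. \<Sum>b\<in>Basis. norm (frechet_derivative V (at x) b)) ` cball 0 R)"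
    by (intro compact_imp_bounded compact_continuous_image) auto
  then obtain B where B: "\<And>x. x \<in> cball 0 R \<Longrightarrow> norm (\<Sum>b\<in>Basis. norm (frechet_derivative V (at x) b)) \<le> B"
    unfolding bounded_iff by blast
  have bnd: "norm (frechet_derivative V (at x) v) \<le> \<bar>B\<bar> * norm v" if "x \<in> cball 0 R" for x v
  proof -
    interpret L: bounded_linear "frechet_derivative V (at x)" using der by (rule has_derivative_bounded_linear)
    have "norm (frechet_derivative V (at x) v)
        = norm (\<Sum>b\<in>Basis. (v \<bullet> b) *\<^sub>R frechet_derivative V (at x) b)"
      by (subst euclidean_representation[symmetric, of v]) (simp only: L.sum L.scaleR)
    also have "\<dots> \<le> (\<Sum>b\<in>Basis. norm v * norm (frechet_derivative V (at x) b))"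
      by (intro sum_norm_le) (auto intro!: mult_right_mono Basis_le_norm)
    also have "\<dots> = norm v * (\<Sum>b\<in>Basis. norm (frechet_derivative V (at x) b))"
      by (simp add: sum_distrib_left)
    also have "\<dots> \<le> norm v * \<bar>B\<bar>"
      using B[OF that] by (intro mult_left_mono) auto
    finally show ?thesis by (simp add: mult.commute)
  qed
  show ?thesis
  proof (rule that[of "\<bar>B\<bar>"])
    show "norm (frechet_derivative V (at x) v) \<le> \<bar>B\<bar> * norm v" if "x \<in> N" for x v
      using bnd R that by blast
    show "norm (V x - V y) \<le> \<bar>B\<bar> * norm (x - y)" if "x \<in> N" "y \<in> N" for x y
    proof (rule differentiable_bound[of "cball 0 R" V "\<lambda>x. frechet_derivative V (at x)"])
      show "(V has_derivative frechet_derivative V (at x)) (at x within cball 0 R)" for x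
        using der has_derivative_at_withinI by blast
      show "onorm (frechet_derivative V (at x)) \<le> \<bar>B\<bar>" if "x \<in> cball 0 R" for x
        using bnd[OF that] by (intro onorm_bound) auto
    qed (use R that in auto)
  qed auto
qed

context embedded_surface
begin

lemma differential_tangent:
  assumes "p \<in> M" "v \<in> tangent_space M p"
  shows "differential M \<Phi> p v \<in> tangent_space (\<Phi> ` M) (\<Phi> p)"
proof -
  obtain k Q X w u where X: "local_parametrization M k Q X" "w \<in> Q \<inter> half_space k" "X w = p"
      and v: "v = frechet_derivative X (at w) u"
    using assms(2) unfolding tangent_space_def by blast
  obtain Q' Z where Z: "w \<in> Q'" "local_parametrization (\<Phi> ` M) k Q' Z"
      "\<And>z. z \<in> Q' \<inter> half_space k \<Longrightarrow> Z z = \<Phi> (X z)"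
      "\<And>z u. z \<in> Q' \<inter> half_space k \<Longrightarrow>
       frechet_derivative Z (at z) u = differential M \<Phi> (X z) (frechet_derivative X (at z) u)"
    using image_chart[OF X(1,2)] by metis
  have w: "w \<in> Q' \<inter> half_space k" using X(2) Z(1) by auto
  have "tangent_space (\<Phi> ` M) (\<Phi> p) = range (frechet_derivative Z (at w))"
    using tangent_space_chart[OF Z(2) w] Z(3)[OF w] X(3) by simp
  moreover have "differential M \<Phi> p v = frechet_derivative Z (at w) u"
    using Z(4)[OF w] X(3) v by simp
  ultimately show ?thesis by blast
qed

text \<open>The frames drop out. Orthonormality makes the determinant equal to the Jacobian up to sign, and the
  sign is positive since the frames on the image belong to the transported orientation. Everything
  that depends on \<open>\<tau>\<close> and \<open>\<sigma>\<close> depends on them only through this determinant.\<close>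

lemma det_cov_deriv:
  assumes "orientation_on M ori" "frame_choice M ori \<tau>"
    and "frame_choice (\<Phi> ` M) (transported_orientation M \<Phi> ori) \<sigma>" "p \<in> M"
  shows "det (cov_deriv M \<tau> \<sigma> \<Phi> p) = jacobian M \<Phi> p"
proof -
  let ?L = "differential M \<Phi> p"
  have \<tau>: "orthonormal_basis_at M p (\<tau> p p)" "\<tau> p p \<in> ori p"
    using assms(2,4) unfolding frame_choice_def oriented_orthonormal_frame_def by blast+
  have \<sigma>: "orthonormal_basis_at (\<Phi> ` M) (\<Phi> p) (\<sigma> (\<Phi> p) (\<Phi> p))"
    "\<sigma> (\<Phi> p) (\<Phi> p) \<in> transported_orientation M \<Phi> ori (\<Phi> p)"
    using assms(3,4) unfolding frame_choice_def oriented_orthonormal_frame_def by blast+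
  obtain c where c: "c \<in> ori p" "\<sigma> (\<Phi> p) (\<Phi> p) = (\<lambda>i. ?L (c i))"
    using \<sigma>(2) by (auto simp: transported_orientation_def Let_def inv_into_f_f[OF inj assms(4)])
  obtain b where b: "ori p = {c. same_orientation b c}"
    using assms(1,4) unfolding orientation_on_def by blast
  obtain A B :: "real^'n^'n" where AB: "0 < det A" "\<And>j. \<tau> p p j = (\<Sum>i\<in>UNIV. A $ i $ j *\<^sub>R b i)"
      "0 < det B" "\<And>j. c j = (\<Sum>i\<in>UNIV. B $ i $ j *\<^sub>R b i)"
    using \<tau>(2) c(1) unfolding b same_orientation_def by blast
  have "orthonormal (\<lambda>i. ?L (c i))" using \<sigma>(1) c(2) by (simp add: orthonormal_basis_at_iff)
  then have "det (\<chi> i j. ?L (\<tau> p p j) \<bullet> ?L (c i)) = sqrt (gram (\<lambda>i. ?L (\<tau> p p i)))"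
    by (rule det_same_orientation[OF linear_differential[OF assms(4)] AB(1,3,2,4)])
  then show ?thesis
    using jacobian_eq[OF assms(4) \<tau>(1)] by (simp add: cov_deriv_def c(2))
qed

lemma continuous_inverse: "continuous_on (\<Phi> ` M) (inv_into M \<Phi>)"
  by (rule continuous_on_inv[OF continuous compact]) (simp add: inv_into_f_f[OF inj])

lemma measurable_inverse: "inv_into M \<Phi> \<in> surface_measure (\<Phi> ` M) \<rightarrow>\<^sub>M surface_measure M"
proof -
  have "inv_into M \<Phi> \<in> restrict_space borel (\<Phi> ` M) \<rightarrow>\<^sub>M restrict_space borel M"
    using borel_measurable_continuous_on_restrict[OF continuous_inverse]
    by (auto simp: measurable_restrict_space2_iff space_restrict_space inv_into_f_f[OF inj])
  then show ?thesis by (simp cong: measurable_cong_sets)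
qed

end

locale perturbed_surface = embedded_surface M \<Phi> for M :: "('n::finite) ambient set" and \<Phi> +
  fixes V :: "'n ambient \<Rightarrow> 'n ambient"
  assumes Emb_bd: "\<Phi> \<in> Emb_bd M" and direction: "V \<in> directions M \<Phi>"
begin

lemma smooth_V: "smooth_on UNIV V"
  using direction by (simp add: directions_def)

abbreviation "dV x \<equiv> frechet_derivative V (at x)"

lemma linear_dV: "linear (dV x)"
  using smooth_on_linear_derivative[OF smooth_V] by simp

lemma has_derivative_V: "(V has_derivative dV x) (at x)"
  using smooth_on_has_derivative[OF smooth_V] by simp

abbreviation "\<Phi>t \<equiv> perturb M \<Phi> V"

lemma perturb_apply: "p \<in> M \<Longrightarrow> \<Phi>t t p = \<Phi> p + t *\<^sub>R V (\<Phi> p)"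
  by (simp add: perturb_def)

lemma perturb_0: "\<Phi>t 0 = \<Phi>"
proof -
  have "\<Phi> \<in> extensional M" using Emb by (simp add: Emb_def)
  then show ?thesis by (auto simp: perturb_def fun_eq_iff extensional_def)
qed

lemma has_derivative_perturb:
  assumes "p \<in> M"
  shows "(\<Phi>t t has_derivative (\<lambda>v. differential M \<Phi> p v + t *\<^sub>R dV (\<Phi> p) (differential M \<Phi> p v))) (at p within M)"
proof -
  note d = has_derivative_differential[OF assms]
  have "((\<lambda>q. V (\<Phi> q)) has_derivative (\<lambda>v. dV (\<Phi> p) (differential M \<Phi> p v))) (at p within M)"
    by (rule has_derivative_compose[OF d has_derivative_V])
  then have der: "((\<lambda>q. \<Phi> q + t *\<^sub>R V (\<Phi> q)) has_derivative
      (\<lambda>v. differential M \<Phi> p v + t *\<^sub>R dV (\<Phi> p) (differential M \<Phi> p v))) (at p within M)"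
    by (intro has_derivative_add has_derivative_scaleR_right d)
  show ?thesis
    by (rule has_derivative_transform[OF assms perturb_apply der])
qed

lemma differential_perturb:
  "p \<in> M \<Longrightarrow> v \<in> tangent_space M p \<Longrightarrow>
    differential M (\<Phi>t t) p v = differential M \<Phi> p v + t *\<^sub>R dV (\<Phi> p) (differential M \<Phi> p v)"
  by (rule differential_unique[OF has_derivative_perturb])

lemma boundary_subset: "mfd_boundary M \<subseteq> M"
proof
  fix p assume "p \<in> mfd_boundary M"
  then obtain k Q X w where X: "local_parametrization M k Q X" "w \<in> Q" "w $ k = 0" "X w = p"
    unfolding mfd_boundary_def by blast
  then have "w \<in> Q \<inter> half_space k" by (simp add: half_space_def)
  then show "p \<in> M" using chart.image_subset[OF chart.intro[OF X(1)]] X(4) by blast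
qed

text \<open>The perturbed map is \<open>\<Phi>\<close> followed by \<open>x \<mapsto> x + t V x\<close>. On the compact image \<open>V\<close> is Lipschitz with
  some constant \<open>B\<close>; for \<open>t B < 1\<close> the perturbation cannot cancel a nonzero difference of points or
  tangent vectors, so injectivity and immersivity persist. On a compact surface a continuous
  injection is a homeomorphism onto its image, and boundary points stay fixed because \<open>\<Phi>\<close> maps them
  into the boundary of the image, where \<open>V\<close> vanishes.\<close>

lemma perturb_in_Emb_bd:
  obtains b where "b > 0" "\<And>t. 0 \<le> t \<Longrightarrow> t < b \<Longrightarrow> \<Phi>t t \<in> Emb_bd M"
proof -
  obtain B where B: "B \<ge> 0"
    "\<And>x v. x \<in> \<Phi> ` M \<Longrightarrow> norm (dV x v) \<le> B * norm v"
    "\<And>x y. x \<in> \<Phi> ` M \<Longrightarrow> y \<in> \<Phi> ` M \<Longrightarrow> norm (V x - V y) \<le> B * norm (x - y)"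
    by (rule smooth_bounds_on_compact[OF smooth_V compact_image]) (rule that)
  have "\<Phi>t t \<in> Emb_bd M" if t: "0 \<le> t" "t < 1 / (B + 1)" for t
  proof -
    have "t * (B + 1) < 1" using t B(1) by (simp add: pos_less_divide_eq)
    then have tB: "t * B < 1" using t by (simp add: algebra_simps)
    \<comment> \<open>A relative perturbation smaller than one cannot cancel a nonzero vector.\<close>
    have zero: "a = 0" if "a = - (t *\<^sub>R c)" "norm c \<le> B * norm a" for a c :: "'n ambient"
    proof -
      have "norm a \<le> (t * B) * norm a"
        using that t(1) mult_left_mono[OF that(2) t(1)] by (simp add: mult.assoc)
      moreover have "(t * B) * norm a < 1 * norm a" if "a \<noteq> 0"
        using tB that by (intro mult_strict_right_mono) auto
      ultimately show ?thesis by fastforce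
    qed
    have inj: "inj_on (\<Phi>t t) M"
    proof (rule inj_onI)
      fix p q assume pq: "p \<in> M" "q \<in> M" "\<Phi>t t p = \<Phi>t t q"
      have "\<Phi> p - \<Phi> q = - (t *\<^sub>R (V (\<Phi> p) - V (\<Phi> q)))"
        using pq by (simp add: perturb_apply algebra_simps)
      then have "\<Phi> p - \<Phi> q = 0" by (rule zero) (use B(3) pq in auto)
      then show "p = q" using embedded_surface.inj[OF embedded_surface_axioms] pq by (simp add: inj_on_def)
    qed
    have smooth_t: "smooth_map_on M (\<Phi>t t)"
      unfolding smooth_map_on_def
    proof
      fix p assume "p \<in> M"
      then obtain U F where U: "open U" "p \<in> U" "smooth_on U F" "\<forall>x\<in>U \<inter> M. F x = \<Phi> x"
        using smooth unfolding smooth_map_on_def by meson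
      have "smooth_on U (\<lambda>x. F x + t *\<^sub>R V (F x))"
        by (rule smooth_on_compose[OF U(1) open_UNIV _ U(3) smooth_on_id_plus_scaleR[OF open_UNIV smooth_V]]) simp
      moreover have "\<forall>x\<in>U \<inter> M. F x + t *\<^sub>R V (F x) = \<Phi>t t x"
        using U(4) by (simp add: perturb_apply)
      ultimately show "\<exists>U F. open U \<and> p \<in> U \<and> smooth_on U F \<and> (\<forall>x\<in>U \<inter> M. F x = \<Phi>t t x)"
        using U(1,2) by (intro exI[of _ U] exI[of _ "\<lambda>x. F x + t *\<^sub>R V (F x)"]) simp
    qed
    have hom: "\<exists>\<psi>. homeomorphism M (\<Phi>t t ` M) (\<Phi>t t) \<psi>"
      by (rule homeomorphism_compact[OF compact smooth_map_on_imp_continuous_on[OF smooth_t] refl inj])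
    have dinj: "inj_on (differential M (\<Phi>t t) p) (tangent_space M p)" if p: "p \<in> M" for p
    proof (rule inj_onI)
      fix v v' assume v: "v \<in> tangent_space M p" "v' \<in> tangent_space M p"
        "differential M (\<Phi>t t) p v = differential M (\<Phi>t t) p v'"
      let ?a = "differential M \<Phi> p v" and ?a' = "differential M \<Phi> p v'"
      have "?a - ?a' = - (t *\<^sub>R dV (\<Phi> p) (?a - ?a'))"
        using v(3) by (simp add: differential_perturb[OF p v(1)] differential_perturb[OF p v(2)]
            linear_diff[OF linear_dV] algebra_simps)
      then have "?a - ?a' = 0" by (rule zero) (use B(2) p in auto)
      then show "v = v'" using inj_differential[OF p] v(1,2) by (simp add: inj_on_def)
    qed
    have bd: "\<Phi>t t p = p" if p: "p \<in> mfd_boundary M" for p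
    proof -
      have "\<Phi> p = p" using Emb_bd p by (simp add: Emb_bd_def)
      moreover have "V (\<Phi> p) = 0" using direction boundary_image[OF p] by (simp add: directions_def)
      ultimately show ?thesis using boundary_subset p by (auto simp: perturb_apply)
    qed
    show ?thesis
      using smooth_t hom dinj bd by (simp add: Emb_bd_def Emb_def perturb_def)
  qed
  then show ?thesis using that[of "1 / (B + 1)"] B(1) by simp
qed

text \<open>Jacobians multiply under composition, and the second factor is the Jacobian of \<open>x \<mapsto> x + t V x\<close> on the
  image surface.\<close>

lemma jacobian_perturb:
  assumes "\<Phi>t t \<in> Emb M" "p \<in> M" "orthonormal_basis_at (\<Phi> ` M) (\<Phi> p) e"
  shows "jacobian M (\<Phi>t t) p = jacobian M \<Phi> p * sqrt (gram (\<lambda>i. e i + t *\<^sub>R dV (\<Phi> p) (e i)))"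
proof -
  interpret t: embedded_surface M "\<Phi>t t" by unfold_locales (rule assms(1))
  obtain \<tau> where \<tau>: "orthonormal_basis_at M p \<tau>" using ex_orthonormal_basis_at[OF submanifold assms(2)] by blast
  then have \<tau>t: "\<tau> i \<in> tangent_space M p" for i by (simp add: orthonormal_basis_at_def)
  let ?L = "\<lambda>v. v + t *\<^sub>R dV (\<Phi> p) v"
  have lin: "linear ?L"
    using linear_dV[of "\<Phi> p"] by (auto simp: linear_iff algebra_simps)
  have "jacobian M (\<Phi>t t) p = sqrt (gram (\<lambda>i. ?L (differential M \<Phi> p (\<tau> i))))"
    using t.jacobian_eq[OF assms(2) \<tau>] by (simp add: differential_perturb[OF assms(2) \<tau>t])
  also have "gram (\<lambda>i. ?L (differential M \<Phi> p (\<tau> i))) = gram (\<lambda>i. differential M \<Phi> p (\<tau> i)) * gram (\<lambda>i. ?L (e i))"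
    by (rule gram_linear_tangent[OF submanifold_image _ assms(3) _ lin])
       (use assms(2) differential_tangent[OF assms(2) \<tau>t] in auto)
  finally show ?thesis using jacobian_eq[OF assms(2) \<tau>] by (simp add: real_sqrt_mult)
qed

end

section \<open>Differentiating the functional\<close>

text \<open>Expanding the square leaves the three terms \<open>G\<^sup>2/(J j)\<close>, \<open>2 G a\<close> and \<open>J j a\<^sup>2\<close>; each is Lipschitz in
  \<open>(j, a)\<close> as long as \<open>j\<close> stays away from zero.\<close>

lemma mismatch_difference_bound:
  fixes J j G a a0 K C m t :: real
  assumes J: "0 < J" "J \<le> m" "1 / J \<le> m" and m: "\<bar>G\<bar> \<le> m" "\<bar>a0\<bar> \<le> m"
    and j: "\<bar>j - 1\<bar> \<le> K * t" "1/2 \<le> j" and a: "\<bar>a - a0\<bar> \<le> C * t"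
    and t: "0 \<le> t" "t \<le> 1" and "0 \<le> K" "0 \<le> C"
  shows "\<bar>1/2 * (J * j) * (G / (J * j) - a)\<^sup>2 - 1/2 * J * (G / J - a0)\<^sup>2\<bar>
    \<le> (m * m * m * (2 * K) + 2 * m * C + m * (K * ((m + C) * (m + C)) + C * (2 * m + C))) * t"
proof -
  have m0: "0 \<le> m" using m(1) by linarith
  have Ct: "C * t \<le> C" using \<open>0 \<le> C\<close> t by (simp add: mult_left_le)
  have aa: "\<bar>a\<bar> \<le> m + C" using a m(2) Ct by linarith
  have id: "1/2 * (J * j) * (G / (J * j) - a)\<^sup>2 - 1/2 * J * (G / J - a0)\<^sup>2 =
      1/2 * ((G * G * (1 / J)) * ((1 - j) / j) - 2 * G * (a - a0) + J * ((j - 1) * (a * a) + (a - a0) * (a + a0)))"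
    using J(1) j(2) by (simp add: field_simps power2_eq_square)
  have 1: "\<bar>(G * G * (1 / J)) * ((1 - j) / j)\<bar> \<le> (m * m * m) * (2 * K * t)"
    unfolding abs_mult
  proof (intro mult_mono)
    show "\<bar>(1 - j) / j\<bar> \<le> 2 * K * t"
    proof -
      have "\<bar>(1 - j) / j\<bar> = \<bar>j - 1\<bar> * (1 / j)" using j(2) by (simp add: abs_minus_commute)
      also have "\<dots> \<le> (K * t) * 2"
        using j by (intro mult_mono) (auto simp: field_simps)
      finally show ?thesis by simp
    qed
  qed (use J m m0 in auto)
  have 2: "\<bar>2 * G * (a - a0)\<bar> \<le> 2 * m * (C * t)"
    unfolding abs_mult using m a m0 by (intro mult_mono) auto
  have 3: "\<bar>(j - 1) * (a * a)\<bar> \<le> (K * t) * ((m + C) * (m + C))"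
    unfolding abs_mult using j aa m0 \<open>0 \<le> C\<close> \<open>0 \<le> K\<close> t by (intro mult_mono) auto
  have 4: "\<bar>(a - a0) * (a + a0)\<bar> \<le> (C * t) * (2 * m + C)"
    unfolding abs_mult using a aa m t \<open>0 \<le> C\<close> by (intro mult_mono) auto
  have 5: "\<bar>J * ((j - 1) * (a * a) + (a - a0) * (a + a0))\<bar> \<le>
      m * ((K * t) * ((m + C) * (m + C)) + (C * t) * (2 * m + C))"
    unfolding abs_mult[of J] using J 3 4 m0 by (intro mult_mono) (auto intro: order_trans[OF abs_triangle_ineq])
  have aux: "\<bar>1/2 * (X - Y + Z)\<bar> \<le> x + y + z"
    if "\<bar>X\<bar> \<le> x" "\<bar>Y\<bar> \<le> y" "\<bar>Z\<bar> \<le> z" for X Y Z x y z :: real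
    using that by (simp add: abs_le_iff)
  show ?thesis
    unfolding id by (rule order_trans[OF aux[OF 1 2 5]]) (simp add: algebra_simps)
qed

lemma mismatch_has_derivative:
  fixes J G :: real
  assumes "J > 0" "(j has_real_derivative d) (at 0)" "j 0 = 1"
    and "(a has_real_derivative a') (at 0 within {0..})"
  shows "((\<lambda>t. 1/2 * (J * j t) * (G / (J * j t) - a t)\<^sup>2) has_real_derivative
    - (J * (1/2 * ((G / J)\<^sup>2 - (a 0)\<^sup>2) * d + (G / J - a 0) * a'))) (at 0 within {0..})"
proof -
  have j: "(j has_real_derivative d) (at 0 within {0..})"
    using assms(2) by (rule has_field_derivative_at_within)
  define x where "x = G / J"
  have u: "((\<lambda>t. J * j t) has_real_derivative J * d) (at 0 within {0..})"
    using DERIV_cmult[OF j] .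
  have q: "((\<lambda>t. G / (J * j t)) has_real_derivative - x * d) (at 0 within {0..})"
    using DERIV_divide[OF DERIV_const u, of G] assms(1,3) by (simp add: x_def)
  have r: "((\<lambda>t. G / (J * j t) - a t) has_real_derivative - x * d - a') (at 0 within {0..})"
    by (rule DERIV_diff[OF q assms(4)])
  have "((\<lambda>t. 1/2 * (J * j t) * ((G / (J * j t) - a t) * (G / (J * j t) - a t))) has_real_derivative
      1/2 * (J * d) * ((x - a 0) * (x - a 0)) +
      ((- x * d - a') * (x - a 0) + (- x * d - a') * (x - a 0)) * (1/2 * (J * 1))) (at 0 within {0..})"
    using DERIV_mult[OF DERIV_cmult[OF u, of "1/2"] DERIV_mult[OF r r]] assms(3) by (simp add: x_def)
  moreover have "1/2 * (J * d) * ((x - a 0) * (x - a 0)) +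
      ((- x * d - a') * (x - a 0) + (- x * d - a') * (x - a 0)) * (1/2 * (J * 1)) =
      - (J * (1/2 * (x\<^sup>2 - (a 0)\<^sup>2) * d + (x - a 0) * a'))"
    by (simp add: algebra_simps power2_eq_square)
  ultimately show ?thesis by (simp only: x_def power2_eq_square)
qed

context embedded_surface
begin

lemma pushed_density_image:
  assumes "orientation_on M ori" "frame_system M ori \<tau> \<sigma>" "\<Phi> \<in> Emb_bd M" "p \<in> M"
  shows "pushed_density M g \<tau> \<sigma> \<Phi> (\<Phi> p) = g p / jacobian M \<Phi> p"
  using det_cov_deriv[OF assms(1), of \<tau> "\<sigma> \<Phi>" p] assms
  by (simp add: pushed_density_def frame_system_def inv_into_f_f[OF inj])

text \<open>Transporting the integral to \<open>M\<close> fixes the domain of integration and removes the inverse of the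
  embedding from the integrand.\<close>

lemma J_functional_pullback:
  assumes "orientation_on M ori" "frame_system M ori \<tau> \<sigma>" "\<Phi> \<in> Emb_bd M"
    and "continuous_on M g" "continuous_on (\<Phi> ` M) (f \<Phi>)"
  shows "J_functional M g f \<tau> \<sigma> \<Phi> =
    (\<integral>p. 1/2 * jacobian M \<Phi> p * (g p / jacobian M \<Phi> p - f \<Phi> (\<Phi> p))\<^sup>2 \<partial>surface_measure M)"
proof -
  let ?F = "\<lambda>s. (pushed_density M g \<tau> \<sigma> \<Phi> s - f \<Phi> s)\<^sup>2"
  let ?\<psi> = "inv_into M \<Phi>"
  have "continuous_on (\<Phi> ` M) (\<lambda>s. (g (?\<psi> s) / jacobian M \<Phi> (?\<psi> s) - f \<Phi> s)\<^sup>2)"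
  proof (intro continuous_intros assms(5))
    have sub: "?\<psi> ` (\<Phi> ` M) \<subseteq> M" by (auto simp: inv_into_f_f[OF inj])
    show "continuous_on (\<Phi> ` M) (\<lambda>s. g (?\<psi> s))"
      by (rule continuous_on_compose2[OF assms(4) continuous_inverse sub])
    show "continuous_on (\<Phi> ` M) (\<lambda>s. jacobian M \<Phi> (?\<psi> s))"
      by (rule continuous_on_compose2[OF continuous_jacobian continuous_inverse sub])
    show "\<forall>s\<in>\<Phi> ` M. jacobian M \<Phi> (?\<psi> s) \<noteq> 0"
      using jacobian_pos by (auto simp: inv_into_f_f[OF inj] less_imp_neq[symmetric])
  qed
  then have "continuous_on (\<Phi> ` M) ?F"
    by (rule continuous_on_eq) (auto simp: pushed_density_image[OF assms(1-3)] inv_into_f_f[OF inj])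
  from integral_surface_image[OF image.continuous_on_measurable[OF this]]
  have "J_functional M g f \<tau> \<sigma> \<Phi> = 1/2 * (\<integral>p. jacobian M \<Phi> p * ?F (\<Phi> p) \<partial>surface_measure M)"
    by (simp add: J_functional_def)
  also have "\<dots> = (\<integral>p. 1/2 * (jacobian M \<Phi> p * ?F (\<Phi> p)) \<partial>surface_measure M)" by simp
  also have "\<dots> = (\<integral>p. 1/2 * jacobian M \<Phi> p * (g p / jacobian M \<Phi> p - f \<Phi> (\<Phi> p))\<^sup>2 \<partial>surface_measure M)"
    by (intro Bochner_Integration.integral_cong refl) (simp add: pushed_density_image[OF assms(1-3)])
  finally show ?thesis .
qed

end

locale perturbed_targets = perturbed_surface M \<Phi> V
  for M :: "('n::finite) ambient set" and \<Phi> V +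
  fixes g :: "'n ambient \<Rightarrow> real" and f :: "('n ambient \<Rightarrow> 'n ambient) \<Rightarrow> 'n ambient \<Rightarrow> real"
  assumes continuous_g: "continuous_on M g"
    and continuous_f: "\<And>\<psi>. \<psi> \<in> Emb_bd M \<Longrightarrow> continuous_on (\<psi> ` M) (f \<psi>)"
    and regular: "materially_regular M f"
begin

text \<open>The integrand of the functional at \<open>\<Phi>t t\<close>, pulled back to \<open>M\<close>.\<close>

definition misfit :: "real \<Rightarrow> 'n ambient \<Rightarrow> real" where
  "misfit t p = 1/2 * jacobian M (\<Phi>t t) p * (g p / jacobian M (\<Phi>t t) p - f (\<Phi>t t) (\<Phi>t t p))\<^sup>2"

text \<open>Up to sign, the derivative of the integrand relative to the surface measure of the image: the integrand
  of the shape derivative formula, evaluated at \<open>\<Phi> p\<close>.\<close>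

definition misfit_deriv :: "'n ambient \<Rightarrow> real" where
  "misfit_deriv p =
     1/2 * ((g p / jacobian M \<Phi> p)\<^sup>2 - (f \<Phi> (\<Phi> p))\<^sup>2) * tang_div (\<Phi> ` M) V (\<Phi> p)
     + (g p / jacobian M \<Phi> p - f \<Phi> (\<Phi> p)) * material_deriv M f \<Phi> V (\<Phi> p)"

text \<open>The very choice made inside \<open>tang_div\<close>, so that the derivative of \<open>stretch\<close> is literally \<open>tang_div\<close>.\<close>

definition frame :: "'n ambient \<Rightarrow> 'n \<Rightarrow> 'n ambient" where
  "frame x = (SOME e. orthonormal_basis_at (\<Phi> ` M) x e)"

text \<open>The Jacobian of \<open>x \<mapsto> x + t V x\<close> on the image surface.\<close>

definition stretch :: "real \<Rightarrow> 'n ambient \<Rightarrow> real" where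
  "stretch t x = sqrt (gram (\<lambda>i. frame x i + t *\<^sub>R dV x (frame x i)))"

lemma frame: "x \<in> \<Phi> ` M \<Longrightarrow> orthonormal_basis_at (\<Phi> ` M) x (frame x)"
  unfolding frame_def using ex_orthonormal_basis_at[OF submanifold_image] by (rule someI_ex)

lemma orthonormal_frame: "x \<in> \<Phi> ` M \<Longrightarrow> orthonormal (frame x)"
  using frame by (simp add: orthonormal_basis_at_iff)

lemma stretch_0: "x \<in> \<Phi> ` M \<Longrightarrow> stretch 0 x = 1"
  by (simp add: stretch_def gram_orthonormal[OF orthonormal_frame])

lemma stretch_has_derivative:
  "x \<in> \<Phi> ` M \<Longrightarrow> ((\<lambda>t. stretch t x) has_real_derivative tang_div (\<Phi> ` M) V x) (at 0)"
  using sqrt_gram_has_derivative[OF orthonormal_frame, of x "\<lambda>i. dV x (frame x i)"]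
  by (simp add: stretch_def tang_div_def frame_def[symmetric] Let_def)

lemma target_has_derivative:
  assumes "p \<in> M"
  shows "((\<lambda>t. f (\<Phi>t t) (\<Phi>t t p)) has_real_derivative material_deriv M f \<Phi> V (\<Phi> p)) (at 0 within {0..})"
proof -
  have "(\<lambda>t. f (\<Phi>t t) (\<Phi> p + t *\<^sub>R V (\<Phi> p))) differentiable (at 0 within {0..})"
    using regular Emb_bd direction assms unfolding materially_regular_def by blast
  then have "((\<lambda>t. f (\<Phi>t t) (\<Phi> p + t *\<^sub>R V (\<Phi> p))) has_vector_derivative
      material_deriv M f \<Phi> V (\<Phi> p)) (at 0 within {0..})"
    unfolding material_deriv_def by (simp add: vector_derivative_works[symmetric])
  then show ?thesis
    using assms by (simp add: has_real_derivative_iff_has_vector_derivative perturb_apply)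
qed

lemma misfit_eq:
  assumes "\<Phi>t t \<in> Emb_bd M" "p \<in> M"
  shows "misfit t p = 1/2 * (jacobian M \<Phi> p * stretch t (\<Phi> p)) *
    (g p / (jacobian M \<Phi> p * stretch t (\<Phi> p)) - f (\<Phi>t t) (\<Phi>t t p))\<^sup>2"
  using jacobian_perturb[OF _ assms(2) frame] assms
  by (simp add: misfit_def stretch_def Emb_bd_def)

lemma misfit_quotient_tendsto:
  assumes "p \<in> M"
  shows "((\<lambda>t. (misfit t p - misfit 0 p) / t) \<longlongrightarrow> - (jacobian M \<Phi> p * misfit_deriv p)) (at_right 0)"
proof -
  let ?k = "\<lambda>t. 1/2 * (jacobian M \<Phi> p * stretch t (\<Phi> p)) *
    (g p / (jacobian M \<Phi> p * stretch t (\<Phi> p)) - f (\<Phi>t t) (\<Phi>t t p))\<^sup>2"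
  have "(?k has_real_derivative - (jacobian M \<Phi> p * misfit_deriv p)) (at 0 within {0..})"
    using mismatch_has_derivative[OF jacobian_pos[OF assms] stretch_has_derivative stretch_0
        target_has_derivative[OF assms], of "\<Phi> p" "g p"] assms
    by (simp add: misfit_deriv_def perturb_0)
  then have "((\<lambda>t. (?k t - ?k 0) / (t - 0)) \<longlongrightarrow> - (jacobian M \<Phi> p * misfit_deriv p)) (at_right 0)"
    by (simp add: has_field_derivative_iff at_within_Ici_at_right)
  moreover obtain b where b: "b > 0" "\<And>t. 0 \<le> t \<Longrightarrow> t < b \<Longrightarrow> \<Phi>t t \<in> Emb_bd M"
    by (rule perturb_in_Emb_bd) (rule that)
  have "(?k t - ?k 0) / (t - 0) = (misfit t p - misfit 0 p) / t" if "0 < t" "t < b" for t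
    using misfit_eq[OF b(2)[of t] assms] misfit_eq[OF b(2)[of 0] assms] that by simp
  then have "\<forall>\<^sub>F t in at_right 0. (?k t - ?k 0) / (t - 0) = (misfit t p - misfit 0 p) / t"
    unfolding eventually_at_right_field using b(1) by blast
  ultimately show ?thesis by (rule Lim_transform_eventually)
qed

lemma bounded_on_M:
  assumes "continuous_on M h"
  obtains m :: real where "\<And>p. p \<in> M \<Longrightarrow> \<bar>h p\<bar> \<le> m"
  using compact_imp_bounded[OF compact_continuous_image[OF assms compact]] unfolding bounded_iff by auto

text \<open>A constant dominating all difference quotients. It combines the uniform estimate for Gram
  determinants, the bound contained in \<open>materially_regular\<close>, and the compactness of \<open>M\<close>.\<close>

lemma misfit_quotient_bound:
  obtains b C where "b > 0" "\<And>t. 0 \<le> t \<Longrightarrow> t < b \<Longrightarrow> \<Phi>t t \<in> Emb_bd M"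
    "\<And>t p. 0 < t \<Longrightarrow> t < b \<Longrightarrow> p \<in> M \<Longrightarrow> \<bar>(misfit t p - misfit 0 p) / t\<bar> \<le> C"
proof -
  obtain B where B: "B \<ge> 0"
    "\<And>x v. x \<in> \<Phi> ` M \<Longrightarrow> norm (dV x v) \<le> B * norm v"
    "\<And>x y. x \<in> \<Phi> ` M \<Longrightarrow> y \<in> \<Phi> ` M \<Longrightarrow> norm (V x - V y) \<le> B * norm (x - y)"
    by (rule smooth_bounds_on_compact[OF smooth_V compact_image]) (rule that)
  obtain K d where K: "d > 0" "K \<ge> 0"
    "\<And>(e::'n \<Rightarrow> 'n ambient) w t. \<lbrakk>orthonormal e; \<forall>i. norm (w i) \<le> B; 0 \<le> t; t < d\<rbrakk>
       \<Longrightarrow> \<bar>sqrt (gram (\<lambda>i. e i + t *\<^sub>R w i)) - 1\<bar> \<le> K * t"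
    by (rule sqrt_gram_uniform_bound[of B]) (rule that)
  obtain C where "\<forall>\<^sub>F t in at_right 0. \<forall>x\<in>\<Phi> ` M. \<bar>f (\<Phi>t t) (x + t *\<^sub>R V x) - f \<Phi> x\<bar> \<le> C * t"
    using regular Emb_bd direction unfolding materially_regular_def by blast
  then obtain c where c: "c > 0" "\<And>t p. 0 < t \<Longrightarrow> t < c \<Longrightarrow> p \<in> M \<Longrightarrow>
      \<bar>f (\<Phi>t t) (\<Phi>t t p) - f \<Phi> (\<Phi> p)\<bar> \<le> C * t"
    unfolding eventually_at_right_field by (auto simp: perturb_apply)
  obtain b where b: "b > 0" "\<And>t. 0 \<le> t \<Longrightarrow> t < b \<Longrightarrow> \<Phi>t t \<in> Emb_bd M"
    by (rule perturb_in_Emb_bd) (rule that)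
  obtain m1 where m1: "\<And>p. p \<in> M \<Longrightarrow> \<bar>g p\<bar> \<le> m1" by (rule bounded_on_M[OF continuous_g]) (rule that)
  obtain m2 where m2: "\<And>p. p \<in> M \<Longrightarrow> \<bar>jacobian M \<Phi> p\<bar> \<le> m2"
    by (rule bounded_on_M[OF continuous_jacobian]) (rule that)
  have "continuous_on M (\<lambda>p. 1 / jacobian M \<Phi> p)"
    using jacobian_pos by (intro continuous_intros continuous_jacobian) (auto simp: less_imp_neq[symmetric])
  then obtain m3 where m3: "\<And>p. p \<in> M \<Longrightarrow> \<bar>1 / jacobian M \<Phi> p\<bar> \<le> m3"
    by (rule bounded_on_M) (rule that)
  have "continuous_on M (\<lambda>p. f \<Phi> (\<Phi> p))"
    by (rule continuous_on_compose2[OF continuous_f[OF Emb_bd] continuous]) simp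
  then obtain m4 where m4: "\<And>p. p \<in> M \<Longrightarrow> \<bar>f \<Phi> (\<Phi> p)\<bar> \<le> m4" by (rule bounded_on_M) (rule that)
  define m where "m = max (max m1 m2) (max m3 m4)"
  \<comment> \<open>The last entry keeps \<open>K * t \<le> 1/2\<close>, so that the stretch factor is at least \<open>1/2\<close>.\<close>
  define b' where "b' = Min {b, c, d, 1 / (2 * (K + 1))}"
  have b': "b' > 0" "b' \<le> b" "b' \<le> c" "b' \<le> d" "b' \<le> 1 / (2 * (K + 1))"
    using b(1) c(1) K(1,2) by (auto simp: b'_def)
  have "1 / (2 * (K + 1)) \<le> 1" using K(2) by (simp add: divide_le_eq)
  then have b'1: "b' \<le> 1" using b'(5) by linarith
  define R where "R = m * m * m * (2 * K) + 2 * m * \<bar>C\<bar> + m * (K * ((m + \<bar>C\<bar>) * (m + \<bar>C\<bar>)) + \<bar>C\<bar> * (2 * m + \<bar>C\<bar>))"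
  show ?thesis
  proof (rule that[of b' R])
    show "b' > 0" "\<And>t. 0 \<le> t \<Longrightarrow> t < b' \<Longrightarrow> \<Phi>t t \<in> Emb_bd M" using b' b(2) by auto
    fix t p assume t: "0 < t" "t < b'" and p: "p \<in> M"
    have x: "\<Phi> p \<in> \<Phi> ` M" using p by blast
    have "norm (frame (\<Phi> p) i) = 1" for i
      using orthonormal_frame[OF x] by (simp add: orthonormal_def norm_eq_1)
    then have "norm (dV (\<Phi> p) (frame (\<Phi> p) i)) \<le> B" for i
      using B(2)[OF x, of "frame (\<Phi> p) i"] by simp
    then have j: "\<bar>stretch t (\<Phi> p) - 1\<bar> \<le> K * t"
      unfolding stretch_def using t b' by (intro K(3) orthonormal_frame x) auto
    have "t < 1 / (2 * (K + 1))" using t b'(5) by linarith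
    then have "t * (2 * (K + 1)) < 1" using K(2) by (simp add: pos_less_divide_eq)
    then have "K * t \<le> 1/2" using t(1) by (simp add: algebra_simps)
    then have j2: "1/2 \<le> stretch t (\<Phi> p)" using j by linarith
    have a: "\<bar>f (\<Phi>t t) (\<Phi>t t p) - f \<Phi> (\<Phi> p)\<bar> \<le> \<bar>C\<bar> * t"
    proof -
      have "\<bar>f (\<Phi>t t) (\<Phi>t t p) - f \<Phi> (\<Phi> p)\<bar> \<le> C * t" using c(2) t b'(3) p by simp
      also have "\<dots> \<le> \<bar>C\<bar> * t" using t(1) by (intro mult_right_mono) auto
      finally show ?thesis .
    qed
    have "misfit 0 p = 1/2 * jacobian M \<Phi> p * (g p / jacobian M \<Phi> p - f \<Phi> (\<Phi> p))\<^sup>2"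
      by (simp add: misfit_def perturb_0)
    moreover have "misfit t p = 1/2 * (jacobian M \<Phi> p * stretch t (\<Phi> p)) *
      (g p / (jacobian M \<Phi> p * stretch t (\<Phi> p)) - f (\<Phi>t t) (\<Phi>t t p))\<^sup>2"
      by (rule misfit_eq) (use b(2) b'(2) t p in auto)
    moreover have "\<bar>1/2 * (jacobian M \<Phi> p * stretch t (\<Phi> p)) *
        (g p / (jacobian M \<Phi> p * stretch t (\<Phi> p)) - f (\<Phi>t t) (\<Phi>t t p))\<^sup>2
        - 1/2 * jacobian M \<Phi> p * (g p / jacobian M \<Phi> p - f \<Phi> (\<Phi> p))\<^sup>2\<bar> \<le> R * t"
      unfolding R_def
      by (rule mismatch_difference_bound)
         (use jacobian_pos[OF p] m1[OF p] m2[OF p] m3[OF p] m4[OF p] j j2 a t b'1 K(2) in \<open>auto simp: m_def\<close>)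
    ultimately have "\<bar>misfit t p - misfit 0 p\<bar> \<le> R * t" by simp
    then show "\<bar>(misfit t p - misfit 0 p) / t\<bar> \<le> R"
      using t(1) by (simp add: abs_divide pos_divide_le_eq)
  qed
qed

lemma continuous_misfit:
  assumes "\<Phi>t t \<in> Emb_bd M"
  shows "continuous_on M (misfit t)"
proof -
  interpret t: embedded_surface M "\<Phi>t t" by unfold_locales (use assms in \<open>simp add: Emb_bd_def\<close>)
  have "continuous_on M (\<lambda>p. f (\<Phi>t t) (\<Phi>t t p))"
    by (rule continuous_on_compose2[OF continuous_f[OF assms] t.continuous]) simp
  then show ?thesis
    unfolding misfit_def[abs_def] using t.jacobian_pos
    by (intro continuous_intros t.continuous_jacobian continuous_g) (auto simp: less_imp_neq[symmetric])
qed

lemma integrable_continuous_on: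
  fixes h :: "'n ambient \<Rightarrow> real"
  assumes "continuous_on M h"
  shows "integrable (surface_measure M) h"
proof -
  obtain m where "\<And>p. p \<in> M \<Longrightarrow> \<bar>h p\<bar> \<le> m" by (rule bounded_on_M[OF assms]) (rule that)
  then show ?thesis
    by (intro finite_measure.integrable_const_bound[OF finite_surface_measure, of _ m] AE_I2
        continuous_on_measurable assms) simp
qed

text \<open>Dominated convergence on a finite measure space. The limit, which
  contains the divergence and the material derivative, is measurable as a pointwise limit of difference
  quotients, which are continuous functions on \<open>M\<close>.\<close>

lemma integral_misfit_differentiable:
  shows "integrable (surface_measure M) (\<lambda>p. jacobian M \<Phi> p * misfit_deriv p)"
    and "((\<lambda>t. ((\<integral>p. misfit t p \<partial>surface_measure M) - (\<integral>p. misfit 0 p \<partial>surface_measure M)) / t) \<longlongrightarrow>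
      - (\<integral>p. jacobian M \<Phi> p * misfit_deriv p \<partial>surface_measure M)) (at_right 0)"
proof -
  let ?S = "surface_measure M"
  let ?D = "\<lambda>p. - (jacobian M \<Phi> p * misfit_deriv p)"
  obtain b C where b: "b > 0" "\<And>t. 0 \<le> t \<Longrightarrow> t < b \<Longrightarrow> \<Phi>t t \<in> Emb_bd M"
    and C: "\<And>t p. 0 < t \<Longrightarrow> t < b \<Longrightarrow> p \<in> M \<Longrightarrow> \<bar>(misfit t p - misfit 0 p) / t\<bar> \<le> C"
    by (rule misfit_quotient_bound) (rule that)
  have meas: "misfit t \<in> borel_measurable ?S" "integrable ?S (misfit t)" if "0 \<le> t" "t < b" for t
    using continuous_misfit[OF b(2)[OF that]] continuous_on_measurable integrable_continuous_on by auto
  have main: "integrable ?S ?D \<and>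
      (\<lambda>n. ((\<integral>p. misfit (S n) p \<partial>?S) - (\<integral>p. misfit 0 p \<partial>?S)) / S n) \<longlonglongrightarrow> (\<integral>p. ?D p \<partial>?S)"
    if S: "\<And>n. 0 < S n" "\<And>n. S n < b" "S \<longlonglongrightarrow> 0" for S :: "nat \<Rightarrow> real"
  proof -
    let ?s = "\<lambda>n p. (misfit (S n) p - misfit 0 p) / S n"
    have "S n \<noteq> 0" for n using S(1)[of n] by simp
    then have fl: "filterlim S (at_right 0) sequentially"
      using S by (auto simp: filterlim_at intro!: always_eventually)
    have lim: "(\<lambda>n. ?s n p) \<longlonglongrightarrow> ?D p" if "p \<in> M" for p
      using filterlim_compose[OF misfit_quotient_tendsto[OF that] fl] .
    have ms: "?s n \<in> borel_measurable ?S" for n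
      using meas(1)[of "S n"] meas(1)[of 0] S(1,2)[of n] b(1) by simp
    have mD: "?D \<in> borel_measurable ?S"
      by (rule borel_measurable_LIMSEQ_real[OF _ ms]) (use lim in simp)
    have w: "integrable ?S (\<lambda>p. C)"
      using finite_measure.integrable_const[OF finite_surface_measure] by blast
    have bnd: "AE p in ?S. norm (?s n p) \<le> C" for n
      using C[OF S(1,2)] by (intro AE_I2) simp
    have AElim: "AE p in ?S. (\<lambda>n. ?s n p) \<longlonglongrightarrow> ?D p" using lim by (intro AE_I2) simp
    have lims: "integrable ?S ?D" "(\<lambda>n. \<integral>p. ?s n p \<partial>?S) \<longlonglongrightarrow> (\<integral>p. ?D p \<partial>?S)"
      using integrable_dominated_convergence[OF mD ms w AElim bnd]
        integral_dominated_convergence[OF mD ms w AElim bnd] by blast+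
    have eq: "(\<integral>p. ?s n p \<partial>?S) = ((\<integral>p. misfit (S n) p \<partial>?S) - (\<integral>p. misfit 0 p \<partial>?S)) / S n" for n
      using meas(2)[of "S n"] meas(2)[of 0] S(1,2)[of n] b(1) by simp
    show ?thesis using lims(1) lims(2)[unfolded eq] by blast
  qed
  \<comment> \<open>Any null sequence in the open interval from \<open>0\<close> to \<open>b\<close> yields integrability of the limit.\<close>
  let ?h = "\<lambda>n. b / 2 * inverse (real (Suc n))"
  have "?h \<longlonglongrightarrow> 0" by (rule tendsto_mult_right_zero[OF LIMSEQ_inverse_real_of_nat])
  moreover have "0 < ?h n" "?h n < b" for n
  proof -
    show "0 < ?h n" using b(1) by simp
    have "?h n \<le> b / 2 * 1" using b(1) by (intro mult_left_mono) (auto simp: inverse_le_1_iff)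
    then show "?h n < b" using b(1) by simp
  qed
  ultimately have "integrable ?S ?D" using main[of ?h] by blast
  then show "integrable ?S (\<lambda>p. jacobian M \<Phi> p * misfit_deriv p)" by simp
  show "((\<lambda>t. ((\<integral>p. misfit t p \<partial>?S) - (\<integral>p. misfit 0 p \<partial>?S)) / t) \<longlongrightarrow>
      - (\<integral>p. jacobian M \<Phi> p * misfit_deriv p \<partial>?S)) (at_right 0)"
    by (rule tendsto_at_right_sequentially[OF b(1)]) (use main in simp)
qed

lemma preshape_derivative:
  assumes ori: "orientation_on M ori" and frames: "frame_system M ori \<tau> \<sigma>"
  defines "h \<equiv> \<lambda>s. 1 / 2 * ((pushed_density M g \<tau> \<sigma> \<Phi> s)\<^sup>2 - (f \<Phi> s)\<^sup>2) * tang_div (\<Phi> ` M) V s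
      + (pushed_density M g \<tau> \<sigma> \<Phi> s - f \<Phi> s) * material_deriv M f \<Phi> V s"
  shows "integrable (surface_measure (\<Phi> ` M)) h"
    and "(\<integral>s. h s \<partial>surface_measure (\<Phi> ` M)) = (\<integral>p. jacobian M \<Phi> p * misfit_deriv p \<partial>surface_measure M)"
    and "has_preshape_deriv M (J_functional M g f \<tau> \<sigma>) \<Phi> V (- (\<integral>s. h s \<partial>surface_measure (\<Phi> ` M)))"
proof -
  let ?S = "surface_measure M" and ?N = "surface_measure (\<Phi> ` M)"
  have h: "h (\<Phi> p) = misfit_deriv p" if "p \<in> M" for p
    by (simp add: h_def misfit_deriv_def pushed_density_image[OF ori frames Emb_bd that])
  note int = integral_misfit_differentiable
  have "misfit_deriv \<in> borel_measurable ?S"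
  proof -
    have "(\<lambda>p. (jacobian M \<Phi> p * misfit_deriv p) / jacobian M \<Phi> p) \<in> borel_measurable ?S"
      using borel_measurable_integrable[OF int(1)] measurable_jacobian by (rule borel_measurable_divide)
    then show ?thesis
      by (rule measurable_cong[THEN iffD1, rotated]) (use jacobian_pos in \<open>auto simp: less_imp_neq[symmetric]\<close>)
  qed
  then have "(\<lambda>s. misfit_deriv (inv_into M \<Phi> s)) \<in> borel_measurable ?N"
    using measurable_compose[OF measurable_inverse] by blast
  then have hm: "h \<in> borel_measurable ?N"
    by (rule measurable_cong[THEN iffD1, rotated]) (auto simp: h inv_into_f_f[OF inj])
  have "integrable ?S (\<lambda>p. jacobian M \<Phi> p * h (\<Phi> p)) \<longleftrightarrow> integrable ?S (\<lambda>p. jacobian M \<Phi> p * misfit_deriv p)"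
    by (rule Bochner_Integration.integrable_cong) (simp_all add: h)
  then show "integrable ?N h" using integrable_surface_image[OF hm] int(1) by simp
  have "(\<integral>p. jacobian M \<Phi> p * h (\<Phi> p) \<partial>?S) = (\<integral>p. jacobian M \<Phi> p * misfit_deriv p \<partial>?S)"
    by (rule Bochner_Integration.integral_cong) (simp_all add: h)
  then show eq: "(\<integral>s. h s \<partial>?N) = (\<integral>p. jacobian M \<Phi> p * misfit_deriv p \<partial>?S)"
    using integral_surface_image[OF hm] by simp
  obtain b where b: "b > 0" "\<And>t. 0 \<le> t \<Longrightarrow> t < b \<Longrightarrow> \<Phi>t t \<in> Emb_bd M"
    by (rule perturb_in_Emb_bd) (rule that)
  have J: "J_functional M g f \<tau> \<sigma> (\<Phi>t t) = (\<integral>p. misfit t p \<partial>?S)" if "0 \<le> t" "t < b" for t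
  proof -
    note E = b(2)[OF that]
    interpret t: embedded_surface M "\<Phi>t t" by unfold_locales (use E in \<open>simp add: Emb_bd_def\<close>)
    show ?thesis
      using t.J_functional_pullback[OF ori frames E continuous_g, where f = f, OF continuous_f[OF E]] by (simp add: misfit_def)
  qed
  have "J_functional M g f \<tau> \<sigma> \<Phi> = (\<integral>p. misfit 0 p \<partial>?S)"
    using J[of 0] b(1) perturb_0 by simp
  then have "\<forall>\<^sub>F t in at_right 0. ((\<integral>p. misfit t p \<partial>?S) - (\<integral>p. misfit 0 p \<partial>?S)) / t =
      (J_functional M g f \<tau> \<sigma> (\<Phi>t t) - J_functional M g f \<tau> \<sigma> \<Phi>) / t"
    unfolding eventually_at_right_field using J b(1) by (intro exI[of _ b]) simp
  with int(2) show "has_preshape_deriv M (J_functional M g f \<tau> \<sigma>) \<Phi> V (- (\<integral>s. h s \<partial>?N))"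
    unfolding has_preshape_deriv_def eq by (rule Lim_transform_eventually)
qed

end

lemma preshape_deriv_eqI: "has_preshape_deriv M J \<phi> V D \<Longrightarrow> preshape_deriv M J \<phi> V = D"
  unfolding has_preshape_deriv_def preshape_deriv_def by (rule tendsto_Lim) simp_all

theorem theorem2:
  fixes M :: "(real ^ ('n::finite option)) set"
    and ori :: "real ^ ('n option) \<Rightarrow> ('n \<Rightarrow> real ^ ('n option)) set"
    and g :: "real ^ ('n option) \<Rightarrow> real"
    and f :: "(real ^ ('n option) \<Rightarrow> real ^ ('n option)) \<Rightarrow> real ^ ('n option) \<Rightarrow> real"
    and \<phi> V :: "real ^ ('n option) \<Rightarrow> real ^ ('n option)"
  assumes "submanifold M" and "compact M" and "path_connected M"
    and "orientation_on M ori"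
    and "smooth_map_on M g" and "\<forall>p\<in>M. g p > 0"
    and "\<forall>\<psi>\<in>Emb_bd M. smooth_map_on (\<psi> ` M) (f \<psi>) \<and> (\<forall>x\<in>\<psi> ` M. f \<psi> x > 0)"
    and "shape_functionality M f"
    and "\<forall>\<psi>\<in>Emb_bd M.
           (\<integral>s. f \<psi> s \<partial>surface_measure (\<psi> ` M)) = (\<integral>s. g s \<partial>surface_measure M)"
    and "materially_regular M f"
    and "\<phi> \<in> Emb_bd M" and "V \<in> directions M \<phi>"
  shows "(\<forall>\<tau> \<sigma>. frame_system M ori \<tau> \<sigma> \<longrightarrow>
            (let q = pushed_density M g \<tau> \<sigma> \<phi>;
                 h = (\<lambda>s. 1 / 2 * ((q s)\<^sup>2 - (f \<phi> s)\<^sup>2) * tang_div (\<phi> ` M) V s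
                          + (q s - f \<phi> s) * material_deriv M f \<phi> V s)
             in integrable (surface_measure (\<phi> ` M)) h \<and>
                has_preshape_deriv M (J_functional M g f \<tau> \<sigma>) \<phi> V
                  (- (\<integral>s. h s \<partial>surface_measure (\<phi> ` M)))))
         \<and> (\<forall>\<tau> \<sigma> \<tau>' \<sigma>'. frame_system M ori \<tau> \<sigma> \<longrightarrow> frame_system M ori \<tau>' \<sigma>' \<longrightarrow>
              preshape_deriv M (J_functional M g f \<tau> \<sigma>) \<phi> V =
              preshape_deriv M (J_functional M g f \<tau>' \<sigma>') \<phi> V)"
proof -
  interpret perturbed_targets M \<phi> V g f
  proof unfold_locales
    show "\<phi> \<in> Emb M" using assms by (simp add: Emb_bd_def)
    show "continuous_on M g" using assms by (blast intro: smooth_map_on_imp_continuous_on)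
    show "continuous_on (\<psi> ` M) (f \<psi>)" if "\<psi> \<in> Emb_bd M" for \<psi>
      using assms that by (blast intro: smooth_map_on_imp_continuous_on)
  qed fact+
  note d = preshape_derivative[OF \<open>orientation_on M ori\<close>]
  have "preshape_deriv M (J_functional M g f \<tau> \<sigma>) \<phi> V =
      - (\<integral>p. jacobian M \<phi> p * misfit_deriv p \<partial>surface_measure M)"
    if "frame_system M ori \<tau> \<sigma>" for \<tau> \<sigma>
    using preshape_deriv_eqI[OF d(3)[OF that]] d(2)[OF that] by simp
  then show ?thesis using d(1,3) by (simp add: Let_def)
qed

end
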